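(* Let $K,\kappa\in\mathbb R$, $N\in[1,\infty)$, and let $(X,d,m)$ be a metric measure space which satisfies $\mathrm{RCD}(K,N)$ and such that $(X,d)$ is $\mathrm{CAT}(\kappa)$. Let $\gamma:[0,1]\to X$ be a geodesic and let $0<s_0<1/2$. Then for any $\varepsilon>0$ there are $\delta>0$ and $r_0>0$ such that for all $0<r<r_0$ and all $t,t'\in[s_0,1-s_0]$ with $|t-t'|<\delta$, $$\mathbf D\left(\Big(\tfrac1r\bar B_r(\gamma(t)),\tfrac{1}{m(\bar B_r(\gamma(t)))}m|_{\bar B_r(\gamma(t))}\Big),\Big(\tfrac1r\bar B_r(\gamma(t')),\tfrac{1}{m(\bar B_r(\gamma(t')))}m|_{\bar B_r(\gamma(t'))}\Big)\right)<\varepsilon.$$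
   Context: A metric measure space is a triple $(X,d,m)$ with $(X,d)$ complete separable and $m$ a locally finite Borel measure; it is assumed that $\operatorname{supp} m=X$. $\mathrm{RCD}(K,N)$ means the Lott--Sturm--Villani curvature-dimension condition $\mathrm{CD}(K,N)$ together with infinitesimal Hilbertianity. Geodesics are shortest curves parametrized on $[0,1]$ with constant speed. $\frac1r\bar B_r(x)$ denotes the closed ball $\bar B_r(x)\subset X$ equipped with the rescaled metric $\frac1r d$. $\mathbf D$ is Sturm's transport distance between normalized metric measure spaces: $\mathbf D((Y,d_Y,\mu),(Z,d_Z,\nu))$ is the infimum, over all metric spaces $(W,d_W)$ and isometric embeddings $\iota:\operatorname{supp}\mu\to W$, $\iota':\operatorname{supp}\nu\to W$, of the $L^2$-Wasserstein distance between $\iota_\#\mu$ and $\iota'_\#\nu$ in $W$. *)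

theory Defs
  imports "HOL-Probability.Probability"
begin

text \<open>Metric spaces are elements of the library type \<open>'a metric\<close>; measures on them live on
  the Borel \<open>\<sigma>\<close>-algebra of the metric topology.\<close>

section \<open>Metric measure spaces\<close>

definition metric_borel :: "'a metric \<Rightarrow> 'a measure" where
  "metric_borel X = sigma (mspace X) {U. openin (mtopology_of X) U}"

definition measure_support :: "'a metric \<Rightarrow> 'a measure \<Rightarrow> 'a set" where
  "measure_support X \<mu> = {x \<in> mspace X. \<forall>r>0. emeasure \<mu> (mball_of X x r) > 0}"

locale metric_measure_space =
  fixes X :: "'a metric" and m :: "'a measure"
  assumes complete: "mcomplete_of X"
    and separable: "separable_space (mtopology_of X)"
    and sets_eq: "sets m = sets (metric_borel X)"
    and locally_finite: "x \<in> mspace X \<Longrightarrow> \<exists>r>0. emeasure m (mball_of X x r) < \<infinity>"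
    and full_support: "measure_support X m = mspace X"

text \<open>Shortest curves on \<open>[0,1]\<close> of constant speed; the length of \<open>c\<close> is then the distance
  of its endpoints. Constant curves are included.\<close>

definition is_geodesic :: "'a metric \<Rightarrow> (real \<Rightarrow> 'a) \<Rightarrow> bool" where
  "is_geodesic X c \<longleftrightarrow>
     (\<forall>t\<in>{0..1}. c t \<in> mspace X) \<and>
     (\<forall>s\<in>{0..1}. \<forall>t\<in>{0..1}. mdist X (c s) (c t) = \<bar>s - t\<bar> * mdist X (c 0) (c 1))"


section \<open>The \<open>L\<^sup>2\<close>-Wasserstein distance\<close>

definition ennreal_sqrt :: "ennreal \<Rightarrow> ennreal" where
  "ennreal_sqrt x = (if x = \<infinity> then \<infinity> else ennreal (sqrt (enn2real x)))"

definition couplings :: "'a metric \<Rightarrow> 'a measure \<Rightarrow> 'a measure \<Rightarrow> ('a \<times> 'a) measure set" where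
  "couplings X \<mu> \<nu> =
     {\<pi>. sets \<pi> = sets (metric_borel X \<Otimes>\<^sub>M metric_borel X) \<and>
         distr \<pi> (metric_borel X) fst = \<mu> \<and> distr \<pi> (metric_borel X) snd = \<nu>}"

definition transport_cost :: "'a metric \<Rightarrow> ('a \<times> 'a) measure \<Rightarrow> ennreal" where
  "transport_cost X \<pi> = (\<integral>\<^sup>+(x, y). ennreal ((mdist X x y)\<^sup>2) \<partial>\<pi>)"

definition wasserstein :: "'a metric \<Rightarrow> 'a measure \<Rightarrow> 'a measure \<Rightarrow> ennreal" where
  "wasserstein X \<mu> \<nu> = ennreal_sqrt (INF \<pi> \<in> couplings X \<mu> \<nu>. transport_cost X \<pi>)"

definition optimal_coupling ::
    "'a metric \<Rightarrow> 'a measure \<Rightarrow> 'a measure \<Rightarrow> ('a \<times> 'a) measure \<Rightarrow> bool" where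
  "optimal_coupling X \<mu> \<nu> \<pi> \<longleftrightarrow>
     \<pi> \<in> couplings X \<mu> \<nu> \<and> (\<forall>\<pi>'\<in>couplings X \<mu> \<nu>. transport_cost X \<pi> \<le> transport_cost X \<pi>')"


section \<open>The curvature-dimension condition\<close>

text \<open>Absolutely continuous probability measures with finite second moment.\<close>

definition P2_ac :: "'a metric \<Rightarrow> 'a measure \<Rightarrow> 'a measure set" where
  "P2_ac X m =
     {\<mu>. sets \<mu> = sets (metric_borel X) \<and> prob_space \<mu> \<and>
         (\<exists>x0\<in>mspace X. (\<integral>\<^sup>+x. ennreal ((mdist X x0 x)\<^sup>2) \<partial>\<mu>) < \<infinity>) \<and>
         absolutely_continuous m \<mu>}"

text \<open>The density as a real function. Any choice of representative is only relevant up to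
  \<open>m\<close>-null sets, and the density of a probability measure is finite \<open>m\<close>-almost everywhere.\<close>

definition real_density :: "'a measure \<Rightarrow> 'a measure \<Rightarrow> 'a \<Rightarrow> real" where
  "real_density m \<mu> x = enn2real (RN_deriv m \<mu> x)"

text \<open>\<open>S\<^sub>N(\<mu>|m) = - \<integral> \<rho>\<^bsup>1 - 1/N\<^esup> dm\<close> for \<open>\<mu> = \<rho> m\<close>. Since \<open>0 powr 0 = 0\<close>,
  for \<open>N = 1\<close> this is \<open>- m{\<rho> > 0}\<close>, the usual convention.\<close>

definition renyi_entropy :: "real \<Rightarrow> 'a measure \<Rightarrow> 'a measure \<Rightarrow> ereal" where
  "renyi_entropy N m \<mu> = - enn2ereal (\<integral>\<^sup>+x. ennreal (real_density m \<mu> x powr (1 - 1/N)) \<partial>m)"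

text \<open>The distortion coefficients \<open>\<tau>\<^sub>K\<^sub>,\<^sub>N\<^bsup>(t)\<^esup>(\<theta>)\<close>. The case \<open>K \<theta>\<^sup>2 = 0\<close> takes precedence,
  so that the value there is \<open>t\<close> also for \<open>N = 1\<close>.\<close>

definition distortion :: "real \<Rightarrow> real \<Rightarrow> real \<Rightarrow> real \<Rightarrow> ennreal" where
  "distortion K N t \<theta> =
    (if K * \<theta>\<^sup>2 = 0 then ennreal t
     else if K * \<theta>\<^sup>2 \<ge> (N - 1) * pi\<^sup>2 then \<infinity>
     else if K * \<theta>\<^sup>2 > 0 then
       ennreal (t powr (1/N) *
         (sin (t * \<theta> * sqrt (K / (N - 1))) / sin (\<theta> * sqrt (K / (N - 1)))) powr (1 - 1/N))
     else if N = 1 then ennreal t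
     else
       ennreal (t powr (1/N) *
         (sinh (t * \<theta> * sqrt (- K / (N - 1))) / sinh (\<theta> * sqrt (- K / (N - 1)))) powr (1 - 1/N)))"

text \<open>Sturm's definition of \<open>CD(K,N)\<close>, which asks for the inequality for all \<open>N' \<ge> N\<close>.
  The densities \<open>\<rho>\<^sub>0(x)\<close> and \<open>\<rho>\<^sub>1(y)\<close> are positive for almost every \<open>(x,y)\<close> with respect to \<open>\<pi>\<close>,
  so the negative powers are evaluated at positive arguments only.\<close>

definition CD :: "real \<Rightarrow> real \<Rightarrow> 'a metric \<Rightarrow> 'a measure \<Rightarrow> bool" where
  "CD K N X m \<longleftrightarrow>
     (\<forall>\<mu>0\<in>P2_ac X m. \<forall>\<mu>1\<in>P2_ac X m. \<exists>\<pi> \<Gamma>.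
        optimal_coupling X \<mu>0 \<mu>1 \<pi> \<and>
        \<Gamma> 0 = \<mu>0 \<and> \<Gamma> 1 = \<mu>1 \<and>
        (\<forall>t\<in>{0..1}. \<Gamma> t \<in> P2_ac X m) \<and>
        (\<forall>s\<in>{0..1}. \<forall>t\<in>{0..1}.
           wasserstein X (\<Gamma> s) (\<Gamma> t) = ennreal \<bar>s - t\<bar> * wasserstein X \<mu>0 \<mu>1) \<and>
        (\<forall>t\<in>{0..1::real}. \<forall>N'\<ge>N.
           renyi_entropy N' m (\<Gamma> t) \<le>
           - enn2ereal (\<integral>\<^sup>+(x, y).
                 distortion K N' (1 - t) (mdist X x y) * ennreal (real_density m \<mu>0 x powr (- 1/N'))
               + distortion K N' t (mdist X x y) * ennreal (real_density m \<mu>1 y powr (- 1/N')) \<partial>\<pi>)))"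


section \<open>Infinitesimal Hilbertianity\<close>

definition L2_fun :: "'a measure \<Rightarrow> ('a \<Rightarrow> real) \<Rightarrow> bool" where
  "L2_fun m f \<longleftrightarrow> f \<in> borel_measurable m \<and> (\<integral>\<^sup>+x. ennreal ((f x)\<^sup>2) \<partial>m) < \<infinity>"

text \<open>The local Lipschitz constant; it is \<open>0\<close> at isolated points.\<close>

definition local_slope :: "'a metric \<Rightarrow> ('a \<Rightarrow> real) \<Rightarrow> 'a \<Rightarrow> ennreal" where
  "local_slope X f x =
     Limsup (atin (mtopology_of X) x) (\<lambda>y. ennreal (\<bar>f y - f x\<bar> / mdist X y x))"

definition cheeger_energy :: "'a metric \<Rightarrow> 'a measure \<Rightarrow> ('a \<Rightarrow> real) \<Rightarrow> ennreal" where
  "cheeger_energy X m f =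
     (INF F \<in> {F :: nat \<Rightarrow> 'a \<Rightarrow> real.
                (\<forall>n. Lipschitz_continuous_map X euclidean_metric (F n) \<and> L2_fun m (F n)) \<and>
                (\<lambda>n. \<integral>\<^sup>+x. ennreal ((F n x - f x)\<^sup>2) \<partial>m) \<longlonglongrightarrow> 0}.
        liminf (\<lambda>n. (\<integral>\<^sup>+x. (local_slope X (F n) x)\<^sup>2 \<partial>m) / 2))"

definition sobolev :: "'a metric \<Rightarrow> 'a measure \<Rightarrow> ('a \<Rightarrow> real) set" where
  "sobolev X m = {f. L2_fun m f \<and> cheeger_energy X m f < \<infinity>}"

definition sobolev_norm :: "'a metric \<Rightarrow> 'a measure \<Rightarrow> ('a \<Rightarrow> real) \<Rightarrow> real" where
  "sobolev_norm X m f =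
     sqrt (enn2real ((\<integral>\<^sup>+x. ennreal ((f x)\<^sup>2) \<partial>m) + 2 * cheeger_energy X m f))"

text \<open>\<open>W\<^bsup>1,2\<^esup>(X,d,m)\<close> is a Hilbert space: its norm comes from an inner product and is complete.
  Functions are not identified up to null sets, so the norm and \<open>B\<close> are only semi-definite here.\<close>

definition infinitesimally_hilbertian :: "'a metric \<Rightarrow> 'a measure \<Rightarrow> bool" where
  "infinitesimally_hilbertian X m \<longleftrightarrow>
     (\<exists>B. (\<forall>f\<in>sobolev X m. \<forall>g\<in>sobolev X m. B f g = B g f) \<and>
          (\<forall>f\<in>sobolev X m. \<forall>g\<in>sobolev X m. \<forall>h\<in>sobolev X m. \<forall>a b.
             B (\<lambda>x. a * f x + b * g x) h = a * B f h + b * B g h) \<and>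
          (\<forall>f\<in>sobolev X m. sobolev_norm X m f = sqrt (B f f) \<and> B f f \<ge> 0)) \<and>
     (\<forall>F :: nat \<Rightarrow> 'a \<Rightarrow> real.
        (\<forall>n. F n \<in> sobolev X m) \<and>
        (\<forall>e>0. \<exists>n0. \<forall>i\<ge>n0. \<forall>j\<ge>n0. sobolev_norm X m (\<lambda>x. F i x - F j x) < e) \<longrightarrow>
        (\<exists>f\<in>sobolev X m. (\<lambda>n. sobolev_norm X m (\<lambda>x. F n x - f x)) \<longlonglongrightarrow> 0))"

definition RCD :: "real \<Rightarrow> real \<Rightarrow> 'a metric \<Rightarrow> 'a measure \<Rightarrow> bool" where
  "RCD K N X m \<longleftrightarrow> CD K N X m \<and> infinitesimally_hilbertian X m"


section \<open>\<open>CAT(\<kappa>)\<close> spaces\<close>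

text \<open>The simply connected surface of constant curvature \<open>\<kappa>\<close>, realised in \<open>\<real>\<^sup>3\<close>: unit sphere,
  plane, or upper sheet of the hyperboloid, with the appropriately scaled metric.\<close>

definition model_plane :: "real \<Rightarrow> (real \<times> real \<times> real) set" where
  "model_plane \<kappa> =
    (if \<kappa> > 0 then {p. norm p = 1}
     else if \<kappa> = 0 then {(a, b, c). c = 0}
     else {(a, b, c). a\<^sup>2 + b\<^sup>2 - c\<^sup>2 = -1 \<and> c > 0})"

definition minkowski_form :: "real \<times> real \<times> real \<Rightarrow> real \<times> real \<times> real \<Rightarrow> real" where
  "minkowski_form = (\<lambda>(a, b, c) (a', b', c'). a * a' + b * b' - c * c')"

definition model_dist :: "real \<Rightarrow> real \<times> real \<times> real \<Rightarrow> real \<times> real \<times> real \<Rightarrow> real" where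
  "model_dist \<kappa> p q =
    (if \<kappa> > 0 then arccos (p \<bullet> q) / sqrt \<kappa>
     else if \<kappa> = 0 then dist p q
     else arcosh (- minkowski_form p q) / sqrt (- \<kappa>))"

definition model_diameter :: "real \<Rightarrow> ereal" where
  "model_diameter \<kappa> = (if \<kappa> > 0 then ereal (pi / sqrt \<kappa>) else \<infinity>)"

text \<open>A geodesic triangle has vertices \<open>p 0, p 1, p 2\<close> and sides \<open>c i\<close> from \<open>p i\<close> to
  \<open>p ((i + 1) mod 3)\<close>; \<open>q\<close> is a comparison triangle in the model plane, and \<open>x\<close>, \<open>y\<close> are the
  comparison points of \<open>c i s\<close>, \<open>c j t\<close> on its sides (geodesics of the model plane shorter than
  its diameter are unique).\<close>

definition comparison_point ::
    "real \<Rightarrow> real \<times> real \<times> real \<Rightarrow> real \<times> real \<times> real \<Rightarrow> real \<Rightarrow> real \<times> real \<times> real \<Rightarrow> bool" where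
  "comparison_point \<kappa> a b s x \<longleftrightarrow>
     x \<in> model_plane \<kappa> \<and>
     model_dist \<kappa> a x = s * model_dist \<kappa> a b \<and> model_dist \<kappa> x b = (1 - s) * model_dist \<kappa> a b"

definition CAT :: "real \<Rightarrow> 'a metric \<Rightarrow> bool" where
  "CAT \<kappa> X \<longleftrightarrow>
     (\<forall>x\<in>mspace X. \<forall>y\<in>mspace X. ereal (mdist X x y) < model_diameter \<kappa> \<longrightarrow>
        (\<exists>c. is_geodesic X c \<and> c 0 = x \<and> c 1 = y)) \<and>
     (\<forall>(p :: nat \<Rightarrow> 'a) c q.
        (\<forall>i<3. p i \<in> mspace X \<and> is_geodesic X (c i) \<and>
               c i 0 = p i \<and> c i 1 = p ((i + 1) mod 3)) \<and>
        ereal (mdist X (p 0) (p 1) + mdist X (p 1) (p 2) + mdist X (p 2) (p 0))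
          < 2 * model_diameter \<kappa> \<and>
        (\<forall>i<3. q i \<in> model_plane \<kappa>) \<and>
        (\<forall>i<3. \<forall>j<3. model_dist \<kappa> (q i) (q j) = mdist X (p i) (p j)) \<longrightarrow>
        (\<forall>i<3. \<forall>j<3. \<forall>s\<in>{0..1}. \<forall>t\<in>{0..1}. \<forall>x y.
           comparison_point \<kappa> (q i) (q ((i + 1) mod 3)) s x \<and>
           comparison_point \<kappa> (q j) (q ((j + 1) mod 3)) t y \<longrightarrow>
           mdist X (c i s) (c j t) \<le> model_dist \<kappa> x y))"


section \<open>Sturm's transport distance\<close>

definition isometric_embedding_on :: "'a set \<Rightarrow> 'a metric \<Rightarrow> 'w metric \<Rightarrow> ('a \<Rightarrow> 'w) \<Rightarrow> bool" where
  "isometric_embedding_on S Y W \<iota> \<longleftrightarrow>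
     \<iota> ` S \<subseteq> mspace W \<and> (\<forall>x\<in>S. \<forall>y\<in>S. mdist W (\<iota> x) (\<iota> y) = mdist Y x y)"

definition push_support :: "'a metric \<Rightarrow> 'a measure \<Rightarrow> 'w metric \<Rightarrow> ('a \<Rightarrow> 'w) \<Rightarrow> 'w measure" where
  "push_support Y \<mu> W \<iota> = distr (restrict_space \<mu> (measure_support Y \<mu>)) (metric_borel W) \<iota>"

text \<open>The ambient spaces \<open>W\<close> range over all metric spaces whose points are elements of \<open>'a + 'b\<close>.
  This is no restriction: the pushed-forward measures are concentrated on the union of the two
  images, so one may replace \<open>W\<close> by that union, which has at most as many points as \<open>'a + 'b\<close>.\<close>

fun sturm_distance :: "'a metric \<times> 'a measure \<Rightarrow> 'b metric \<times> 'b measure \<Rightarrow> ennreal" where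
  "sturm_distance (Y, \<mu>) (Z, \<nu>) =
     (INF (W, \<iota>, \<iota>') \<in> {(W :: ('a + 'b) metric, \<iota>, \<iota>').
            isometric_embedding_on (measure_support Y \<mu>) Y W \<iota> \<and>
            isometric_embedding_on (measure_support Z \<nu>) Z W \<iota>'}.
        wasserstein W (push_support Y \<mu> W \<iota>) (push_support Z \<nu> W \<iota>'))"


section \<open>Rescaled balls\<close>

definition rescaled_ball :: "'a metric \<Rightarrow> 'a \<Rightarrow> real \<Rightarrow> 'a metric" where
  "rescaled_ball X x r = metric (mcball_of X x r, \<lambda>y z. mdist X y z / r)"

lemma rescaled_ball:
  assumes "r > 0"
  shows "mspace (rescaled_ball X x r) = mcball_of X x r"
    and "mdist (rescaled_ball X x r) = (\<lambda>y z. mdist X y z / r)"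
proof -
  interpret Metric_space "mcball_of X x r" "\<lambda>y z. mdist X y z / r"
  proof
    fix a b c assume "a \<in> mcball_of X x r" "b \<in> mcball_of X x r" "c \<in> mcball_of X x r"
    then show "mdist X a c / r \<le> mdist X a b / r + mdist X b c / r"
      using assms by (simp add: mdist_triangle divide_right_mono flip: add_divide_distrib)
  qed (use assms in \<open>auto simp: mdist_commute\<close>)
  show "mspace (rescaled_ball X x r) = mcball_of X x r"
    "mdist (rescaled_ball X x r) = (\<lambda>y z. mdist X y z / r)"
    using mspace_Self mdist_Self by (auto simp: rescaled_ball_def Self_def)
qed

definition normalized_ball :: "'a metric \<Rightarrow> 'a measure \<Rightarrow> 'a \<Rightarrow> real \<Rightarrow> 'a metric \<times> 'a measure" where
  "normalized_ball X m x r =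
     (rescaled_ball X x r,
      scale_measure (1 / emeasure m (mcball_of X x r)) (restrict_space m (mcball_of X x r)))"

end

theory Submission
  imports Defs
begin

text \<open>Let \<open>p = \<gamma>(t)\<close> and \<open>p' = \<gamma>(t')\<close> be close to each other. Moving every point \<open>x\<close> of \<open>B\<^sub>r(p)\<close> by a
  small fraction \<open>l\<close> along the geodesic towards a point \<open>o\<close> of \<open>\<gamma>\<close> beyond \<open>p'\<close> gives a map
  \<open>f : B\<^sub>r(p) \<rightarrow> B\<^sub>r(p')\<close>; as \<open>p'\<close> is an interior point of \<open>\<gamma>\<close>, there is a map \<open>g\<close> back. By
  \<open>CAT(\<kappa>)\<close> both are 1-Lipschitz, and by the Brunn-Minkowski inequality for \<open>f\<inverse>(V)\<close> and a tiny ball around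
  \<open>o\<close> they satisfy \<open>c m(f\<inverse>(V)) \<le> m(V)\<close> with \<open>c = (1 - l)\<^bsup>2(N+1)\<^esup>\<close> close to 1. Hence the self-map
  \<open>h = g \<circ> f\<close> of \<open>B\<^sub>r(p)\<close> nearly preserves the measure, so \<open>\<integral>\<integral> d(x,y) - d(h(x),h(y))\<close> is nearly 0. The
  integrand is nonnegative and Lipschitz, and small balls have a definite share of the volume, so it is
  uniformly small. Thus \<open>f\<close> is an almost isometry pushing the normalized measure of the first ball almost
  onto that of the second.\<close>

section \<open>Comparison triangles\<close>

text \<open>\<open>CD\<close> speaks about a geodesic of measures in Wasserstein space, not about
  mass moving along geodesics of \<open>X\<close>. The bridge is metric: near-optimal couplings
  force the intermediate measure to live on approximate intermediate points, and CAT(\<kappa>)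
  comparison places these close to the point on the geodesic. This is why thin triangles are
  estimated with constants uniform in the triangle. Images of Borel sets under \<open>f\<close> are
  awkward to measure, so the bound is stated for preimages, first for closed \<open>V\<close> as a
  limit of neighbourhoods, then by inner regularity. The exponent \<open>2 * (N + 1)\<close> has two
  sources: the distortion coefficient is bounded below by \<open>t\<^sup>2\<close>, and the
  dimension is raised to \<open>N + 1\<close> to include \<open>N = 1\<close>. Uniformity in
  \<open>r\<close> comes from keeping \<open>o\<close> at a fixed parameter distance \<sigma> beyond
  \<open>p'\<close>: then \<open>l\<close> is governed by
  \<open>\<bar>t - t'\<bar> / \<sigma>\<close> at every scale, and the volume share of a ball of
  radius proportional to \<open>r\<close> depends only on the proportion and on
  \<open>N\<close>.\<close>

definition law_of_cosines :: "real \<Rightarrow> real \<Rightarrow> real \<Rightarrow> real \<Rightarrow> real" where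
  "law_of_cosines \<kappa> a b c =
    (if \<kappa> > 0 then arccos (cos (sqrt \<kappa> * a) * cos (sqrt \<kappa> * b) + sin (sqrt \<kappa> * a) * sin (sqrt \<kappa> * b) * c) / sqrt \<kappa>
     else if \<kappa> = 0 then sqrt (a\<^sup>2 + b\<^sup>2 - 2 * a * b * c)
     else arcosh (cosh (sqrt (- \<kappa>) * a) * cosh (sqrt (- \<kappa>) * b) - sinh (sqrt (- \<kappa>) * a) * sinh (sqrt (- \<kappa>) * b) * c) / sqrt (- \<kappa>))"

text \<open>The point at distance \<open>s\<close> from a pole on the ray at angle \<open>arccos c\<close> to a reference ray.\<close>

definition model_ray :: "real \<Rightarrow> real \<Rightarrow> real \<Rightarrow> real \<times> real \<times> real" where
  "model_ray \<kappa> c s =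
    (if \<kappa> > 0 then (sin (sqrt \<kappa> * s) * c, sin (sqrt \<kappa> * s) * sqrt (1 - c\<^sup>2), cos (sqrt \<kappa> * s))
     else if \<kappa> = 0 then (s * c, s * sqrt (1 - c\<^sup>2), 0)
     else (sinh (sqrt (- \<kappa>) * s) * c, sinh (sqrt (- \<kappa>) * s) * sqrt (1 - c\<^sup>2), cosh (sqrt (- \<kappa>) * s)))"

lemma unit_interval_square: "c \<in> {-1..1} \<Longrightarrow> c\<^sup>2 \<le> (1::real)"
  by (simp add: abs_square_le_1 abs_le_iff)

lemma model_dist_sym: "model_dist \<kappa> p q = model_dist \<kappa> q p"
  by (auto simp: model_dist_def inner_commute dist_commute minkowski_form_def mult.commute split: prod.splits)

lemma model_ray_in_model_plane:
  assumes "c \<in> {-1..1}"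
  shows "model_ray \<kappa> c s \<in> model_plane \<kappa>"
proof -
  have q: "(sqrt (1 - c\<^sup>2))\<^sup>2 = 1 - c\<^sup>2" using unit_interval_square[OF assms] by simp
  have "(sin t * c)\<^sup>2 + (sin t * sqrt (1 - c\<^sup>2))\<^sup>2 + (cos t)\<^sup>2 = 1" for t
    unfolding power_mult_distrib q by (simp add: algebra_simps)
  moreover have "(sinh t * c)\<^sup>2 + (sinh t * sqrt (1 - c\<^sup>2))\<^sup>2 - (cosh t)\<^sup>2 = -1" for t
    unfolding power_mult_distrib q by (simp add: algebra_simps cosh_square_eq)
  ultimately show ?thesis
    by (auto simp: model_ray_def model_plane_def norm_prod_def add.assoc)
qed

text \<open>The ray with \<open>c = 1\<close> is the reference ray, so \<open>c\<close> is the
  cosine of the angle at the pole: \<open>model_ray\<close> describes geodesic polar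
  coordinates.\<close>

lemma model_dist_rays: 
  assumes "c \<in> {-1..1}"
  shows "model_dist \<kappa> (model_ray \<kappa> 1 s) (model_ray \<kappa> c u) = law_of_cosines \<kappa> s u c"
proof -
  have q: "(sqrt (1 - c\<^sup>2))\<^sup>2 = 1 - c\<^sup>2" using unit_interval_square[OF assms] by simp
  have "(s - u * c)\<^sup>2 + (u * sqrt (1 - c\<^sup>2))\<^sup>2 = s\<^sup>2 + u\<^sup>2 - 2 * s * u * c"
    unfolding power_mult_distrib q by (simp add: algebra_simps power2_eq_square)
  then show ?thesis
    by (auto simp: model_dist_def model_ray_def law_of_cosines_def minkowski_form_def inner_prod_def dist_prod_def
        dist_real_def algebra_simps)
qed

lemma model_dist_ray:
  assumes c: "c \<in> {-1..1}" and "s \<le> u" and pi: "\<kappa> > 0 \<Longrightarrow> sqrt \<kappa> * (u - s) \<le> pi"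
  shows "model_dist \<kappa> (model_ray \<kappa> c s) (model_ray \<kappa> c u) = u - s"
proof -
  have q: "(sqrt (1 - c\<^sup>2))\<^sup>2 = 1 - c\<^sup>2" using unit_interval_square[OF c] by simp
  consider "\<kappa> > 0" | "\<kappa> = 0" | "\<kappa> < 0" by linarith
  then show ?thesis
  proof cases
    case 1
    let ?k = "sqrt \<kappa>"
    have "model_ray \<kappa> c s \<bullet> model_ray \<kappa> c u
        = sin (?k * s) * sin (?k * u) * (c\<^sup>2 + (sqrt (1 - c\<^sup>2))\<^sup>2) + cos (?k * s) * cos (?k * u)"
      using 1 unfolding model_ray_def by (simp add: power2_eq_square algebra_simps del: real_sqrt_mult_self)
    also have "\<dots> = cos (?k * (u - s))"
      unfolding q by (simp add: right_diff_distrib cos_diff algebra_simps)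
    finally show ?thesis
      using 1 pi \<open>s \<le> u\<close> by (simp add: model_dist_def arccos_cos)
  next
    case 2
    have "(s * c - u * c)\<^sup>2 + (s * sqrt (1 - c\<^sup>2) - u * sqrt (1 - c\<^sup>2))\<^sup>2 = (u - s)\<^sup>2 * (c\<^sup>2 + (sqrt (1 - c\<^sup>2))\<^sup>2)"
      by algebra
    also have "\<dots> = (u - s)\<^sup>2" unfolding q by simp
    finally show ?thesis
      using 2 \<open>s \<le> u\<close> by (simp add: model_dist_def model_ray_def dist_prod_def dist_real_def)
  next
    case 3
    let ?k = "sqrt (- \<kappa>)"
    have "- minkowski_form (model_ray \<kappa> c s) (model_ray \<kappa> c u)
        = cosh (?k * s) * cosh (?k * u) - sinh (?k * s) * sinh (?k * u) * (c\<^sup>2 + (sqrt (1 - c\<^sup>2))\<^sup>2)"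
      using 3 unfolding model_ray_def minkowski_form_def
      by (simp add: power2_eq_square algebra_simps del: real_sqrt_mult_self)
    also have "\<dots> = cosh (?k * (u - s))"
      unfolding q by (simp add: right_diff_distrib cosh_diff algebra_simps)
    finally show ?thesis
      using 3 \<open>s \<le> u\<close> by (simp add: model_dist_def arcosh_cosh_real)
  qed
qed

text \<open>A side of length \<open>b\<close> is addressed by fractions, as in
  \<open>comparison_point\<close>. The bound on \<open>b\<close> keeps the side in the range where
  \<open>arccos\<close> inverts \<open>cos\<close>; its factor 4 is the form in which the scale
  bound on sides arrives.\<close>

lemma model_dist_segment:
  assumes c: "c \<in> {-1..1}" and "0 \<le> s" "s \<le> u" "u \<le> 1" "0 \<le> b" and small: "\<kappa> > 0 \<Longrightarrow> sqrt \<kappa> * b * 4 \<le> pi"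
  shows "model_dist \<kappa> (model_ray \<kappa> c (s * b)) (model_ray \<kappa> c (u * b)) = (u - s) * b"
proof -
  have "s * b \<le> u * b" using assms by (intro mult_right_mono) auto
  moreover have "sqrt \<kappa> * (u * b - s * b) \<le> pi" if "\<kappa> > 0"
  proof -
    have "(u - s) * b \<le> b" using assms by (intro mult_left_le_one_le) auto
    then have "sqrt \<kappa> * (u * b - s * b) \<le> sqrt \<kappa> * b"
      using that by (intro mult_left_mono) (auto simp: left_diff_distrib)
    then show ?thesis using small[OF that] pi_gt_zero by linarith
  qed
  ultimately show ?thesis using model_dist_ray[OF c, of "s * b" "u * b" \<kappa>] by (simp add: algebra_simps)
qed

section \<open>Comparison angles by affine interpolation in the cosine\<close>

lemma affine_solution:
  fixes X Y v :: real
  assumes "X - Y \<le> v" "v \<le> X + Y"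
  shows "\<exists>c\<in>{-1..1}. X + Y * c = v"
proof (cases "Y = 0")
  case False
  then have "Y > 0" using assms by linarith
  then show ?thesis
    using assms by (intro bexI[of _ "(v - X) / Y"]) (auto simp: field_simps)
qed (use assms in \<open>auto intro!: bexI[of _ 0]\<close>)

text \<open>By the addition formulas the extreme angles \<open>c = 1\<close> and
  \<open>c = -1\<close> produce the third sides \<open>\<bar>a - b\<bar>\<close> and
  \<open>a + b\<close>. In between, the argument of the inverse function is affine in
  \<open>c\<close>, so a linear equation yields the angle. In the flat and hyperbolic cases the
  cosine enters with a minus sign, hence the witness \<open>-c\<close>.\<close>

lemma law_of_cosines_solution:
  assumes "0 \<le> a" "0 \<le> b" "0 \<le> d" and tri: "\<bar>a - b\<bar> \<le> d" "d \<le> a + b"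
    and small: "\<kappa> > 0 \<Longrightarrow> sqrt \<kappa> * (a + b) \<le> pi"
  shows "\<exists>c\<in>{-1..1}. law_of_cosines \<kappa> a b c = d"
proof -
  consider "\<kappa> > 0" | "\<kappa> = 0" | "\<kappa> < 0" by linarith
  then show ?thesis
  proof cases
    case 1
    let ?k = "sqrt \<kappa>"
    have kd: "?k * \<bar>a - b\<bar> \<le> ?k * d" "?k * d \<le> ?k * (a + b)" "?k * (a + b) \<le> pi"
      using 1 tri small by (auto intro!: mult_left_mono simp del: distrib_left)
    have kd_pi: "?k * d \<le> pi" using kd(2,3) by (rule order_trans)
    have kab_pi: "?k * \<bar>a - b\<bar> \<le> pi" using kd(1) kd_pi by (rule order_trans)
    have "cos (?k * (a + b)) \<le> cos (?k * d)"
      using kd 1 \<open>0 \<le> d\<close> by (intro cos_monotone_0_pi_le) auto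
    moreover have "cos (?k * d) \<le> cos (?k * \<bar>a - b\<bar>)"
      using kd kd_pi 1 by (intro cos_monotone_0_pi_le) auto
    moreover have "cos (?k * \<bar>a - b\<bar>) = cos (?k * a) * cos (?k * b) + sin (?k * a) * sin (?k * b)"
    proof -
      have "cos (?k * \<bar>a - b\<bar>) = cos (?k * (a - b))"
        by (metis abs_mult abs_of_nonneg cos_abs_real real_sqrt_ge_zero 1 less_imp_le)
      then show ?thesis by (simp add: right_diff_distrib cos_diff)
    qed
    ultimately obtain c where "c \<in> {-1..1}"
      "cos (?k * a) * cos (?k * b) + sin (?k * a) * sin (?k * b) * c = cos (?k * d)"
      using affine_solution[of "cos (?k * a) * cos (?k * b)" "sin (?k * a) * sin (?k * b)" "cos (?k * d)"]
      by (auto simp: distrib_left cos_add)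
    then show ?thesis
      using 1 kd_pi \<open>0 \<le> d\<close> by (intro bexI[of _ c]) (simp_all add: law_of_cosines_def arccos_cos)
  next
    case 2
    have "d\<^sup>2 \<le> (a + b)\<^sup>2" using tri \<open>0 \<le> d\<close> by (intro power_mono) auto
    moreover have "(a - b)\<^sup>2 \<le> d\<^sup>2" using tri by (metis abs_ge_zero power2_abs power_mono)
    ultimately obtain c where "c \<in> {-1..1}" "(a\<^sup>2 + b\<^sup>2) + 2 * a * b * c = d\<^sup>2"
      using affine_solution[of "a\<^sup>2 + b\<^sup>2" "2 * a * b" "d\<^sup>2"]
      by (auto simp: power2_eq_square algebra_simps)
    then show ?thesis
      using 2 \<open>0 \<le> d\<close> by (intro bexI[of _ "-c"]) (auto simp: law_of_cosines_def)
  next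
    case 3
    let ?k = "sqrt (- \<kappa>)"
    have kd: "?k * \<bar>a - b\<bar> \<le> ?k * d" "?k * d \<le> ?k * (a + b)"
      using 3 tri by (auto intro!: mult_left_mono)
    have "cosh (?k * d) \<le> cosh (?k * (a + b))"
      using kd 3 \<open>0 \<le> d\<close> assms(1,2) by (subst cosh_real_nonneg_le_iff) auto
    moreover have "cosh (?k * \<bar>a - b\<bar>) \<le> cosh (?k * d)"
      using kd 3 \<open>0 \<le> d\<close> by (subst cosh_real_nonneg_le_iff) auto
    moreover have "cosh (?k * \<bar>a - b\<bar>) = cosh (?k * a) * cosh (?k * b) - sinh (?k * a) * sinh (?k * b)"
    proof -
      have "cosh (?k * \<bar>a - b\<bar>) = cosh (?k * (a - b))"
      proof (cases "a \<le> b")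
        case True
        then have "?k * \<bar>a - b\<bar> = - (?k * (a - b))" by (simp add: algebra_simps)
        then show ?thesis by (simp only: cosh_minus)
      qed simp
      then show ?thesis by (simp add: right_diff_distrib cosh_diff)
    qed
    ultimately obtain c where "c \<in> {-1..1}"
      "cosh (?k * a) * cosh (?k * b) + sinh (?k * a) * sinh (?k * b) * c = cosh (?k * d)"
      using affine_solution[of "cosh (?k * a) * cosh (?k * b)" "sinh (?k * a) * sinh (?k * b)" "cosh (?k * d)"]
      by (auto simp: distrib_left cosh_add)
    then show ?thesis
      using 3 \<open>0 \<le> d\<close> by (intro bexI[of _ "-c"]) (auto simp: law_of_cosines_def arcosh_cosh_real)
  qed
qed

text \<open>The value at \<open>c\<close> is a convex combination of the values at the degenerate
  angles, where the hinge expressions collapse to \<open>cos (u + v)\<close>,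
  \<open>cosh (u - v)\<close> or perfect squares.\<close>

lemma affine_ge_0:
  fixes X Y c :: real
  assumes "0 \<le> X - Y" "0 \<le> X + Y" "c \<in> {-1..1}"
  shows "0 \<le> X + Y * c"
proof -
  have "X + Y * c = (1 - c) / 2 * (X - Y) + (1 + c) / 2 * (X + Y)" by (simp add: field_simps)
  moreover have "(1 - c) / 2 * (X - Y) \<ge> 0" using assms by (intro mult_nonneg_nonneg) auto
  moreover have "(1 + c) / 2 * (X + Y) \<ge> 0" using assms by (intro mult_nonneg_nonneg) auto
  ultimately show ?thesis by linarith
qed

lemma spherical_cosine_range:
  assumes "c \<in> {-1..1::real}"
  shows "\<bar>cos u * cos v + sin u * sin v * c\<bar> \<le> 1"
proof -
  have "0 \<le> (1 - cos u * cos v) + (- (sin u * sin v)) * c"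
    by (rule affine_ge_0[OF _ _ assms]) (use assms cos_le_one[of "u - v"] cos_le_one[of "u + v"] in \<open>auto simp: cos_diff cos_add\<close>)
  moreover have ge: "- 1 \<le> cos u * cos v + sin u * sin v" "- 1 \<le> cos u * cos v - sin u * sin v"
    using cos_ge_minus_one[of "u - v"] cos_ge_minus_one[of "u + v"] by (auto simp: cos_diff cos_add)
  have "0 \<le> (1 + cos u * cos v) + (sin u * sin v) * c"
    by (rule affine_ge_0[OF _ _ assms]) (use ge in linarith)+
  ultimately show ?thesis by (auto simp: algebra_simps abs_le_iff)
qed

lemma hyperbolic_cosine_range:
  assumes "c \<in> {-1..1::real}"
  shows "cosh u * cosh v - sinh u * sinh v * c \<ge> 1"
proof -
  have "0 \<le> (cosh u * cosh v - 1) + (- (sinh u * sinh v)) * c"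
    by (rule affine_ge_0[OF _ _ assms]) (use assms cosh_real_ge_1[of "u - v"] cosh_real_ge_1[of "u + v"] in \<open>auto simp: cosh_diff cosh_add\<close>)
  then show ?thesis by (auto simp: algebra_simps)
qed

lemma euclidean_cosine_range:
  assumes "c \<in> {-1..1::real}"
  shows "a\<^sup>2 + b\<^sup>2 - 2 * a * b * c \<ge> 0"
proof -
  have "0 \<le> (a\<^sup>2 + b\<^sup>2) + (- (2 * a * b)) * c"
    by (rule affine_ge_0[OF _ _ assms]) (use assms zero_le_power2[of "a - b"] zero_le_power2[of "a + b"] in \<open>auto simp: power2_eq_square algebra_simps\<close>)
  then show ?thesis by simp
qed

text \<open>In \<open>c\<close> both sides are affine after removing the inverse trigonometric function, so it suffices
  to compare them for \<open>c = -1\<close> and \<open>c = 1\<close>.\<close>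

lemma law_of_cosines_contract:
  assumes "0 \<le> a" "0 \<le> b" "t \<in> {0..1}" and c: "c \<in> {-1..1}"
    and small: "\<kappa> > 0 \<Longrightarrow> sqrt \<kappa> * (a + b) \<le> pi"
  shows "law_of_cosines \<kappa> (t * a) (t * b) c \<le> law_of_cosines \<kappa> a b c"
proof -
  have shrink: "\<bar>t * x\<bar> \<le> \<bar>x\<bar>" for x :: real
    using assms(3) by (simp add: abs_mult mult_left_le_one_le)
  consider "\<kappa> > 0" | "\<kappa> = 0" | "\<kappa> < 0" by linarith
  then show ?thesis
  proof cases
    case 1
    let ?k = "sqrt \<kappa>" define u v where "u = ?k * a" and "v = ?k * b"
    have uv: "0 \<le> u" "0 \<le> v" "u + v \<le> pi" using assms 1 by (auto simp: u_def v_def distrib_left)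
    have mono: "cos w \<le> cos (t * w)" if "\<bar>w\<bar> \<le> pi" for w
    proof -
      have "cos \<bar>w\<bar> \<le> cos \<bar>t * w\<bar>" using that shrink[of w] by (intro cos_monotone_0_pi_le) auto
      then show ?thesis by simp
    qed
    have "0 \<le> (cos (t * u) * cos (t * v) - cos u * cos v) + (sin (t * u) * sin (t * v) - sin u * sin v) * c"
    proof (rule affine_ge_0[OF _ _ c])
      show "0 \<le> cos (t * u) * cos (t * v) - cos u * cos v - (sin (t * u) * sin (t * v) - sin u * sin v)"
        using mono[of "u + v"] uv by (simp add: cos_add distrib_left)
      have "\<bar>u - v\<bar> \<le> pi" using uv by (simp add: abs_le_iff)
      then show "0 \<le> cos (t * u) * cos (t * v) - cos u * cos v + (sin (t * u) * sin (t * v) - sin u * sin v)"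
        using mono[of "u - v"] by (simp add: cos_diff right_diff_distrib)
    qed
    then have "cos u * cos v + sin u * sin v * c \<le> cos (t * u) * cos (t * v) + sin (t * u) * sin (t * v) * c"
      by (simp add: algebra_simps)
    then have "arccos (cos (t * u) * cos (t * v) + sin (t * u) * sin (t * v) * c)
        \<le> arccos (cos u * cos v + sin u * sin v * c)"
      using spherical_cosine_range[OF c, of u v] spherical_cosine_range[OF c, of "t * u" "t * v"]
      by (intro arccos_le_arccos) auto
    then show ?thesis
      using 1 by (simp add: law_of_cosines_def u_def v_def divide_right_mono mult.left_commute)
  next
    case 2
    have "t\<^sup>2 * (a\<^sup>2 + b\<^sup>2 - 2 * a * b * c) \<le> a\<^sup>2 + b\<^sup>2 - 2 * a * b * c"
      using euclidean_cosine_range[OF c] assms(3) by (intro mult_left_le_one_le) (auto simp: power_le_one)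
    then show ?thesis
      using 2 by (simp add: law_of_cosines_def power_mult_distrib algebra_simps power2_eq_square)
  next
    case 3
    let ?k = "sqrt (- \<kappa>)" define u v where "u = ?k * a" and "v = ?k * b"
    have mono: "cosh (t * w) \<le> cosh w" for w :: real
    proof -
      have "cosh \<bar>t * w\<bar> \<le> cosh \<bar>w\<bar>" using shrink[of w] by (subst cosh_real_nonneg_le_iff) auto
      then show ?thesis by (simp add: abs_if split: if_splits)
    qed
    have "0 \<le> (cosh u * cosh v - cosh (t * u) * cosh (t * v)) + (sinh (t * u) * sinh (t * v) - sinh u * sinh v) * c"
      by (rule affine_ge_0[OF _ _ c]) (use c mono[of "u - v"] mono[of "u + v"] in \<open>auto simp: cosh_diff cosh_add right_diff_distrib distrib_left\<close>)
    then have le: "cosh (t * u) * cosh (t * v) - sinh (t * u) * sinh (t * v) * c \<le> cosh u * cosh v - sinh u * sinh v * c"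
      by (simp add: algebra_simps)
    then have "arcosh (cosh (t * u) * cosh (t * v) - sinh (t * u) * sinh (t * v) * c)
        \<le> arcosh (cosh u * cosh v - sinh u * sinh v * c)"
      using hyperbolic_cosine_range[OF c, of u v] hyperbolic_cosine_range[OF c, of "t * u" "t * v"]
        arcosh_real_strict_mono[of "cosh (t * u) * cosh (t * v) - sinh (t * u) * sinh (t * v) * c" "cosh u * cosh v - sinh u * sinh v * c"]
      by (metis dual_order.refl le_less)
    then show ?thesis
      using 3 by (simp add: law_of_cosines_def u_def v_def divide_right_mono mult.left_commute)
  qed
qed

section \<open>Geodesics and hinge comparison in CAT(\<kappa>) spaces\<close>

lemma geodesic_in_mspace: "is_geodesic X c \<Longrightarrow> t \<in> {0..1} \<Longrightarrow> c t \<in> mspace X"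
  unfolding is_geodesic_def by blast

lemma geodesic_dist:
  "is_geodesic X c \<Longrightarrow> s \<in> {0..1} \<Longrightarrow> t \<in> {0..1} \<Longrightarrow> mdist X (c s) (c t) = \<bar>s - t\<bar> * mdist X (c 0) (c 1)"
  unfolding is_geodesic_def by blast

lemma subgeodesic:
  assumes c: "is_geodesic X c" and st: "s \<in> {0..1}" "t \<in> {0..1}"
  shows "is_geodesic X (\<lambda>u. c (s + u * (t - s)))"
proof -
  have in01: "s + u * (t - s) \<in> {0..1}" if "u \<in> {0..1}" for u
  proof -
    have "0 \<le> (1 - u) * s + u * t" using that st by auto
    moreover have "(1 - u) * s + u * t \<le> 1" using convex_bound_le[of s 1 t "1 - u" u] that st by auto
    moreover have "s + u * (t - s) = (1 - u) * s + u * t" by algebra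
    ultimately show ?thesis by simp
  qed
  have "mdist X (c (s + u * (t - s))) (c (s + v * (t - s))) = \<bar>u - v\<bar> * (\<bar>s - t\<bar> * mdist X (c 0) (c 1))"
    if "u \<in> {0..1}" "v \<in> {0..1}" for u v
  proof -
    have "(s + u * (t - s)) - (s + v * (t - s)) = (u - v) * (t - s)" by algebra
    then show ?thesis
      using geodesic_dist[OF c in01 in01, OF that] by (simp add: abs_mult abs_minus_commute)
  qed
  moreover have "mdist X (c (s + 0 * (t - s))) (c (s + 1 * (t - s))) = \<bar>s - t\<bar> * mdist X (c 0) (c 1)"
    using geodesic_dist[OF c st] by simp
  ultimately show ?thesis
    using geodesic_in_mspace[OF c in01] unfolding is_geodesic_def by metis
qed

lemma reverse_geodesic: "is_geodesic X c \<Longrightarrow> is_geodesic X (\<lambda>t. c (1 - t))"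
  using subgeodesic[of X c 1 0] by simp

lemma CAT_geodesic:
  assumes cat: "CAT \<kappa> X" and R: "\<kappa> > 0 \<Longrightarrow> sqrt \<kappa> * R \<le> pi / 4"
    and "x \<in> mspace X" "y \<in> mspace X" and d: "mdist X x y \<le> R"
  shows "\<exists>c. is_geodesic X c \<and> c 0 = x \<and> c 1 = y"
proof -
  have "ereal (mdist X x y) < model_diameter \<kappa>"
  proof (cases "\<kappa> > 0")
    case True
    then have "sqrt \<kappa> * mdist X x y \<le> sqrt \<kappa> * R" using d by (intro mult_left_mono) auto
    then have "sqrt \<kappa> * mdist X x y < pi" using R[OF True] pi_gt_zero by linarith
    then show ?thesis using True by (simp add: model_diameter_def field_simps)
  qed (auto simp: model_diameter_def)
  then show ?thesis using cat[unfolded CAT_def, THEN conjunct1] assms(3,4) by simp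
qed

text \<open>The third side required by \<open>CAT\<close> is supplied by
  \<open>CAT_geodesic\<close>. The comparison triangle is placed with the common vertex at the pole,
  so that the two given sides become rays and the comparison distance is a law of cosines.
  \<open>c2\<close> runs towards the vertex because it is the last side of a cyclically oriented
  triangle. The bound by \<open>R\<close> keeps the perimeter below twice the model
  diameter.\<close>

lemma CAT_hinge:
  assumes cat: "CAT \<kappa> X" and c0: "is_geodesic X c0" and c2: "is_geodesic X c2" and eq: "c0 0 = c2 1"
    and R: "\<kappa> > 0 \<Longrightarrow> sqrt \<kappa> * R \<le> pi / 4"
    and dist: "mdist X (c0 0) (c0 1) \<le> R" "mdist X (c2 0) (c2 1) \<le> R" "mdist X (c0 1) (c2 0) \<le> R"
  shows "\<exists>c\<in>{-1..1}. law_of_cosines \<kappa> (mdist X (c0 0) (c0 1)) (mdist X (c2 0) (c2 1)) c = mdist X (c0 1) (c2 0) \<and>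
     (\<forall>s\<in>{0..1}. \<forall>t\<in>{0..1}. mdist X (c0 s) (c2 t) \<le>
        law_of_cosines \<kappa> (s * mdist X (c0 0) (c0 1)) ((1 - t) * mdist X (c2 0) (c2 1)) c)"
proof -
  define a b d where "a = mdist X (c0 0) (c0 1)" and "b = mdist X (c2 0) (c2 1)" and "d = mdist X (c0 1) (c2 0)"
  have pts: "c0 0 \<in> mspace X" "c0 1 \<in> mspace X" "c2 0 \<in> mspace X"
    using c0 c2 by (auto intro: geodesic_in_mspace)
  have b': "b = mdist X (c0 0) (c2 0)" by (simp add: b_def eq mdist_commute)
  have nn: "0 \<le> a" "0 \<le> b" "0 \<le> d" by (auto simp: a_def b_def d_def)
  have tri: "\<bar>a - b\<bar> \<le> d" "d \<le> a + b"
    using mdist_triangle[of "c0 0" X "c0 1" "c2 0"] mdist_triangle[of "c0 0" X "c2 0" "c0 1"] mdist_triangle[of "c0 1" X "c0 0" "c2 0"] pts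
    unfolding a_def b' d_def by (auto simp: mdist_commute abs_le_iff)
  have aR: "a \<le> R" "b \<le> R" "d \<le> R" using dist by (auto simp: a_def b_def d_def)
  have kab: "sqrt \<kappa> * a \<le> pi / 4" "sqrt \<kappa> * b \<le> pi / 4" "sqrt \<kappa> * d \<le> pi / 4" if "\<kappa> > 0"
    using R[OF that] aR that by (meson mult_left_mono order_trans real_sqrt_ge_zero less_imp_le)+
  obtain c where c: "c \<in> {-1..1}" and law: "law_of_cosines \<kappa> a b c = d"
  proof -
    have "sqrt \<kappa> * (a + b) \<le> pi" if "\<kappa> > 0"
      using kab[OF that] pi_gt_zero unfolding distrib_left by linarith
    then show ?thesis using law_of_cosines_solution[OF nn tri, of \<kappa>] that by blast
  qed
  obtain c1 where c1: "is_geodesic X c1" "c1 0 = c0 1" "c1 1 = c2 0"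
    using CAT_geodesic[OF cat R pts(2,3)] dist by auto
  define p where "p = (\<lambda>i::nat. if i = 0 then c0 0 else if i = 1 then c0 1 else c2 0)"
  define q where "q = (\<lambda>i::nat. if i = 0 then model_ray \<kappa> 1 0 else if i = 1 then model_ray \<kappa> 1 a else model_ray \<kappa> c b)"
  define cc where "cc = (\<lambda>i::nat. if i = 0 then c0 else if i = 1 then c1 else c2)"
  have ray0: "model_ray \<kappa> 1 0 = model_ray \<kappa> c 0" by (simp add: model_ray_def)
  have lt3: "(i < 3) \<longleftrightarrow> i = 0 \<or> i = 1 \<or> i = 2" for i :: nat by auto
  have ray1: "model_dist \<kappa> (model_ray \<kappa> 1 (s * a)) (model_ray \<kappa> 1 (u * a)) = (u - s) * a"
    and ray2: "model_dist \<kappa> (model_ray \<kappa> c (s * b)) (model_ray \<kappa> c (u * b)) = (u - s) * b"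
    if "0 \<le> s" "s \<le> u" "u \<le> 1" for s u
    using that nn kab pi_gt_zero c by (auto intro!: model_dist_segment)
  have q01: "model_dist \<kappa> (q 0) (q 1) = a" using ray1[of 0 1] by (simp add: q_def)
  have q02: "model_dist \<kappa> (q 0) (q 2) = b" using ray2[of 0 1] by (simp add: q_def ray0)
  have q12: "model_dist \<kappa> (q 1) (q 2) = d" using model_dist_rays[OF c, of \<kappa> a b] law by (simp add: q_def)
  have self: "model_dist \<kappa> (q i) (q i) = 0" for i
    using model_dist_ray[of 1 0 0 \<kappa>] model_dist_ray[of 1 a a \<kappa>] model_dist_ray[OF c, of b b \<kappa>] by (simp add: q_def)
  have pd: "mdist X (p 0) (p 1) = a" "mdist X (p 0) (p 2) = b" "mdist X (p 1) (p 2) = d"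
    by (auto simp: p_def a_def b' d_def)
  have pself: "mdist X (p i) (p i) = 0" for i using pts by (auto simp: p_def)
  have H1: "\<forall>i<3. p i \<in> mspace X \<and> is_geodesic X (cc i) \<and> cc i 0 = p i \<and> cc i 1 = p ((i + 1) mod 3)"
    using pts c0 c1 c2 eq by (auto simp: lt3 p_def cc_def numeral_2_eq_2)
  have H2: "ereal (mdist X (p 0) (p 1) + mdist X (p 1) (p 2) + mdist X (p 2) (p 0)) < 2 * model_diameter \<kappa>"
  proof (cases "\<kappa> > 0")
    case True
    have "sqrt \<kappa> * (a + d + b) < 2 * pi" using kab[OF True] pi_gt_zero unfolding distrib_left by linarith
    then have "a + d + b < 2 * (pi / sqrt \<kappa>)" using True by (simp add: field_simps)
    then show ?thesis using True pd by (simp add: model_diameter_def mdist_commute[of X "p 2"])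
  qed (auto simp: model_diameter_def)
  have H3: "\<forall>i<3. q i \<in> model_plane \<kappa>"
    using c by (auto simp: q_def model_ray_in_model_plane)
  have H4: "\<forall>i<3. \<forall>j<3. model_dist \<kappa> (q i) (q j) = mdist X (p i) (p j)"
  proof -
    have "model_dist \<kappa> (q 1) (q 0) = a" "model_dist \<kappa> (q 2) (q 0) = b" "model_dist \<kappa> (q 2) (q 1) = d"
      using q01 q02 q12 model_dist_sym by metis+
    moreover have "mdist X (p 1) (p 0) = a" "mdist X (p 2) (p 0) = b" "mdist X (p 2) (p 1) = d"
      using pd mdist_commute by metis+
    ultimately show ?thesis
      using q01 q02 q12 pd
      by (intro allI impI, unfold lt3, elim disjE; hypsubst) (simp_all only: self pself)
  qed
  have main: "\<forall>i<3. \<forall>j<3. \<forall>s\<in>{0..1}. \<forall>t\<in>{0..1}. \<forall>x y.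
           comparison_point \<kappa> (q i) (q ((i + 1) mod 3)) s x \<and>
           comparison_point \<kappa> (q j) (q ((j + 1) mod 3)) t y \<longrightarrow>
           mdist X (cc i s) (cc j t) \<le> model_dist \<kappa> x y"
    using cat[unfolded CAT_def, THEN conjunct2, rule_format, of p cc q] H1 H2 H3 H4 by blast
  have "mdist X (c0 s) (c2 t) \<le> law_of_cosines \<kappa> (s * a) ((1 - t) * b) c" if st: "s \<in> {0..1}" "t \<in> {0..1}" for s t
  proof -
    have "comparison_point \<kappa> (q 0) (q ((0 + 1) mod 3)) s (model_ray \<kappa> 1 (s * a))"
      using ray1[of 0 s] ray1[of s 1] ray1[of 0 1] st by (auto simp: comparison_point_def q_def model_ray_in_model_plane)
    moreover have "comparison_point \<kappa> (q 2) (q ((2 + 1) mod 3)) t (model_ray \<kappa> c ((1 - t) * b))"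
      using ray2[of 0 "1 - t"] ray2[of "1 - t" 1] ray2[of 0 1] st c
      by (auto simp: comparison_point_def q_def model_ray_in_model_plane ray0 model_dist_sym[of \<kappa> "model_ray \<kappa> c b"]
          model_dist_sym[of \<kappa> _ "model_ray \<kappa> c 0"])
    ultimately have "mdist X (cc 0 s) (cc 2 t) \<le> model_dist \<kappa> (model_ray \<kappa> 1 (s * a)) (model_ray \<kappa> c ((1 - t) * b))"
      using main st by (metis lt3)
    then show ?thesis by (simp add: cc_def model_dist_rays[OF c])
  qed
  then show ?thesis using c law unfolding a_def b_def d_def by blast
qed

text \<open>Both points sit on a hinge at the common endpoint, with sides shrunk by the same factor
  \<open>1 - t\<close>. Shrinking a model hinge at fixed angle does not lengthen its third
  side.\<close>

lemma CAT_contraction: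
  assumes cat: "CAT \<kappa> X" and c: "is_geodesic X c" and c': "is_geodesic X c'" and eq: "c 1 = c' 1"
    and R: "\<kappa> > 0 \<Longrightarrow> sqrt \<kappa> * R \<le> pi / 4"
    and dist: "mdist X (c 0) (c 1) \<le> R" "mdist X (c' 0) (c' 1) \<le> R" "mdist X (c 0) (c' 0) \<le> R"
    and t: "t \<in> {0..1}"
  shows "mdist X (c t) (c' t) \<le> mdist X (c 0) (c' 0)"
proof -
  let ?a = "mdist X (c 0) (c 1)" and ?b = "mdist X (c' 0) (c' 1)"
  obtain cs where cs: "cs \<in> {-1..1}" "law_of_cosines \<kappa> ?a ?b cs = mdist X (c 0) (c' 0)"
    and le: "\<forall>s\<in>{0..1}. \<forall>t\<in>{0..1}. mdist X (c (1 - s)) (c' t) \<le> law_of_cosines \<kappa> (s * ?a) ((1 - t) * ?b) cs"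
    using CAT_hinge[OF cat reverse_geodesic[OF c] c', of R] R dist eq by (auto simp: mdist_commute)
  have "?a \<le> R" "?b \<le> R" using dist by auto
  then have "sqrt \<kappa> * (?a + ?b) \<le> pi" if "\<kappa> > 0"
  proof -
    have "sqrt \<kappa> * (?a + ?b) \<le> sqrt \<kappa> * (2 * R)" using dist that by (intro mult_left_mono) auto
    then show ?thesis using R[OF that] pi_gt_zero by linarith
  qed
  then have "law_of_cosines \<kappa> ((1 - t) * ?a) ((1 - t) * ?b) cs \<le> law_of_cosines \<kappa> ?a ?b cs"
    using t cs by (intro law_of_cosines_contract) auto
  moreover have "mdist X (c (1 - (1 - t))) (c' t) \<le> law_of_cosines \<kappa> ((1 - t) * ?a) ((1 - t) * ?b) cs"
    using le t by (metis add_diff_cancel_left' atLeastAtMost_iff diff_ge_0_iff_ge diff_left_mono diff_zero)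
  ultimately show ?thesis using cs by simp
qed

section \<open>Points that almost divide a side lie near it\<close>

lemma cos_ge_cos_minus:
  assumes "0 \<le> u" "u \<le> w + e" "0 \<le> w" "w \<le> pi" "0 \<le> e"
  shows "cos w - e \<le> cos (u::real)"
proof (cases "u \<le> w")
  case True
  then have "cos w \<le> cos u" using assms by (intro cos_monotone_0_pi_le) auto
  then show ?thesis using assms by linarith
next
  case False
  then have "\<exists>z. w < z \<and> z < u \<and> cos u - cos w = (u - w) * - sin z"
    by (intro MVT2) (auto intro!: derivative_eq_intros)
  then obtain z where z: "cos u - cos w = - ((u - w) * sin z)" by auto
  have "(u - w) * sin z \<le> (u - w) * 1" using False by (intro mult_left_mono) auto
  moreover have "u - w \<le> e" using assms(2) by linarith
  ultimately have "(u - w) * sin z \<le> e" by (metis mult.right_neutral order_trans)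
  then show ?thesis using z by linarith
qed

text \<open>With \<open>b\<close> the third side, Stewart's theorem on the sphere reads
  \<open>sin v cos d = sin ((1 - l) v) cos u + sin (l v) cos b\<close>, where \<open>d\<close> is the distance of the point
  dividing the side \<open>v\<close> from the opposite vertex.\<close>

lemma spherical_thin:
  fixes u v l c e :: real
  assumes "0 \<le> u" "0 \<le> v" "v \<le> pi / 2" and l: "l \<in> {0..1}" and c: "c \<in> {-1..1}" and "0 \<le> e"
    and 1: "u \<le> l * v + e"
    and 2: "arccos (cos u * cos v + sin u * sin v * c) \<le> (1 - l) * v + e"
  shows "1 - 2 * e \<le> cos u * cos (l * v) + sin u * sin (l * v) * c"
proof -
  define X where "X = cos u * cos (l * v) + sin u * sin (l * v) * c"
  define b where "b = arccos (cos u * cos v + sin u * sin v * c)"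
  have rng: "-1 \<le> cos u * cos v + sin u * sin v * c" "cos u * cos v + sin u * sin v * c \<le> 1"
    using spherical_cosine_range[OF c, of u v] by (auto simp: abs_le_iff)
  have cosb: "cos b = cos u * cos v + sin u * sin v * c" "0 \<le> b"
    unfolding b_def using rng by (auto intro: cos_arccos arccos_lbound)
  have lv: "0 \<le> l * v" "l * v \<le> v" "0 \<le> (1 - l) * v" "(1 - l) * v \<le> v"
    using l assms(2) by (auto intro: mult_left_le_one_le)
  have cu: "cos (l * v) - e \<le> cos u"
    using assms lv pi_gt_zero by (intro cos_ge_cos_minus) auto
  have cb: "cos ((1 - l) * v) - e \<le> cos b"
    using assms lv pi_gt_zero cosb 2 by (intro cos_ge_cos_minus) (auto simp: b_def)
  show ?thesis
  proof (cases "v = 0")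
    case True
    then show ?thesis using cu \<open>0 \<le> e\<close> by simp
  next
    case False
    then have sv: "sin v > 0" using assms pi_gt_zero by (intro sin_gt_zero) auto
    have s: "0 \<le> sin (l * v)" "sin (l * v) \<le> sin v" "0 \<le> sin ((1 - l) * v)" "sin ((1 - l) * v) \<le> sin v"
    proof -
      have "- (pi / 2) \<le> l * v" "- (pi / 2) \<le> (1 - l) * v" "l * v \<le> pi" "(1 - l) * v \<le> pi"
        using lv assms(3) pi_gt_zero by linarith+
      then show "0 \<le> sin (l * v)" "sin (l * v) \<le> sin v" "0 \<le> sin ((1 - l) * v)" "sin ((1 - l) * v) \<le> sin v"
        using lv assms(3) by (auto intro!: sin_ge_zero sin_monotone_2pi_le)
    qed
    have e1: "(1 - l) * v = v - l * v" by algebra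
    have "sin v * X = sin ((1 - l) * v) * cos u + sin (l * v) * cos b"
      unfolding e1 sin_diff X_def cosb by algebra
    also have "\<dots> \<ge> sin ((1 - l) * v) * (cos (l * v) - e) + sin (l * v) * (cos ((1 - l) * v) - e)"
      using cu cb s by (intro add_mono mult_left_mono) auto
    also have "sin ((1 - l) * v) * (cos (l * v) - e) + sin (l * v) * (cos ((1 - l) * v) - e)
        = sin ((1 - l) * v + l * v) - e * (sin ((1 - l) * v) + sin (l * v))"
      unfolding sin_add by algebra
    also have "(1 - l) * v + l * v = v" by (simp add: algebra_simps)
    finally have "sin v - e * (sin ((1 - l) * v) + sin (l * v)) \<le> sin v * X" by simp
    moreover have "e * (sin ((1 - l) * v) + sin (l * v)) \<le> e * (2 * sin v)"
      using s \<open>0 \<le> e\<close> by (intro mult_left_mono) auto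
    ultimately have "sin v * (1 - 2 * e) \<le> sin v * X" by (simp add: algebra_simps)
    then show ?thesis using sv unfolding X_def by simp
  qed
qed

text \<open>The hyperbolic form of Stewart's theorem is \<open>sinh v * cosh d = sinh ((1 - l) * v)
  * cosh u + sinh (l * v) * cosh b\<close>. Since \<open>cosh\<close> is not globally Lipschitz, the
  error depends on a bound \<open>S\<close> for the side.\<close>

lemma hyperbolic_thin:
  fixes u v l c e :: real
  assumes "0 \<le> u" "0 \<le> v" "v \<le> S" and l: "l \<in> {0..1}" and c: "c \<in> {-1..1}" and "0 \<le> e"
    and 1: "u \<le> l * v + e"
    and 2: "arcosh (cosh u * cosh v - sinh u * sinh v * c) \<le> (1 - l) * v + e"
  shows "cosh u * cosh (l * v) - sinh u * sinh (l * v) * c \<le> cosh e + 2 * sinh e * sinh S"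
proof -
  define X where "X = cosh u * cosh (l * v) - sinh u * sinh (l * v) * c"
  define b where "b = arcosh (cosh u * cosh v - sinh u * sinh v * c)"
  have cosb: "cosh b = cosh u * cosh v - sinh u * sinh v * c" "0 \<le> b"
    unfolding b_def using hyperbolic_cosine_range[OF c] by (auto intro: cosh_arcosh_real arcosh_nonneg_real)
  have lv: "0 \<le> l * v" "l * v \<le> v" "0 \<le> (1 - l) * v" "(1 - l) * v \<le> v"
    using l assms(2) by (auto intro: mult_left_le_one_le)
  have cu: "cosh u \<le> cosh (l * v + e)"
    using assms lv by (subst cosh_real_nonneg_le_iff) auto
  have cb: "cosh b \<le> cosh ((1 - l) * v + e)"
    using assms lv cosb 2 by (subst cosh_real_nonneg_le_iff) (auto simp: b_def)
  show ?thesis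
  proof (cases "v = 0")
    case True
    have "0 \<le> sinh e * sinh S" using assms by (intro mult_nonneg_nonneg) auto
    then show ?thesis using cu True by simp
  next
    case False
    then have sv: "sinh v > 0" using assms by simp
    have s: "0 \<le> sinh (l * v)" "sinh (l * v) \<le> sinh v" "0 \<le> sinh ((1 - l) * v)" "sinh ((1 - l) * v) \<le> sinh S"
      using lv assms by auto
    have e1: "(1 - l) * v = v - l * v" by algebra
    have "sinh v * X = sinh ((1 - l) * v) * cosh u + sinh (l * v) * cosh b"
      unfolding e1 sinh_diff X_def cosb by algebra
    also have "\<dots> \<le> sinh ((1 - l) * v) * cosh (l * v + e) + sinh (l * v) * cosh ((1 - l) * v + e)"
      using cu cb s by (intro add_mono mult_left_mono) auto
    also have "\<dots> = cosh e * sinh ((1 - l) * v + l * v) + 2 * sinh e * (sinh (l * v) * sinh ((1 - l) * v))"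
      unfolding sinh_add cosh_add by algebra
    also have "(1 - l) * v + l * v = v" by (simp add: algebra_simps)
    also have "2 * sinh e * (sinh (l * v) * sinh ((1 - l) * v)) \<le> 2 * sinh e * (sinh v * sinh S)"
      using s assms by (intro mult_left_mono mult_mono) auto
    finally have "sinh v * X \<le> sinh v * (cosh e + 2 * sinh e * sinh S)" by (simp add: algebra_simps)
    then show ?thesis using sv unfolding X_def by simp
  qed
qed

lemma eventually_gap:
  fixes f :: "real \<Rightarrow> real"
  assumes "isCont f 0" "f 0 < B"
  shows "\<exists>\<xi>>0. f \<xi> \<le> B"
proof -
  have "(f \<longlongrightarrow> f 0) (at_right 0)"
    using assms(1) by (simp add: isCont_def filterlim_at_split)
  then have "eventually (\<lambda>x. f x < B) (at_right 0)"
    using assms(2) by (rule order_tendstoD)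
  then obtain d where "d > 0" "\<forall>y>0. y < d \<longrightarrow> f y < B"
    unfolding eventually_at_right_field by auto
  then show ?thesis by (intro exI[of _ "d / 2"]) (auto intro: less_imp_le)
qed

text \<open>The point is that \<xi> depends only on \<kappa>, \<open>R\<close> and \<eta>. On the
  sphere and the hyperbolic plane it comes from the preceding estimates. In the plane, Stewart's
  theorem writes the squared distance as
  \<open>(1 - l) * a\<^sup>2 + l * q - l * (1 - l) * D\<^sup>2\<close>; the main terms cancel and at
  most \<open>\<xi>\<^sup>2 + 4 * R * \<xi>\<close> remains.\<close>

lemma law_of_cosines_thin:
  assumes small: "\<kappa> > 0 \<Longrightarrow> sqrt \<kappa> * R \<le> pi / 4" and "\<eta> > 0" "R \<ge> 0"
  shows "\<exists>\<xi>>0. \<forall>a D l c. 0 \<le> a \<and> 0 \<le> D \<and> D \<le> R \<and> l \<in> {0..1} \<and> c \<in> {-1..1} \<and> a \<le> l * D + \<xi> \<and>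
      law_of_cosines \<kappa> a D c \<le> (1 - l) * D + \<xi> \<longrightarrow> law_of_cosines \<kappa> a (l * D) c \<le> \<eta>"
proof -
  consider "\<kappa> > 0" | "\<kappa> = 0" | "\<kappa> < 0" by linarith
  then show ?thesis
  proof cases
    case 1
    let ?k = "sqrt \<kappa>"
    have k: "?k > 0" using 1 by simp
    \<comment> \<open>The cap at \<open>pi\<close> keeps \<open>arccos (cos h) = h\<close>; the
      value of \<xi> below solves \<open>1 - 2 * (?k * \<xi>) = cos h\<close>.\<close>
    define h where "h = min (?k * \<eta>) pi"
    have h: "0 < h" "h \<le> pi" using k \<open>\<eta> > 0\<close> by (auto simp: h_def)
    have "cos h < cos 0" using h by (intro cos_monotone_0_pi) auto
    then have ch: "cos h < 1" by simp
    define \<xi> where "\<xi> = (1 - cos h) / (2 * ?k)"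
    have xi: "\<xi> > 0" "1 - 2 * (?k * \<xi>) = cos h" using ch k by (auto simp: \<xi>_def field_simps)
    have "law_of_cosines \<kappa> a (l * D) c \<le> \<eta>"
      if H: "0 \<le> a" "0 \<le> D" "D \<le> R" "l \<in> {0..1}" "c \<in> {-1..1}" "a \<le> l * D + \<xi>"
      "law_of_cosines \<kappa> a D c \<le> (1 - l) * D + \<xi>" for a D l c
    proof -
      define X where "X = cos (?k * a) * cos (l * (?k * D)) + sin (?k * a) * sin (l * (?k * D)) * c"
      have "?k * D \<le> ?k * R" using H k by (intro mult_left_mono) auto
      then have kD: "?k * D \<le> pi / 2" using small[OF 1] pi_gt_zero by linarith
      have m: "?k * a \<le> ?k * (l * D + \<xi>)" using H k by (intro mult_left_mono) auto
      have m2: "?k * law_of_cosines \<kappa> a D c \<le> ?k * ((1 - l) * D + \<xi>)" using H k by (intro mult_left_mono) auto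
      have "cos h \<le> X"
        unfolding X_def xi(2)[symmetric]
      proof (rule spherical_thin)
        show "?k * a \<le> l * (?k * D) + ?k * \<xi>" using m by (simp add: algebra_simps)
        show "arccos (cos (?k * a) * cos (?k * D) + sin (?k * a) * sin (?k * D) * c) \<le> (1 - l) * (?k * D) + ?k * \<xi>"
          using m2 k 1 by (simp add: law_of_cosines_def algebra_simps)
      qed (use H k xi kD in auto)
      moreover have "X \<le> 1" using spherical_cosine_range[OF H(5)] unfolding X_def by (meson abs_le_iff)
      ultimately have "arccos X \<le> arccos (cos h)"
        using cos_ge_minus_one[of h] by (intro arccos_le_arccos) auto
      also have "\<dots> = h" using h by (simp add: arccos_cos)
      also have "\<dots> \<le> ?k * \<eta>" by (simp add: h_def)
      finally show ?thesis using k 1 by (simp add: law_of_cosines_def X_def field_simps)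
    qed
    then show ?thesis using xi(1) by blast
  next
    case 2
    have "\<exists>\<xi>>0. \<xi>\<^sup>2 + 4 * R * \<xi> \<le> \<eta>\<^sup>2"
      using \<open>\<eta> > 0\<close> by (intro eventually_gap) (auto intro!: continuous_intros)
    then obtain \<xi> where xi: "\<xi> > 0" "\<xi>\<^sup>2 + 4 * R * \<xi> \<le> \<eta>\<^sup>2" by auto
    have "law_of_cosines \<kappa> a (l * D) c \<le> \<eta>"
      if H: "0 \<le> a" "0 \<le> D" "D \<le> R" "l \<in> {0..1}" "c \<in> {-1..1}" "a \<le> l * D + \<xi>"
      "law_of_cosines \<kappa> a D c \<le> (1 - l) * D + \<xi>" for a D l c
    proof -
      define q where "q = a\<^sup>2 + D\<^sup>2 - 2 * a * D * c"
      have "0 \<le> q" using euclidean_cosine_range[OF H(5)] by (simp add: q_def)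
      moreover have "sqrt q \<le> (1 - l) * D + \<xi>" using H(7) 2 by (simp add: law_of_cosines_def q_def)
      ultimately have q: "q \<le> ((1 - l) * D + \<xi>)\<^sup>2" by (metis sqrt_le_D)
      have a: "a\<^sup>2 \<le> (l * D + \<xi>)\<^sup>2" using H by (intro power_mono) auto
      have "a\<^sup>2 + (l * D)\<^sup>2 - 2 * a * (l * D) * c = (1 - l) * a\<^sup>2 + l * q - l * (1 - l) * D\<^sup>2"
        unfolding q_def by algebra
      also have "\<dots> \<le> (1 - l) * (l * D + \<xi>)\<^sup>2 + l * ((1 - l) * D + \<xi>)\<^sup>2 - l * (1 - l) * D\<^sup>2"
        using q a H by (intro diff_right_mono add_mono mult_left_mono) auto
      also have "\<dots> = \<xi>\<^sup>2 + 4 * (l * (1 - l) * D) * \<xi>" by algebra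
      also have "\<dots> \<le> \<xi>\<^sup>2 + 4 * R * \<xi>"
      proof -
        have "l * (1 - l) \<le> 1" using H by (simp add: mult_le_one)
        moreover have "0 \<le> l * (1 - l)" using H by simp
        ultimately have "l * (1 - l) * D \<le> D" using H(2) by (simp add: mult_left_le_one_le)
        then show ?thesis using xi H by (auto intro!: mult_right_mono)
      qed
      also have "\<dots> \<le> \<eta>\<^sup>2" by (fact xi)
      finally show ?thesis using 2 \<open>\<eta> > 0\<close> by (simp add: law_of_cosines_def real_le_lsqrt)
    qed
    then show ?thesis using xi(1) by blast
  next
    case 3
    let ?k = "sqrt (- \<kappa>)"
    have k: "?k > 0" using 3 by simp
    have "\<exists>\<xi>>0. cosh (?k * \<xi>) + 2 * sinh (?k * \<xi>) * sinh (?k * R) \<le> cosh (?k * \<eta>)"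
      using k \<open>\<eta> > 0\<close> cosh_real_strict_mono[of 0 "?k * \<eta>"] by (intro eventually_gap) (auto intro!: continuous_intros)
    then obtain \<xi> where xi: "\<xi> > 0" "cosh (?k * \<xi>) + 2 * sinh (?k * \<xi>) * sinh (?k * R) \<le> cosh (?k * \<eta>)" by auto
    have "law_of_cosines \<kappa> a (l * D) c \<le> \<eta>"
      if H: "0 \<le> a" "0 \<le> D" "D \<le> R" "l \<in> {0..1}" "c \<in> {-1..1}" "a \<le> l * D + \<xi>"
      "law_of_cosines \<kappa> a D c \<le> (1 - l) * D + \<xi>" for a D l c
    proof -
      define X where "X = cosh (?k * a) * cosh (l * (?k * D)) - sinh (?k * a) * sinh (l * (?k * D)) * c"
      have kD: "?k * D \<le> ?k * R" using H k by (intro mult_left_mono) auto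
      have m: "?k * a \<le> ?k * (l * D + \<xi>)" using H k by (intro mult_left_mono) auto
      have m2: "?k * law_of_cosines \<kappa> a D c \<le> ?k * ((1 - l) * D + \<xi>)" using H k by (intro mult_left_mono) auto
      have "X \<le> cosh (?k * \<xi>) + 2 * sinh (?k * \<xi>) * sinh (?k * R)"
        unfolding X_def
      proof (rule hyperbolic_thin[OF _ _ kD])
        show "?k * a \<le> l * (?k * D) + ?k * \<xi>" using m by (simp add: algebra_simps)
        show "arcosh (cosh (?k * a) * cosh (?k * D) - sinh (?k * a) * sinh (?k * D) * c) \<le> (1 - l) * (?k * D) + ?k * \<xi>"
          using m2 k 3 by (simp add: law_of_cosines_def algebra_simps)
      qed (use H k xi kD in auto)
      then have "X \<le> cosh (?k * \<eta>)" using xi by linarith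
      moreover have "1 \<le> X" using hyperbolic_cosine_range[OF H(5)] unfolding X_def .
      ultimately have "arcosh X \<le> arcosh (cosh (?k * \<eta>))"
        using arcosh_real_strict_mono[of X "cosh (?k * \<eta>)"] by (metis dual_order.refl le_less)
      also have "\<dots> = ?k * \<eta>" using k \<open>\<eta> > 0\<close> by (intro arcosh_cosh_real) auto
      finally show ?thesis using k 3 by (simp add: law_of_cosines_def X_def field_simps)
    qed
    then show ?thesis using xi(1) by blast
  qed
qed

text \<open>Transport costs only reveal the distances of \<open>z\<close> to the two endpoints. This
  converts that information into the position of \<open>z\<close>, with a tolerance independent of
  the geodesic, of \<open>z\<close> and of \<open>l\<close>. The hinge sits at \<open>c 0\<close>,
  with sides towards \<open>z\<close> and \<open>c 1\<close>.\<close>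

lemma CAT_thin:
  assumes cat: "CAT \<kappa> X" and R: "\<kappa> > 0 \<Longrightarrow> sqrt \<kappa> * R \<le> pi / 4" and "\<eta> > 0" "R \<ge> 0"
  shows "\<exists>\<xi>>0. \<forall>c z l. is_geodesic X c \<and> z \<in> mspace X \<and> l \<in> {0..1} \<and>
      mdist X (c 0) (c 1) \<le> R \<and> mdist X (c 0) z \<le> R \<and> mdist X z (c 1) \<le> R \<and>
      mdist X (c 0) z \<le> l * mdist X (c 0) (c 1) + \<xi> \<and> mdist X z (c 1) \<le> (1 - l) * mdist X (c 0) (c 1) + \<xi>
      \<longrightarrow> mdist X z (c l) \<le> \<eta>"
proof -
  obtain \<xi> where xi: "\<xi> > 0" and thin: "\<And>a D l c. 0 \<le> a \<Longrightarrow> 0 \<le> D \<Longrightarrow> D \<le> R \<Longrightarrow> l \<in> {0..1} \<Longrightarrow> c \<in> {-1..1}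
      \<Longrightarrow> a \<le> l * D + \<xi> \<Longrightarrow> law_of_cosines \<kappa> a D c \<le> (1 - l) * D + \<xi> \<Longrightarrow> law_of_cosines \<kappa> a (l * D) c \<le> \<eta>"
    using law_of_cosines_thin[OF R \<open>\<eta> > 0\<close> \<open>R \<ge> 0\<close>] by meson
  have "mdist X z (c l) \<le> \<eta>"
    if c: "is_geodesic X c" and z: "z \<in> mspace X" and l: "l \<in> {0..1}"
      and d: "mdist X (c 0) (c 1) \<le> R" "mdist X (c 0) z \<le> R" "mdist X z (c 1) \<le> R"
      and a: "mdist X (c 0) z \<le> l * mdist X (c 0) (c 1) + \<xi>" "mdist X z (c 1) \<le> (1 - l) * mdist X (c 0) (c 1) + \<xi>"
    for c z l
  proof -
    let ?D = "mdist X (c 0) (c 1)" and ?a = "mdist X (c 0) z"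
    have c0: "c 0 \<in> mspace X" using geodesic_in_mspace[OF c] by simp
    obtain e where e: "is_geodesic X e" "e 0 = c 0" "e 1 = z"
      using CAT_geodesic[OF cat R c0 z] d by auto
    obtain cs where cs: "cs \<in> {-1..1}" "law_of_cosines \<kappa> ?a ?D cs = mdist X z (c 1)"
      and le: "\<forall>s\<in>{0..1}. \<forall>t\<in>{0..1}. mdist X (e s) (c (1 - t)) \<le> law_of_cosines \<kappa> (s * ?a) ((1 - t) * ?D) cs"
      using CAT_hinge[OF cat e(1) reverse_geodesic[OF c], of R] R d e by (auto simp: mdist_commute)
    have "mdist X (e 1) (c (1 - (1 - l))) \<le> law_of_cosines \<kappa> (1 * ?a) ((1 - (1 - l)) * ?D) cs"
      using le l by (metis add_diff_cancel_left' atLeastAtMost_iff diff_ge_0_iff_ge diff_left_mono diff_zero order_refl zero_le_one)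
    moreover have "law_of_cosines \<kappa> ?a (l * ?D) cs \<le> \<eta>"
      using thin[of ?a ?D l cs] d a l cs by simp
    ultimately show ?thesis using e by simp
  qed
  then show ?thesis using xi by blast
qed

section \<open>Borel sets of a metric space\<close>

lemma openin_mtopology_of:
  "openin (mtopology_of X) U \<longleftrightarrow> U \<subseteq> mspace X \<and> (\<forall>x\<in>U. \<exists>r>0. mball_of X x r \<subseteq> U)"
  unfolding mtopology_of_def mball_of_def
  by (auto simp: Metric_space.openin_mtopology Metric_space_mspace_mdist)

lemma openin_imp_subset_mspace: "openin (mtopology_of X) U \<Longrightarrow> U \<subseteq> mspace X"
  using openin_subset[of "mtopology_of X" U] by simp

lemma mdist_self [simp]: "x \<in> mspace X \<Longrightarrow> mdist X x x = 0"
  by simp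

lemma mball_of_mono: "r \<le> s \<Longrightarrow> mball_of X x r \<subseteq> mball_of X x s"
  by auto

lemma openin_mball_of [simp]: "openin (mtopology_of X) (mball_of X x r)"
  unfolding mtopology_of_def mball_of_def
  by (simp add: Metric_space.openin_mball Metric_space_mspace_mdist)

lemma closedin_mcball_of [simp]: "closedin (mtopology_of X) (mcball_of X x r)"
  unfolding mtopology_of_def mcball_of_def
  by (simp add: Metric_space.closedin_mcball Metric_space_mspace_mdist)

lemma space_metric_borel [simp]: "space (metric_borel X) = mspace X"
  unfolding metric_borel_def by (intro space_measure_of) (auto dest: openin_imp_subset_mspace)

lemma sets_metric_borel: "sets (metric_borel X) = sigma_sets (mspace X) {U. openin (mtopology_of X) U}"
  unfolding metric_borel_def by (intro sets_measure_of) (auto dest: openin_imp_subset_mspace)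

lemma openin_in_metric_borel: "openin (mtopology_of X) U \<Longrightarrow> U \<in> sets (metric_borel X)"
  by (auto simp: sets_metric_borel)

lemma closedin_in_metric_borel: "closedin (mtopology_of X) F \<Longrightarrow> F \<in> sets (metric_borel X)"
proof -
  assume F: "closedin (mtopology_of X) F"
  then have "mspace X - F \<in> sets (metric_borel X)"
    by (intro openin_in_metric_borel) (auto simp: closedin_def)
  then have "space (metric_borel X) - (mspace X - F) \<in> sets (metric_borel X)" by (rule sets.compl_sets)
  moreover have "F \<subseteq> mspace X" using closedin_subset[OF F] by simp
  ultimately show ?thesis by (simp add: double_diff)
qed

lemma mball_of_in_metric_borel [simp, measurable]: "mball_of X x r \<in> sets (metric_borel X)"
  by (simp add: openin_in_metric_borel)

lemma mcball_of_in_metric_borel [simp, measurable]: "mcball_of X x r \<in> sets (metric_borel X)"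
  by (simp add: closedin_in_metric_borel)

section \<open>Separability and measurability of the distance\<close>

definition dense_subset :: "'a metric \<Rightarrow> 'a set \<Rightarrow> 'a set \<Rightarrow> bool" where
  "dense_subset X S D \<longleftrightarrow> D \<subseteq> S \<and> (\<forall>x\<in>S. \<forall>e>0. \<exists>q\<in>D. mdist X x q < e)"

text \<open>In metric spaces separability passes to subsets: for each point of a countable dense set
  and each scale \<open>inverse (Suc n)\<close>, one nearby point of \<open>S\<close> is chosen
  whenever there is one. The case of balls is needed later to make the glued space
  separable.\<close>

lemma separable_imp_countable_dense:
  assumes "separable_space (mtopology_of X)" and S: "S \<subseteq> mspace X"
  shows "\<exists>D. countable D \<and> dense_subset X S D"
proof -
  obtain C where C: "countable C" "C \<subseteq> mspace X" "mtopology_of X closure_of C = mspace X"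
    using assms unfolding separable_space_def by auto
  have C_dense: "\<exists>q\<in>C. mdist X x q < e" if x: "x \<in> mspace X" and "e > 0" for x e
  proof -
    have "x \<in> mtopology_of X closure_of C" using C(3) x by simp
    moreover have "x \<in> mball_of X x e" using x \<open>e > 0\<close> by simp
    ultimately obtain q where "q \<in> C" "q \<in> mball_of X x e"
      using openin_mball_of[of X x e] unfolding in_closure_of by meson
    then show ?thesis by auto
  qed
  define P where "P = (\<lambda>(q, n::nat) x. x \<in> S \<and> mdist X q x < inverse (Suc n))"
  define D where "D = (\<lambda>i. SOME x. P i x) ` {i \<in> C \<times> UNIV. \<exists>x. P i x}"
  have "countable D" unfolding D_def
    using C(1) by (intro countable_image countable_Collect countable_SIGMA) auto
  moreover have "D \<subseteq> S"
  proof
    fix y assume "y \<in> D"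
    then obtain i where "\<exists>x. P i x" "y = (SOME x. P i x)" unfolding D_def by auto
    then have "P i y" by (metis someI_ex)
    then show "y \<in> S" unfolding P_def by (auto split: prod.splits)
  qed
  moreover have "\<exists>y\<in>D. mdist X x y < e" if x: "x \<in> S" and "e > 0" for x e
  proof -
    obtain n where n: "inverse (real (Suc n)) < e / 2" using reals_Archimedean[of "e / 2"] \<open>e > 0\<close> by auto
    obtain q where q: "q \<in> C" "mdist X x q < inverse (Suc n)" using C_dense[of x "inverse (Suc n)"] x S by auto
    have ex: "\<exists>x. P (q, n) x" using q x by (auto simp: P_def mdist_commute)
    define y where "y = (SOME x. P (q, n) x)"
    have y: "P (q, n) y" unfolding y_def using ex by (rule someI_ex)
    have "y \<in> D" unfolding D_def y_def using ex q by blast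
    moreover have "mdist X x y \<le> mdist X x q + mdist X q y"
      using x S q C(2) y by (intro mdist_triangle) (auto simp: P_def)
    then have "mdist X x y < e" using q y n unfolding P_def by auto
    ultimately show ?thesis by blast
  qed
  ultimately show ?thesis unfolding dense_subset_def by blast
qed

lemma measurable_mdist_const [measurable]:
  "a \<in> mspace X \<Longrightarrow> mdist X a \<in> borel_measurable (metric_borel X)"
proof (subst borel_measurable_iff_less, intro allI)
  fix c assume "a \<in> mspace X"
  then have "{w \<in> space (metric_borel X). mdist X a w < c} = mball_of X a c" by auto
  then show "{w \<in> space (metric_borel X). mdist X a w < c} \<in> sets (metric_borel X)" by simp
qed

text \<open>The product \<sigma>-algebra could be smaller than the Borel algebra of the product
  space, so continuity alone is not enough. A detour through a point \<open>q\<close> of a countable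
  dense set turns \<open>{d < c}\<close> into a countable union of sets built from functions of one
  coordinate.\<close>

lemma measurable_mdist:
  assumes "countable D" and D: "dense_subset X (mspace X) D"
  shows "(\<lambda>p. mdist X (fst p) (snd p)) \<in> borel_measurable (metric_borel X \<Otimes>\<^sub>M metric_borel X)"
proof (subst borel_measurable_iff_less, intro allI)
  fix c
  let ?M = "metric_borel X \<Otimes>\<^sub>M metric_borel X"
  have Dm: "q \<in> mspace X" if "q \<in> D" for q using D that by (auto simp: dense_subset_def)
  have "{p \<in> space ?M. mdist X (fst p) (snd p) < c}
      = (\<Union>q\<in>D. {p \<in> space ?M. mdist X q (fst p) + mdist X q (snd p) < c})"
  proof (intro equalityI subsetI)
    fix p assume p: "p \<in> {p \<in> space ?M. mdist X (fst p) (snd p) < c}"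
    then have m: "fst p \<in> mspace X" "snd p \<in> mspace X" by (auto simp: space_pair_measure)
    define e where "e = (c - mdist X (fst p) (snd p)) / 2"
    have "e > 0" using p by (auto simp: e_def)
    then obtain q where q: "q \<in> D" "mdist X (fst p) q < e"
      using D m(1) unfolding dense_subset_def by blast
    have "mdist X q (snd p) \<le> mdist X (fst p) q + mdist X (fst p) (snd p)"
      using mdist_triangle[of q X "fst p" "snd p"] m Dm[OF q(1)] by (simp add: mdist_commute)
    then have "mdist X q (fst p) + mdist X q (snd p) < c"
      using q(2) by (simp add: e_def mdist_commute[of X q "fst p"] field_simps)
    then show "p \<in> (\<Union>q\<in>D. {p \<in> space ?M. mdist X q (fst p) + mdist X q (snd p) < c})"
      using p q by auto
  next
    fix p assume "p \<in> (\<Union>q\<in>D. {p \<in> space ?M. mdist X q (fst p) + mdist X q (snd p) < c})"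
    then obtain q where q: "q \<in> D" "p \<in> space ?M" "mdist X q (fst p) + mdist X q (snd p) < c" by auto
    then have "mdist X (fst p) (snd p) \<le> mdist X (fst p) q + mdist X q (snd p)"
      using Dm by (intro mdist_triangle) (auto simp: space_pair_measure)
    then show "p \<in> {p \<in> space ?M. mdist X (fst p) (snd p) < c}"
      using q by (simp add: mdist_commute[of X "fst p" q])
  qed
  also have "\<dots> \<in> sets ?M"
  proof (rule sets.countable_UN''[OF assms(1)])
    fix q assume "q \<in> D"
    then have [measurable]: "mdist X q \<in> borel_measurable (metric_borel X)" using Dm by simp
    show "{p \<in> space ?M. mdist X q (fst p) + mdist X q (snd p) < c} \<in> sets ?M" by measurable
  qed
  finally show "{p \<in> space ?M. mdist X (fst p) (snd p) < c} \<in> sets ?M" .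
qed

lemma measurable_Lipschitz_on:
  assumes M: "sets M = sets (metric_borel X)" and S: "S \<in> sets M"
    and f: "f ` S \<subseteq> mspace W" and "L > 0"
    and lip: "\<And>x y. x \<in> S \<Longrightarrow> y \<in> S \<Longrightarrow> mdist W (f x) (f y) \<le> L * mdist X x y"
  shows "f \<in> restrict_space M S \<rightarrow>\<^sub>M metric_borel W"
proof -
  have spM: "space M = mspace X" using sets_eq_imp_space_eq[OF M] by simp
  have SX: "S \<subseteq> mspace X" using sets.sets_into_space[OF S] spM by simp
  show ?thesis
    unfolding metric_borel_def
  proof (rule measurable_measure_of)
    fix U assume "U \<in> {U. openin (mtopology_of W) U}"
    then have U: "\<And>y. y \<in> U \<Longrightarrow> \<exists>r>0. mball_of W y r \<subseteq> U" by (auto simp: openin_mtopology_of)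
    define B where "B = {(x, r). x \<in> S \<and> f ` (S \<inter> mball_of X x r) \<subseteq> U}"
    have "openin (mtopology_of X) (\<Union>(x, r)\<in>B. mball_of X x r)" by (intro openin_Union) auto
    then have "(\<Union>(x, r)\<in>B. mball_of X x r) \<inter> S \<in> sets M"
      using S M by (intro sets.Int) (auto intro: openin_in_metric_borel)
    moreover have "f -` U \<inter> space (restrict_space M S) = (\<Union>(x, r)\<in>B. mball_of X x r) \<inter> S"
    proof (intro equalityI subsetI)
      fix x assume "x \<in> f -` U \<inter> space (restrict_space M S)"
      then have x: "x \<in> S" "f x \<in> U" by (auto simp: space_restrict_space)
      then obtain r where r: "r > 0" "mball_of W (f x) r \<subseteq> U" using U by blast
      have "f y \<in> U" if "y \<in> S \<inter> mball_of X x (r / L)" for y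
      proof -
        have "mdist W (f x) (f y) \<le> L * mdist X x y" using lip x that by auto
        also have "\<dots> < r" using that \<open>L > 0\<close> by (simp add: field_simps)
        finally have "f y \<in> mball_of W (f x) r" using f x that by auto
        then show ?thesis using r by blast
      qed
      then have "(x, r / L) \<in> B" using x by (auto simp: B_def)
      moreover have "x \<in> mball_of X x (r / L)" using x SX r \<open>L > 0\<close> by auto
      ultimately show "x \<in> (\<Union>(x, r)\<in>B. mball_of X x r) \<inter> S" using x by blast
    next
      fix y assume "y \<in> (\<Union>(x, r)\<in>B. mball_of X x r) \<inter> S"
      then show "y \<in> f -` U \<inter> space (restrict_space M S)"
        using SX spM S by (auto simp: space_restrict_space B_def)
    qed
    ultimately show "f -` U \<inter> space (restrict_space M S) \<in> sets (restrict_space M S)"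
      by (simp add: sets_restrict_space_iff S)
  next
    show "{U. openin (mtopology_of W) U} \<subseteq> Pow (mspace W)" using openin_imp_subset_mspace by blast
  qed (use f SX spM in \<open>auto simp: space_restrict_space\<close>)
qed

section \<open>Inner regularity by closed sets\<close>

lemma closedin_interior_points:
  "closedin (mtopology_of X) {x \<in> mspace X. mball_of X x r \<subseteq> U}"
proof -
  have "openin (mtopology_of X) (mspace X - {x \<in> mspace X. mball_of X x r \<subseteq> U})"
    unfolding openin_mtopology_of
  proof (intro conjI ballI)
    fix x assume "x \<in> mspace X - {x \<in> mspace X. mball_of X x r \<subseteq> U}"
    then obtain y where y: "x \<in> mspace X" "y \<in> mspace X" "mdist X x y < r" "y \<notin> U"
      unfolding subset_iff by auto
    have "mball_of X x (r - mdist X x y) \<subseteq> mspace X - {x \<in> mspace X. mball_of X x r \<subseteq> U}"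
    proof
      fix z assume z: "z \<in> mball_of X x (r - mdist X x y)"
      have "mdist X z y \<le> mdist X z x + mdist X x y" using y z by (intro mdist_triangle) auto
      then have "mdist X z y < r" using z by (auto simp: mdist_commute)
      then show "z \<in> mspace X - {x \<in> mspace X. mball_of X x r \<subseteq> U}" using y z by auto
    qed
    then show "\<exists>e>0. mball_of X x e \<subseteq> mspace X - {x \<in> mspace X. mball_of X x r \<subseteq> U}"
      using y by (intro exI[of _ "r - mdist X x y"]) auto
  qed auto
  then show ?thesis by (auto simp: closedin_def)
qed

text \<open>Approximation is demanded for \<open>A\<close> and its complement together, so that the
  class is visibly closed under complements. Open sets belong to it because the points whose ball of
  radius \<open>inverse (Suc n)\<close> stays inside form closed sets exhausting them.\<close>

lemma metric_borel_regular:
  assumes "finite_measure M" and M: "sets M = sets (metric_borel X)" and "A \<in> sets M"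
  shows "\<forall>e>0. \<exists>F G. closedin (mtopology_of X) F \<and> closedin (mtopology_of X) G \<and>
     F \<subseteq> A \<and> G \<subseteq> mspace X - A \<and> measure M (A - F) < e \<and> measure M ((mspace X - A) - G) < e"
    (is "?P A")
proof -
  interpret finite_measure M by fact
  have [simp]: "space M = mspace X" using sets_eq_imp_space_eq[OF M] by simp
  have closed: "F \<in> sets M" if "closedin (mtopology_of X) F" for F
    using closedin_in_metric_borel[OF that] M by simp
  have "A \<in> sigma_sets (mspace X) {U. openin (mtopology_of X) U}"
    using assms(3) M by (simp add: sets_metric_borel)
  then have "A \<in> sets M \<and> ?P A"
  proof induction
    case (Basic U)
    then have U: "openin (mtopology_of X) U" by simp
    then have Um: "U \<in> sets M" using M by (simp add: openin_in_metric_borel)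
    define F where "F = (\<lambda>n::nat. {x \<in> mspace X. mball_of X x (inverse (Suc n)) \<subseteq> U})"
    have F: "closedin (mtopology_of X) (F n)" "F n \<subseteq> U" for n
    proof -
      have "x \<in> mball_of X x (inverse (Suc n))" if "x \<in> mspace X" for x using that by simp
      then show "F n \<subseteq> U" unfolding F_def by blast
    qed (simp add: F_def closedin_interior_points)
    have "(\<lambda>n. measure M (U - F n)) \<longlonglongrightarrow> measure M (\<Inter>n. U - F n)"
    proof (rule finite_Lim_measure_decseq)
      show "range (\<lambda>n. U - F n) \<subseteq> sets M" using Um closed[OF F(1)] by auto
      show "decseq (\<lambda>n. U - F n)"
      proof (rule antimonoI)
        fix a b :: nat assume "a \<le> b"
        then have "inverse (real (Suc b)) \<le> inverse (real (Suc a))" by (simp add: field_simps)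
        then have "mball_of X x (inverse (Suc b)) \<subseteq> mball_of X x (inverse (Suc a))" for x by (rule mball_of_mono)
        then show "U - F b \<subseteq> U - F a" unfolding F_def by blast
      qed
    qed
    moreover have "(\<Inter>n. U - F n) = {}"
    proof -
      have "\<exists>n. x \<in> F n" if x: "x \<in> U" for x
      proof -
        obtain r where r: "r > 0" "mball_of X x r \<subseteq> U" "x \<in> mspace X"
          using U x unfolding openin_mtopology_of by blast
        obtain n where "inverse (real (Suc n)) < r" using reals_Archimedean[OF r(1)] by auto
        then have "mball_of X x (inverse (Suc n)) \<subseteq> U" using r(2) by (fastforce simp: subset_iff)
        then show ?thesis using r unfolding F_def by blast
      qed
      then show ?thesis by blast
    qed
    ultimately have lim: "(\<lambda>n. measure M (U - F n)) \<longlonglongrightarrow> 0" by (metis measure_empty)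
    have "?P U"
    proof (intro allI impI)
      fix e :: real assume "e > 0"
      then obtain n where "measure M (U - F n) < e"
        using order_tendstoD(2)[OF lim] by (auto simp: eventually_sequentially)
      then show "\<exists>F G. closedin (mtopology_of X) F \<and> closedin (mtopology_of X) G \<and>
         F \<subseteq> U \<and> G \<subseteq> mspace X - U \<and> measure M (U - F) < e \<and> measure M ((mspace X - U) - G) < e"
        using F(1)[of n] F(2)[of n] U \<open>e > 0\<close>
        by (intro exI[where x = "F n"] exI[where x = "mspace X - U"] conjI) (auto simp: closedin_def double_diff openin_imp_subset_mspace)
    qed
    then show ?case using Um by blast
  next
    case Empty
    have "closedin (mtopology_of X) (mspace X)" using closedin_topspace[of "mtopology_of X"] by simp
    then show ?case by (intro conjI allI impI exI[where x = "{}"] exI[where x = "mspace X"]) auto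
  next
    case (Compl A)
    have A: "A \<subseteq> mspace X" using Compl sets.sets_into_space by force
    have "mspace X - A \<in> sets M" using Compl sets.compl_sets[of A M] by simp
    moreover have "?P (mspace X - A)"
      using Compl A double_diff[OF A order_refl] by metis
    ultimately show ?case by blast
  next
    case (Union A)
    then have Am: "A i \<in> sets M" for i by blast
    have "?P (\<Union>i. A i)"
    proof (intro allI impI)
      fix e :: real assume "e > 0"
      \<comment> \<open>Geometric weights with total \<open>e / 2\<close>, strictly below
        \<open>e\<close>.\<close>
      define d where "d = (\<lambda>i::nat. (e / 4) * (1 / 2) ^ i)"
      have d: "d i > 0" for i using \<open>e > 0\<close> by (simp add: d_def)
      have "\<forall>i. \<exists>F G. closedin (mtopology_of X) F \<and> closedin (mtopology_of X) G \<and>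
         F \<subseteq> A i \<and> G \<subseteq> mspace X - A i \<and> measure M (A i - F) < d i \<and> measure M ((mspace X - A i) - G) < d i"
        using Union d by blast
      then obtain F G where F: "\<And>i. closedin (mtopology_of X) (F i)" "\<And>i. F i \<subseteq> A i" "\<And>i. measure M (A i - F i) < d i"
        and G: "\<And>i. closedin (mtopology_of X) (G i)" "\<And>i. G i \<subseteq> mspace X - A i"
           "\<And>i. measure M ((mspace X - A i) - G i) < d i"
        by metis
      have sd: "summable d" "suminf d < e"
      proof -
        have "d sums ((e / 4) * (1 / (1 - 1 / 2)))"
          unfolding d_def by (intro sums_mult geometric_sums) simp
        then show "summable d" "suminf d < e" using \<open>e > 0\<close> by (auto simp: sums_iff)
      qed
      have meas: "A i - F i \<in> sets M" "(mspace X - A i) - G i \<in> sets M" for i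
        using closed[OF F(1)] closed[OF G(1)] Am sets.compl_sets[OF Am] by auto
      have small: "measure M (\<Union>i. B i) < e"
        if B: "\<And>i. B i \<in> sets M" "\<And>i. measure M (B i) < d i" for B
      proof -
        have sB: "summable (\<lambda>i. measure M (B i))"
          using B(2) by (intro summable_comparison_test'[OF sd(1), of 0]) (simp add: less_imp_le)
        then have "measure M (\<Union>i. B i) \<le> (\<Sum>i. measure M (B i))"
          using B(1) sB by (intro finite_measure_subadditive_countably) blast+
        also have "\<dots> \<le> suminf d" using B(2) sB sd(1) by (intro suminf_le) (simp_all add: less_imp_le)
        finally show ?thesis using sd by simp
      qed
      \<comment> \<open>An infinite union of closed sets need not be closed, so it is cut off after
        finitely many terms; continuity from above controls what is lost. On the complement side the
        full intersection is already closed.\<close>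
      have lim: "(\<lambda>n. measure M ((\<Union>i. A i) - (\<Union>i\<le>n. F i))) \<longlonglongrightarrow> measure M (\<Inter>n. (\<Union>i. A i) - (\<Union>i\<le>n. F i))"
      proof (rule finite_Lim_measure_decseq)
        show "range (\<lambda>n. (\<Union>i. A i) - (\<Union>i\<le>n. F i)) \<subseteq> sets M" using Am closed[OF F(1)] by auto
        show "decseq (\<lambda>n. (\<Union>i. A i) - (\<Union>i\<le>n. F i))" by (rule antimonoI) force
      qed
      have "(\<Inter>n. (\<Union>i. A i) - (\<Union>i\<le>n. F i)) \<subseteq> (\<Union>i. A i - F i)" by auto
      then have "measure M (\<Inter>n. (\<Union>i. A i) - (\<Union>i\<le>n. F i)) \<le> measure M (\<Union>i. A i - F i)"
        using meas by (intro finite_measure_mono) auto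
      also have "\<dots> < e" using meas F by (intro small)
      finally obtain n where n: "measure M ((\<Union>i. A i) - (\<Union>i\<le>n. F i)) < e"
        using order_tendstoD(2)[OF lim] by (auto simp: eventually_sequentially)
      have "measure M ((mspace X - (\<Union>i. A i)) - (\<Inter>i. G i)) \<le> measure M (\<Union>i. (mspace X - A i) - G i)"
        using meas by (intro finite_measure_mono) auto
      also have "\<dots> < e" using meas G by (intro small)
      finally have "measure M ((mspace X - (\<Union>i. A i)) - (\<Inter>i. G i)) < e" .
      moreover have "closedin (mtopology_of X) (\<Union>i\<le>n. F i)" using F by (intro closedin_Union) auto
      moreover have "closedin (mtopology_of X) (\<Inter>i. G i)" using G by (intro closedin_Inter) auto
      ultimately show "\<exists>F G. closedin (mtopology_of X) F \<and> closedin (mtopology_of X) G \<and>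
         F \<subseteq> (\<Union>i. A i) \<and> G \<subseteq> mspace X - (\<Union>i. A i) \<and> measure M ((\<Union>i. A i) - F) < e \<and>
         measure M ((mspace X - (\<Union>i. A i)) - G) < e"
        using n F(2) G(2) by (intro exI[where x = "\<Union>i\<le>n. F i"] exI[where x = "\<Inter>i. G i"] conjI) blast+
    qed
    then show ?case using Am by blast
  qed
  then show ?thesis by blast
qed

context metric_measure_space
begin

lemma space_eq [simp]: "space m = mspace X"
  using sets_eq_imp_space_eq[OF sets_eq] by simp

lemma open_sets: "openin (mtopology_of X) U \<Longrightarrow> U \<in> sets m"
  by (simp add: sets_eq openin_in_metric_borel)

lemma closed_sets: "closedin (mtopology_of X) U \<Longrightarrow> U \<in> sets m"
  by (simp add: sets_eq closedin_in_metric_borel)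

lemma ball_sets [simp, measurable]: "mball_of X x r \<in> sets m" "mcball_of X x r \<in> sets m"
  by (simp_all add: sets_eq)

lemma countable_dense: "S \<subseteq> mspace X \<Longrightarrow> \<exists>D. countable D \<and> dense_subset X S D"
  using separable_imp_countable_dense[OF separable] .

lemma borel_measurable_mdist [measurable]:
  "(\<lambda>p. mdist X (fst p) (snd p)) \<in> borel_measurable (metric_borel X \<Otimes>\<^sub>M metric_borel X)"
  using countable_dense[of "mspace X"] measurable_mdist by blast

lemma ball_pos: "x \<in> mspace X \<Longrightarrow> r > 0 \<Longrightarrow> emeasure m (mball_of X x r) > 0"
  using full_support unfolding measure_support_def by blast

text \<open>Local finiteness and separability give a countable cover by balls of finite measure;
  Radon-Nikodym derivatives depend on this.\<close>

lemma sigma_finite: "sigma_finite_measure m"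
proof -
  obtain D where D: "countable D" "dense_subset X (mspace X) D" using countable_dense by blast
  define I where "I = {(q, s). q \<in> D \<and> s \<in> \<rat> \<and> emeasure m (mball_of X q s) \<noteq> \<infinity>}"
  define A where "A = (\<lambda>(q, s). mball_of X q s) ` I"
  have "I \<subseteq> D \<times> \<rat>" by (auto simp: I_def)
  then have "countable I" using D(1) countable_rat countable_SIGMA by (metis countable_subset)
  then have "countable A" by (simp add: A_def)
  moreover have "\<Union>A = space m"
  proof (intro equalityI subsetI)
    fix x assume x: "x \<in> space m"
    then obtain r where r: "r > 0" "emeasure m (mball_of X x r) < \<infinity>" using locally_finite by auto
    \<comment> \<open>With a centre closer to \<open>x\<close> than \<open>r / 3\<close>, the lower
      bound on \<open>s\<close> makes the ball contain \<open>x\<close>, and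
      \<open>s + r / 3 < r\<close> keeps it inside the ball of finite measure.\<close>
    obtain s where s: "s \<in> \<rat>" "r / 3 < s" "s < r / 2" using Rats_dense_in_real[of "r / 3" "r / 2"] r by auto
    obtain q where q: "q \<in> D" "mdist X x q < r / 3" using D x r unfolding dense_subset_def
      by (metis space_eq divide_pos_pos zero_less_numeral)
    have qX: "q \<in> mspace X" using q D by (auto simp: dense_subset_def)
    have "mball_of X q s \<subseteq> mball_of X x r"
    proof
      fix y assume y: "y \<in> mball_of X q s"
      then have "mdist X x y \<le> mdist X x q + mdist X q y" using x qX by (intro mdist_triangle) auto
      then show "y \<in> mball_of X x r" using x q s y by auto
    qed
    then have "emeasure m (mball_of X q s) \<le> emeasure m (mball_of X x r)" by (intro emeasure_mono) auto
    then have "(q, s) \<in> I" using q s r by (auto simp: I_def)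
    moreover have "x \<in> mball_of X q s" using x q s qX by (auto simp: mdist_commute)
    ultimately show "x \<in> \<Union>A" unfolding A_def by blast
  qed (auto simp: A_def I_def)
  ultimately show ?thesis
    by (intro sigma_finite_measure.intro exI[of _ A]) (auto simp: A_def I_def)
qed

end

section \<open>Measure contraction\<close>

lemma AE_cell_not_null:
  fixes i :: "'a \<Rightarrow> nat"
  assumes [measurable]: "i \<in> P \<rightarrow>\<^sub>M count_space UNIV"
  shows "AE w in P. emeasure P {w' \<in> space P. i w' = i w} \<noteq> 0"
proof -
  have "AE w in P. \<forall>n. emeasure P {w' \<in> space P. i w' = n} = 0 \<longrightarrow> i w \<noteq> n"
    unfolding AE_all_countable
  proof
    fix n show "AE w in P. emeasure P {w' \<in> space P. i w' = n} = 0 \<longrightarrow> i w \<noteq> n"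
    proof (cases "emeasure P {w' \<in> space P. i w' = n} = 0")
      case True
      then show ?thesis by (intro AE_I[of _ _ "{w \<in> space P. i w = n}"]) auto
    qed simp
  qed
  then show ?thesis by eventually_elim blast
qed

text \<open>Sets where the denominator vanishes are null, so the junk value of \<open>inverse 0\<close> is harmless.\<close>

lemma discrete_gluing:
  fixes i :: "'a \<Rightarrow> nat" and j :: "'b \<Rightarrow> nat"
  assumes P: "prob_space P" and Q: "prob_space Q"
    and i [measurable]: "i \<in> P \<rightarrow>\<^sub>M count_space UNIV" and j [measurable]: "j \<in> Q \<rightarrow>\<^sub>M count_space UNIV"
    and law: "distr P (count_space UNIV) i = distr Q (count_space UNIV) j"
  shows "\<exists>T. sets T = sets (P \<Otimes>\<^sub>M Q) \<and> distr T P fst = P \<and> distr T Q snd = Q \<and> (AE w in T. i (fst w) = j (snd w))"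
proof -
  interpret P: prob_space P by fact
  interpret Q: prob_space Q by fact
  interpret PQ: pair_sigma_finite P Q ..
  define \<nu> where "\<nu> n = emeasure P {w \<in> space P. i w = n}" for n
  have \<nu>Q: "\<nu> n = emeasure Q {w \<in> space Q. j w = n}" for n
  proof -
    have "\<nu> n = emeasure (distr P (count_space UNIV) i) {n}"
      unfolding \<nu>_def by (subst emeasure_distr) (auto intro!: arg_cong[where f = "emeasure P"])
    also have "\<dots> = emeasure Q {w \<in> space Q. j w = n}"
      unfolding law by (subst emeasure_distr) (auto intro!: arg_cong[where f = "emeasure Q"])
    finally show ?thesis .
  qed
  have \<nu>_fin: "\<nu> n \<noteq> \<infinity>" for n unfolding \<nu>_def by simp
  have inv: "inverse (\<nu> n) * \<nu> n = 1" if "\<nu> n \<noteq> 0" for n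
    using ennreal_divide_self[OF that] \<nu>_fin[of n]
    by (simp add: divide_ennreal_def mult.commute less_top)
  \<comment> \<open>Given the common index \<open>n\<close>, the two coordinates are to be
    independent with their conditional laws. That measure has density
    \<open>inverse (\<nu> n)\<close> on the product of the two cells with index \<open>n\<close>,
    and no disintegration is involved.\<close>
  define h where "h w = (if i (fst w) = j (snd w) then inverse (\<nu> (i (fst w))) else 0)" for w
  have [measurable]: "(\<lambda>w. \<nu> (i (fst w))) \<in> borel_measurable (P \<Otimes>\<^sub>M Q)"
    by (rule measurable_compose[of "\<lambda>w. i (fst w)" _ "count_space UNIV"]) measurable
  have "Measurable.pred (P \<Otimes>\<^sub>M Q) (\<lambda>w. \<exists>n. i (fst w) = n \<and> j (snd w) = n)" by measurable
  then have [measurable]: "Measurable.pred (P \<Otimes>\<^sub>M Q) (\<lambda>w. i (fst w) = j (snd w))" by (simp add: eq_commute)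
  have [measurable]: "h \<in> borel_measurable (P \<Otimes>\<^sub>M Q)" unfolding h_def by measurable
  define T where "T = density (P \<Otimes>\<^sub>M Q) h"
  have T: "sets T = sets (P \<Otimes>\<^sub>M Q)" by (simp add: T_def)
  have nzP: "AE w in P. \<nu> (i w) \<noteq> 0" and nzQ: "AE w in Q. \<nu> (j w) \<noteq> 0"
    using AE_cell_not_null[OF i] AE_cell_not_null[OF j] by (simp_all add: \<nu>_def \<nu>Q[unfolded \<nu>_def])
  have "distr T P fst = P"
  proof (rule measure_eqI)
    fix A assume "A \<in> sets (distr T P fst)"
    then have [measurable]: "A \<in> sets P" by simp
    have "emeasure (distr T P fst) A = (\<integral>\<^sup>+w. h w * indicator (fst -` A \<inter> space (P \<Otimes>\<^sub>M Q)) w \<partial>(P \<Otimes>\<^sub>M Q))"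
      by (subst emeasure_distr) (auto simp: T_def emeasure_density space_pair_measure)
    also have "\<dots> = (\<integral>\<^sup>+x. \<integral>\<^sup>+y. h (x, y) * indicator (fst -` A \<inter> space (P \<Otimes>\<^sub>M Q)) (x, y) \<partial>Q \<partial>P)"
      by (subst Q.nn_integral_fst) auto
    also have "\<dots> = (\<integral>\<^sup>+x. indicator A x * (\<integral>\<^sup>+y. inverse (\<nu> (i x)) * indicator {y \<in> space Q. j y = i x} y \<partial>Q) \<partial>P)"
      by (intro nn_integral_cong, subst nn_integral_cmult[symmetric])
         (auto intro!: nn_integral_cong simp: h_def space_pair_measure split: split_indicator)
    also have "\<dots> = (\<integral>\<^sup>+x. indicator A x * (inverse (\<nu> (i x)) * \<nu> (i x)) \<partial>P)"
      by (subst nn_integral_cmult_indicator) (auto simp: \<nu>Q)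
    also have "\<dots> = (\<integral>\<^sup>+x. indicator A x \<partial>P)"
      by (rule nn_integral_cong_AE) (use nzP in eventually_elim, auto simp: inv)
    finally show "emeasure (distr T P fst) A = emeasure P A" by simp
  qed simp
  moreover have "distr T Q snd = Q"
  proof (rule measure_eqI)
    fix A assume "A \<in> sets (distr T Q snd)"
    then have [measurable]: "A \<in> sets Q" by simp
    have "emeasure (distr T Q snd) A = (\<integral>\<^sup>+w. h w * indicator (snd -` A \<inter> space (P \<Otimes>\<^sub>M Q)) w \<partial>(P \<Otimes>\<^sub>M Q))"
      by (subst emeasure_distr) (auto simp: T_def emeasure_density space_pair_measure)
    also have "\<dots> = (\<integral>\<^sup>+y. \<integral>\<^sup>+x. h (x, y) * indicator (snd -` A \<inter> space (P \<Otimes>\<^sub>M Q)) (x, y) \<partial>P \<partial>Q)"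
      by (subst PQ.nn_integral_snd) auto
    also have "\<dots> = (\<integral>\<^sup>+y. indicator A y * (\<integral>\<^sup>+x. inverse (\<nu> (j y)) * indicator {x \<in> space P. i x = j y} x \<partial>P) \<partial>Q)"
      by (intro nn_integral_cong, subst nn_integral_cmult[symmetric])
         (auto intro!: nn_integral_cong simp: h_def space_pair_measure split: split_indicator)
    also have "\<dots> = (\<integral>\<^sup>+y. indicator A y * (inverse (\<nu> (j y)) * \<nu> (j y)) \<partial>Q)"
      by (subst nn_integral_cmult_indicator) (auto simp: \<nu>_def)
    also have "\<dots> = (\<integral>\<^sup>+y. indicator A y \<partial>Q)"
      by (rule nn_integral_cong_AE) (use nzQ in eventually_elim, auto simp: inv)
    finally show "emeasure (distr T Q snd) A = emeasure Q A" by simp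
  qed simp
  moreover have "AE w in T. i (fst w) = j (snd w)"
    unfolding T_def by (subst AE_density) (auto simp: h_def)
  ultimately show ?thesis using T by blast
qed

lemma couplings_prob_space:
  assumes "\<pi> \<in> couplings X \<mu> \<nu>" "prob_space \<mu>"
  shows "prob_space \<pi>"
proof -
  have s: "sets \<pi> = sets (metric_borel X \<Otimes>\<^sub>M metric_borel X)" and d: "distr \<pi> (metric_borel X) fst = \<mu>"
    using assms by (auto simp: couplings_def)
  have "fst \<in> \<pi> \<rightarrow>\<^sub>M metric_borel X" using s by (simp cong: measurable_cong_sets)
  then show ?thesis using assms(2) d prob_space_distrD by blast
qed

lemma couplings_AE:
  assumes "\<pi> \<in> couplings X \<mu> \<nu>"
  shows "AE x in \<mu>. P x \<Longrightarrow> AE w in \<pi>. P (fst w)" "AE y in \<nu>. P y \<Longrightarrow> AE w in \<pi>. P (snd w)"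
proof -
  have s: "sets \<pi> = sets (metric_borel X \<Otimes>\<^sub>M metric_borel X)"
    and d: "distr \<pi> (metric_borel X) fst = \<mu>" "distr \<pi> (metric_borel X) snd = \<nu>"
    using assms by (auto simp: couplings_def)
  have [measurable]: "fst \<in> \<pi> \<rightarrow>\<^sub>M metric_borel X" "snd \<in> \<pi> \<rightarrow>\<^sub>M metric_borel X"
    using s by (simp_all cong: measurable_cong_sets)
  show "AE x in \<mu>. P x \<Longrightarrow> AE w in \<pi>. P (fst w)"
    unfolding d(1)[symmetric] by (rule AE_distrD[rotated]) auto
  show "AE y in \<nu>. P y \<Longrightarrow> AE w in \<pi>. P (snd w)"
    unfolding d(2)[symmetric] by (rule AE_distrD[rotated]) auto
qed

text \<open>Write \<open>a = l D + \<alpha>\<close> and \<open>b = (1 - l) D + \<beta>\<close>; then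
  \<open>a\<^sup>2 / l + b\<^sup>2 / (1 - l) = D\<^sup>2 + 2 D (\<alpha> + \<beta>) + \<alpha>\<^sup>2 / l + \<beta>\<^sup>2 / (1 - l)\<close>.\<close>

lemma intermediate_point_defect:
  fixes a b D l R \<eta> w :: real
  assumes l: "0 < l" "l < 1" and D: "0 \<le> D" "D \<le> R" "D \<le> a + b + \<eta>" and "0 \<le> w" "0 \<le> \<eta>"
  shows "D\<^sup>2 + (if a > l * D + w \<or> b > (1 - l) * D + w then w\<^sup>2 else 0)
     \<le> a\<^sup>2 / l + b\<^sup>2 / (1 - l) + 2 * R * \<eta>"
proof -
  define \<alpha> \<beta> where "\<alpha> = a - l * D" and "\<beta> = b - (1 - l) * D"
  have ab: "a = l * D + \<alpha>" "b = (1 - l) * D + \<beta>" by (auto simp: \<alpha>_def \<beta>_def)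
  have sq: "(if a > l * D + w \<or> b > (1 - l) * D + w then w\<^sup>2 else 0) \<le> \<alpha>\<^sup>2 + \<beta>\<^sup>2"
  proof (cases "a > l * D + w \<or> b > (1 - l) * D + w")
    case True
    then have "w\<^sup>2 \<le> \<alpha>\<^sup>2 \<or> w\<^sup>2 \<le> \<beta>\<^sup>2" using \<open>0 \<le> w\<close> by (auto simp: \<alpha>_def \<beta>_def intro!: power_mono)
    moreover have "0 \<le> \<alpha>\<^sup>2" "0 \<le> \<beta>\<^sup>2" by auto
    ultimately have "w\<^sup>2 \<le> \<alpha>\<^sup>2 + \<beta>\<^sup>2" by linarith
    then show ?thesis by simp
  qed simp
  have "\<alpha>\<^sup>2 \<le> \<alpha>\<^sup>2 / l" "\<beta>\<^sup>2 \<le> \<beta>\<^sup>2 / (1 - l)" using l by (auto simp: divide_simps mult_left_le)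
  moreover have "a\<^sup>2 / l + b\<^sup>2 / (1 - l) = D\<^sup>2 + 2 * D * (\<alpha> + \<beta>) + \<alpha>\<^sup>2 / l + \<beta>\<^sup>2 / (1 - l)"
  proof -
    have "a\<^sup>2 / l = l * D\<^sup>2 + 2 * D * \<alpha> + \<alpha>\<^sup>2 / l" unfolding ab using l by (simp add: power2_eq_square field_simps)
    moreover have "b\<^sup>2 / (1 - l) = (1 - l) * D\<^sup>2 + 2 * D * \<beta> + \<beta>\<^sup>2 / (1 - l)"
      unfolding ab(2) using l by (simp add: power2_eq_square field_simps)
    ultimately show ?thesis by (simp add: algebra_simps)
  qed
  moreover have "- (2 * R * \<eta>) \<le> 2 * D * (\<alpha> + \<beta>)"
  proof -
    have "2 * D * (- \<eta>) \<le> 2 * D * (\<alpha> + \<beta>)" using D by (intro mult_left_mono) (auto simp: \<alpha>_def \<beta>_def algebra_simps)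
    moreover have "D * \<eta> \<le> R * \<eta>" using D \<open>0 \<le> \<eta>\<close> by (intro mult_right_mono) auto
    ultimately show ?thesis by simp
  qed
  ultimately show ?thesis using sq by linarith
qed

context metric_measure_space
begin

lemma borel_measurable_mdist_compose [measurable (raw)]:
  assumes [measurable]: "f \<in> M \<rightarrow>\<^sub>M metric_borel X" "g \<in> M \<rightarrow>\<^sub>M metric_borel X"
  shows "(\<lambda>x. mdist X (f x) (g x)) \<in> borel_measurable M"
  using measurable_compose[OF _ borel_measurable_mdist, of "\<lambda>x. (f x, g x)" M] by simp

text \<open>Each point is assigned the first member of a dense sequence within \<open>e / 2\<close>,
  so two points with the same index are at most \<open>e\<close> apart. Countably many cells are
  what \<open>discrete_gluing\<close> can match.\<close>

lemma cell_index:
  assumes "e > 0"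
  shows "\<exists>idx :: 'a \<Rightarrow> nat. idx \<in> metric_borel X \<rightarrow>\<^sub>M count_space UNIV \<and>
     (\<forall>x\<in>mspace X. \<forall>y\<in>mspace X. idx x = idx y \<longrightarrow> mdist X x y \<le> e)"
proof -
  obtain D where D: "countable D" "dense_subset X (mspace X) D" using countable_dense by blast
  show ?thesis
  proof (cases "mspace X = {}")
    case True
    then show ?thesis by (intro exI[of _ "\<lambda>_. 0"]) auto
  next
    case False
    then have "D \<noteq> {}" using D(2) unfolding dense_subset_def by (metis all_not_in_conv zero_less_one)
    define q where "q = from_nat_into D"
    have q: "q n \<in> mspace X" for n
      using from_nat_into[OF \<open>D \<noteq> {}\<close>] D(2) by (auto simp: q_def dense_subset_def)
    define idx where "idx x = (LEAST n. mdist X (q n) x < e / 2)" for x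
    have near: "mdist X (q (idx x)) x < e / 2" if x: "x \<in> mspace X" for x
    proof -
      obtain p where "p \<in> D" "mdist X x p < e / 2"
        using D(2) x \<open>e > 0\<close> unfolding dense_subset_def by (meson half_gt_zero)
      then have "\<exists>n. mdist X (q n) x < e / 2"
        unfolding q_def by (metis D(1) from_nat_into_surj mdist_commute)
      then show ?thesis unfolding idx_def by (rule LeastI_ex)
    qed
    have "mdist X x y \<le> e" if "x \<in> mspace X" "y \<in> mspace X" "idx x = idx y" for x y
      using mdist_triangle[of x X "q (idx x)" y] near[of x] near[of y] q that by (simp add: mdist_commute)
    moreover have "idx \<in> metric_borel X \<rightarrow>\<^sub>M count_space UNIV"
      unfolding idx_def using q by measurable
    ultimately show ?thesis by blast
  qed
qed

text \<open>Near-optimal couplings of \<open>(\<mu>0, \<nu>)\<close> and \<open>(\<nu>, \<mu>1)\<close> are glued along cells of small diameter.\<close>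

lemma intermediate_measure_concentrated:
  assumes P: "prob_space \<mu>0" "prob_space \<mu>1"
    and V: "V \<ge> 0" "\<And>\<pi>. \<pi> \<in> couplings X \<mu>0 \<mu>1 \<Longrightarrow> ennreal V \<le> transport_cost X \<pi>"
    and c1: "\<And>e. e > 0 \<Longrightarrow> \<exists>\<pi>\<in>couplings X \<mu>0 \<nu>. transport_cost X \<pi> \<le> ennreal (l\<^sup>2 * V + e)"
    and c2: "\<And>e. e > 0 \<Longrightarrow> \<exists>\<pi>\<in>couplings X \<nu> \<mu>1. transport_cost X \<pi> \<le> ennreal ((1 - l)\<^sup>2 * V + e)"
    and l: "0 < l" "l < 1" and "\<xi> > 0" and p: "p \<in> mspace X"
    and A: "AE x in \<mu>0. x \<in> A" "A \<subseteq> mcball_of X p R"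
    and B: "AE y in \<mu>1. mdist X p y \<le> \<xi> / 4"
    and C: "C \<in> sets (metric_borel X)"
      "\<And>x z. x \<in> A \<Longrightarrow> z \<in> mspace X \<Longrightarrow> mdist X x z \<le> l * mdist X x p + \<xi> \<Longrightarrow>
        mdist X z p \<le> (1 - l) * mdist X x p + \<xi> \<Longrightarrow> z \<in> C"
    and \<nu>: "prob_space \<nu>" "sets \<nu> = sets (metric_borel X)"
  shows "AE z in \<nu>. z \<in> C"
proof -
  interpret \<nu>: prob_space \<nu> by fact
  let ?B = "metric_borel X"
  let ?BB = "?B \<Otimes>\<^sub>M ?B"
  \<comment> \<open>Four errors of size at most \<open>w\<close> add up to \<xi>: the distance of
    \<open>y\<close> from \<open>p\<close> enters twice, the mismatch of \<open>z\<close> and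
    \<open>z'\<close> inside a cell once, and the tolerated defect of an intermediate point
    once.\<close>
  define w where "w = \<xi> / 4"
  define R' where "R' = \<bar>R\<bar> + \<xi>"
  \<comment> \<open>Collects the errors proportional to \<open>e\<close>: the slack in the two
    couplings, weighted by \<open>1 / l\<close> and \<open>1 / (1 - l)\<close>, and
    \<open>2 * R' * e\<close> from the mismatch inside cells.\<close>
  define K where "K = 1 / l + 1 / (1 - l) + 2 * R'"
  have pos: "w > 0" "R' > 0" "K \<ge> 0" using \<open>\<xi> > 0\<close> l by (auto simp: w_def R'_def K_def add_nonneg_pos)
  have [measurable]: "C \<in> sets ?B" by fact
  have spn: "space \<nu> = mspace X" using sets_eq_imp_space_eq[OF \<nu>(2)] by simp
  define \<beta> where "\<beta> = measure \<nu> (mspace X - C)"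
  \<comment> \<open>Gluing produces a competitor for the optimal cost \<open>V\<close>, in which
    every unit of mass outside \<open>C\<close> costs an extra \<open>w\<^sup>2\<close>. As
    \<open>e\<close> tends to 0 this leaves no room for such mass.\<close>
  have key: "V + w\<^sup>2 * \<beta> \<le> V + e * K" if e: "0 < e" "e \<le> w" for e
  proof -
    obtain \<pi>1 where \<pi>1: "\<pi>1 \<in> couplings X \<mu>0 \<nu>" "transport_cost X \<pi>1 \<le> ennreal (l\<^sup>2 * V + e)" using c1 e by blast
    obtain \<pi>2 where \<pi>2: "\<pi>2 \<in> couplings X \<nu> \<mu>1" "transport_cost X \<pi>2 \<le> ennreal ((1 - l)\<^sup>2 * V + e)" using c2 e by blast
    have s: "sets \<pi>1 = sets ?BB" "sets \<pi>2 = sets ?BB"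
      and d: "distr \<pi>1 ?B fst = \<mu>0" "distr \<pi>1 ?B snd = \<nu>" "distr \<pi>2 ?B fst = \<nu>" "distr \<pi>2 ?B snd = \<mu>1"
      using \<pi>1 \<pi>2 by (auto simp: couplings_def)
    note [measurable_cong] = s
    have sp: "space \<pi>1 = mspace X \<times> mspace X" "space \<pi>2 = mspace X \<times> mspace X"
      using sets_eq_imp_space_eq[OF s(1)] sets_eq_imp_space_eq[OF s(2)] by (auto simp: space_pair_measure)
    obtain idx where idx [measurable]: "idx \<in> ?B \<rightarrow>\<^sub>M count_space (UNIV :: nat set)"
      and idx_near: "\<And>x y. x \<in> mspace X \<Longrightarrow> y \<in> mspace X \<Longrightarrow> idx x = idx y \<Longrightarrow> mdist X x y \<le> e"
      using cell_index[OF e(1)] by blast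
    have "\<exists>T. sets T = sets (\<pi>1 \<Otimes>\<^sub>M \<pi>2) \<and> distr T \<pi>1 fst = \<pi>1 \<and> distr T \<pi>2 snd = \<pi>2 \<and>
        (AE t in T. (idx \<circ> snd) (fst t) = (idx \<circ> fst) (snd t))"
    proof (rule discrete_gluing)
      show "prob_space \<pi>1" "prob_space \<pi>2" using couplings_prob_space \<pi>1 \<pi>2 P(1) \<nu>(1) by blast+
      have "distr \<pi>1 (count_space UNIV) (idx \<circ> snd) = distr (distr \<pi>1 ?B snd) (count_space UNIV) idx"
        by (intro distr_distr[symmetric]) measurable
      also have "\<dots> = distr (distr \<pi>2 ?B fst) (count_space UNIV) idx" using d by simp
      also have "\<dots> = distr \<pi>2 (count_space UNIV) (idx \<circ> fst)"
        by (intro distr_distr) measurable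
      finally show "distr \<pi>1 (count_space UNIV) (idx \<circ> snd) = distr \<pi>2 (count_space UNIV) (idx \<circ> fst)" .
    qed measurable
    then obtain T where T: "sets T = sets (\<pi>1 \<Otimes>\<^sub>M \<pi>2)" "distr T \<pi>1 fst = \<pi>1" "distr T \<pi>2 snd = \<pi>2"
      and Tidx: "AE t in T. idx (snd (fst t)) = idx (fst (snd t))" by auto
    note [measurable_cong] = T(1)
    have spT: "space T = (mspace X \<times> mspace X) \<times> (mspace X \<times> mspace X)"
      using sets_eq_imp_space_eq[OF T(1)] sp by (simp add: space_pair_measure)
    let ?D = "\<lambda>t. ennreal ((mdist X (fst (fst t)) (snd (snd t)))\<^sup>2)"
    let ?a = "\<lambda>t. ennreal ((mdist X (fst (fst t)) (snd (fst t)))\<^sup>2)"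
    let ?b = "\<lambda>t. ennreal ((mdist X (fst (snd t)) (snd (snd t)))\<^sup>2)"
    let ?E = "{t \<in> space T. snd (fst t) \<notin> C}"
    have AET1: "AE t in T. Q (fst t)" if "AE u in \<pi>1. Q u" for Q
      using that by (subst (asm) T(2)[symmetric]) (rule AE_distrD[rotated], auto)
    have AET2: "AE t in T. Q (snd t)" if "AE u in \<pi>2. Q u" for Q
      using that by (subst (asm) T(3)[symmetric]) (rule AE_distrD[rotated], auto)
    \<comment> \<open>Forgetting the two middle coordinates leaves an exact coupling of
      \<open>\<mu>0\<close> and \<open>\<mu>1\<close>, although the gluing matches the middle points
      only up to a cell.\<close>
    define \<sigma> where "\<sigma> = distr T ?BB (\<lambda>t. (fst (fst t), snd (snd t)))"
    have "distr \<sigma> ?B fst = distr T ?B (fst \<circ> fst)"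
      unfolding \<sigma>_def by (subst distr_distr) (auto simp: comp_def)
    also have "\<dots> = distr (distr T \<pi>1 fst) ?B fst" by (intro distr_distr[symmetric]) measurable
    also have "\<dots> = \<mu>0" using T d by simp
    finally have \<sigma>1: "distr \<sigma> ?B fst = \<mu>0" .
    have "distr \<sigma> ?B snd = distr T ?B (snd \<circ> snd)"
      unfolding \<sigma>_def by (subst distr_distr) (auto simp: comp_def)
    also have "\<dots> = distr (distr T \<pi>2 snd) ?B snd" by (intro distr_distr[symmetric]) measurable
    also have "\<dots> = \<mu>1" using T d by simp
    finally have \<sigma>2: "distr \<sigma> ?B snd = \<mu>1" .
    have "\<sigma> \<in> couplings X \<mu>0 \<mu>1" using \<sigma>1 \<sigma>2 by (simp add: couplings_def \<sigma>_def)
    then have "ennreal V \<le> transport_cost X \<sigma>" by (rule V)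
    also have "\<dots> = (\<integral>\<^sup>+t. ?D t \<partial>T)"
      unfolding transport_cost_def \<sigma>_def case_prod_beta by (subst nn_integral_distr) auto
    finally have V_le: "ennreal V \<le> (\<integral>\<^sup>+t. ?D t \<partial>T)" .
    have "emeasure \<nu> (mspace X - C) = emeasure (distr (distr T \<pi>1 fst) ?B snd) (mspace X - C)" using T d by simp
    also have "\<dots> = emeasure T ?E"
      by (subst distr_distr, measurable, subst emeasure_distr) (auto simp: spT sets.compl_sets[of C ?B, simplified] intro!: arg_cong[where f = "emeasure T"])
    finally have \<beta>T: "ennreal \<beta> = emeasure T ?E"
      by (simp add: \<beta>_def \<nu>.emeasure_eq_measure)
    have [measurable]: "?E \<in> sets T" by measurable
    have "ennreal (V + w\<^sup>2 * \<beta>) = ennreal V + ennreal (w\<^sup>2) * ennreal \<beta>"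
      using V(1) by (simp add: ennreal_plus ennreal_mult \<beta>_def)
    also have "\<dots> \<le> (\<integral>\<^sup>+t. ?D t \<partial>T)
        + (\<integral>\<^sup>+t. ennreal (w\<^sup>2) * indicator ?E t \<partial>T)"
      using V_le by (intro add_mono) (simp_all add: nn_integral_cmult_indicator \<beta>T)
    also have "\<dots> = (\<integral>\<^sup>+t. ?D t
        + ennreal (w\<^sup>2) * indicator ?E t \<partial>T)"
      by (intro nn_integral_add[symmetric]) measurable
    also have "\<dots> \<le> (\<integral>\<^sup>+t. ennreal (1 / l) * ?a t
        + ennreal (1 / (1 - l)) * ?b t + ennreal (2 * R' * e) \<partial>T)"
    proof (rule nn_integral_mono_AE)
      show "AE t in T. ?D t
        + ennreal (w\<^sup>2) * indicator ?E t
        \<le> ennreal (1 / l) * ?a t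
        + ennreal (1 / (1 - l)) * ?b t + ennreal (2 * R' * e)"
        using Tidx AET1[OF couplings_AE(1)[OF \<pi>1(1) A(1)]] AET2[OF couplings_AE(2)[OF \<pi>2(1) B]] AE_space
      proof eventually_elim
        case (elim t)
        obtain x z z' y where t: "t = ((x, z), (z', y))" by (metis surj_pair)
        have m: "x \<in> mspace X" "z \<in> mspace X" "z' \<in> mspace X" "y \<in> mspace X" using elim(4) by (auto simp: spT t)
        have x: "x \<in> A" and y: "mdist X p y \<le> w" using elim by (auto simp: t w_def)
        have zz: "mdist X z z' \<le> e" using elim(1) idx_near m by (auto simp: t)
        define D a b where "D = mdist X x y" and "a = mdist X x z" and "b = mdist X z' y"
        have xp: "mdist X x p \<le> \<bar>R\<bar>" using x A(2) by (force simp: mdist_commute)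
        have "D \<le> mdist X x p + mdist X p y" unfolding D_def using m p by (intro mdist_triangle)
        then have D2: "D \<le> R'" "D \<le> mdist X x p + w" using xp y \<open>\<xi> > 0\<close> by (auto simp: R'_def w_def)
        have "D \<le> a + mdist X z y" "mdist X z y \<le> mdist X z z' + b"
          unfolding D_def a_def b_def using m by (auto intro!: mdist_triangle)
        then have D3: "D \<le> a + b + e" using zz by linarith
        have bad: "a > l * D + w \<or> b > (1 - l) * D + w" if z: "z \<notin> C"
        proof (rule ccontr)
          assume "\<not> ?thesis"
          then have 1: "a \<le> l * D + w" "b \<le> (1 - l) * D + w" by auto
          have lD: "l * D \<le> l * mdist X x p + w" "(1 - l) * D \<le> (1 - l) * mdist X x p + w"
          proof -
            have "l * D \<le> l * (mdist X x p + w)" using D2 l by (intro mult_left_mono) auto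
            moreover have "l * w \<le> w" using l pos by (simp add: mult_left_le_one_le)
            ultimately show "l * D \<le> l * mdist X x p + w" by (simp add: distrib_left)
            have "(1 - l) * D \<le> (1 - l) * (mdist X x p + w)" using D2 l by (intro mult_left_mono) auto
            moreover have "(1 - l) * w \<le> w" using l pos by (simp add: mult_left_le_one_le)
            ultimately show "(1 - l) * D \<le> (1 - l) * mdist X x p + w" by (simp add: distrib_left)
          qed
          have "mdist X z p \<le> mdist X z z' + mdist X z' p" "mdist X z' p \<le> b + mdist X y p"
            unfolding b_def using m p by (auto intro!: mdist_triangle)
          then have "mdist X z p \<le> e + b + w" using zz y by (simp add: mdist_commute)
          then have "mdist X z p \<le> (1 - l) * mdist X x p + \<xi>" using lD 1 e by (simp add: w_def)
          moreover have "mdist X x z \<le> l * mdist X x p + \<xi>" using lD 1 \<open>\<xi> > 0\<close> by (simp add: a_def w_def)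
          ultimately show False using C(2)[OF x m(2)] z by simp
        qed
        have "D\<^sup>2 + (if z \<notin> C then w\<^sup>2 else 0) \<le> D\<^sup>2 + (if a > l * D + w \<or> b > (1 - l) * D + w then w\<^sup>2 else 0)"
          using bad by auto
        also have "\<dots> \<le> a\<^sup>2 / l + b\<^sup>2 / (1 - l) + 2 * R' * e"
          using D2 D3 e l pos by (intro intermediate_point_defect) (auto simp: D_def)
        finally have "ennreal (D\<^sup>2 + (if z \<notin> C then w\<^sup>2 else 0)) \<le> ennreal (1 / l * a\<^sup>2 + 1 / (1 - l) * b\<^sup>2 + 2 * R' * e)"
          by (intro ennreal_leI) simp
        also have "\<dots> = ennreal (1 / l) * ennreal (a\<^sup>2) + ennreal (1 / (1 - l)) * ennreal (b\<^sup>2) + ennreal (2 * R' * e)"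
          using l pos e by (simp add: ennreal_plus ennreal_mult del: times_divide_eq_left)
        also have "ennreal (D\<^sup>2 + (if z \<notin> C then w\<^sup>2 else 0))
           = ennreal (D\<^sup>2) + ennreal (w\<^sup>2) * indicator ?E t"
          using elim(4) by (auto simp: t ennreal_plus)
        finally show ?case by (simp add: t D_def a_def b_def)
      qed
    qed
    also have "\<dots> = ennreal (1 / l) * (\<integral>\<^sup>+t. ?a t \<partial>T)
        + ennreal (1 / (1 - l)) * (\<integral>\<^sup>+t. ?b t \<partial>T)
        + ennreal (2 * R' * e) * emeasure T (space T)"
      by (simp add: nn_integral_add nn_integral_cmult)
    also have "(\<integral>\<^sup>+t. ?a t \<partial>T) = transport_cost X \<pi>1"
      unfolding transport_cost_def case_prod_beta by (subst T(2)[symmetric], subst nn_integral_distr) auto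
    also have "(\<integral>\<^sup>+t. ?b t \<partial>T) = transport_cost X \<pi>2"
      unfolding transport_cost_def case_prod_beta by (subst T(3)[symmetric], subst nn_integral_distr) auto
    also have "emeasure T (space T) = 1"
    proof -
      have "prob_space (distr T \<pi>1 fst)" unfolding T(2) using couplings_prob_space \<pi>1 P(1) by blast
      then have "prob_space T" by (rule prob_space_distrD[rotated]) measurable
      then show ?thesis by (rule prob_space.emeasure_space_1)
    qed
    also have "ennreal (1 / l) * transport_cost X \<pi>1 + ennreal (1 / (1 - l)) * transport_cost X \<pi>2 + ennreal (2 * R' * e) * 1
        \<le> ennreal (1 / l) * ennreal (l\<^sup>2 * V + e) + ennreal (1 / (1 - l)) * ennreal ((1 - l)\<^sup>2 * V + e) + ennreal (2 * R' * e) * 1"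
      using \<pi>1 \<pi>2 by (intro add_mono mult_left_mono) auto
    also have "\<dots> = ennreal (1 / l * (l\<^sup>2 * V + e) + 1 / (1 - l) * ((1 - l)\<^sup>2 * V + e) + 2 * R' * e)"
      using l V(1) e pos by (simp add: ennreal_plus ennreal_mult del: times_divide_eq_left)
    also have "1 / l * (l\<^sup>2 * V + e) + 1 / (1 - l) * ((1 - l)\<^sup>2 * V + e) + 2 * R' * e = V + e * K"
    proof -
      have "1 / l * (l\<^sup>2 * V + e) = l * V + e * (1 / l)" using l by (simp add: power2_eq_square field_simps)
      moreover have "1 / (1 - l) * ((1 - l)\<^sup>2 * V + e) = (1 - l) * V + e * (1 / (1 - l))"
        using l by (simp add: power2_eq_square field_simps)
      ultimately show ?thesis unfolding K_def by (simp add: algebra_simps)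
    qed
    finally show ?thesis using V(1) e pos by (subst (asm) ennreal_le_iff) auto
  qed
  have "w\<^sup>2 * \<beta> \<le> 0"
  proof (rule field_le_epsilon)
    fix d :: real assume "d > 0"
    define e where "e = min w (d / (K + 1))"
    have "0 < e" "e \<le> w" using \<open>d > 0\<close> pos by (auto simp: e_def)
    then have "w\<^sup>2 * \<beta> \<le> e * K" using key by force
    also have "\<dots> \<le> d / (K + 1) * K" using pos by (intro mult_right_mono) (auto simp: e_def)
    also have "\<dots> \<le> d" using \<open>d > 0\<close> pos by (simp add: field_simps)
    finally show "w\<^sup>2 * \<beta> \<le> 0 + d" by simp
  qed
  then have "\<beta> = 0" using pos by (auto simp: mult_le_0_iff \<beta>_def not_less intro: antisym)
  then have "emeasure \<nu> (mspace X - C) = 0" by (simp add: \<beta>_def \<nu>.emeasure_eq_measure)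
  moreover have "mspace X - C \<in> sets \<nu>" using sets.compl_sets[OF C(1)] \<nu>(2) by simp
  ultimately show ?thesis
    by (intro AE_I[of _ _ "mspace X - C"]) (auto simp: spn)
qed

end

section \<open>Entropy bounds from the distortion coefficients\<close>

lemma sin_scaled_ge:
  assumes "0 \<le> x" "x \<le> pi" "t \<in> {0..1::real}"
  shows "t * sin x \<le> sin (t * x)"
proof -
  have "convex_on {0..pi} (\<lambda>x. - sin x)"
    by (rule f''_ge0_imp_convex[where f' = "\<lambda>x. - cos x" and f'' = sin])
       (auto intro!: derivative_eq_intros sin_ge_zero)
  then have "- sin ((1 - t) *\<^sub>R 0 + t *\<^sub>R x) \<le> (1 - t) * (- sin 0) + t * (- sin x)"
    using assms pi_ge_zero by (intro convex_onD) auto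
  then show ?thesis by simp
qed

text \<open>As \<open>sinh\<close> is convex on the positive axis, the linear bound that holds for
  \<open>sin\<close> fails. For \<open>x \<le> 1\<close> the difference
  \<open>t\<^sup>2 * sinh x - sinh (t * x)\<close> is convex in \<open>t\<close> and vanishes at 0
  and 1. This is the origin of the square in the contraction factor and of the scale bound for
  negative \<open>K\<close>.\<close>

lemma sinh_scaled_ge:
  assumes "0 \<le> x" "x \<le> 1" "t \<in> {0..1::real}"
  shows "t\<^sup>2 * sinh x \<le> sinh (t * x)"
proof -
  have "convex_on {0..1::real} (\<lambda>t. t\<^sup>2 * sinh x - sinh (t * x))"
  proof (rule f''_ge0_imp_convex[where f' = "\<lambda>t. 2 * t * sinh x - x * cosh (t * x)"
        and f'' = "\<lambda>t. 2 * sinh x - x\<^sup>2 * sinh (t * x)"])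
    fix s :: real assume s: "s \<in> {0..1}"
    show "((\<lambda>t. t\<^sup>2 * sinh x - sinh (t * x)) has_real_derivative 2 * s * sinh x - x * cosh (s * x)) (at s)"
      by (auto intro!: derivative_eq_intros)
    show "((\<lambda>t. 2 * t * sinh x - x * cosh (t * x)) has_real_derivative 2 * sinh x - x\<^sup>2 * sinh (s * x)) (at s)"
      by (auto intro!: derivative_eq_intros simp: power2_eq_square)
    have "x\<^sup>2 * sinh (s * x) \<le> 1 * sinh (s * x)"
      using assms s by (intro mult_right_mono) (auto simp: power_le_one)
    also have "\<dots> \<le> sinh x" using assms s by (simp add: mult_left_le_one_le)
    also have "\<dots> \<le> 2 * sinh x" using assms by simp
    finally show "0 \<le> 2 * sinh x - x\<^sup>2 * sinh (s * x)" by simp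
  qed auto
  from convex_onD[OF this, of t 0 1] show ?thesis using assms by simp
qed

text \<open>The coefficient is a weighted geometric mean of \<open>t\<close> and a ratio of sines or
  hyperbolic sines, both at least \<open>t\<^sup>2\<close>. The bound is crude, but it tends to 1
  with \<open>t\<close>, and only coefficients at times near 1 have to be sharp.\<close>

lemma distortion_ge:
  assumes N: "N > 1" and t: "t \<in> {0..1}" and "0 \<le> \<theta>"
    and small: "K < 0 \<Longrightarrow> \<theta> * sqrt (- K / (N - 1)) \<le> 1"
  shows "ennreal (t\<^sup>2) \<le> distortion K N t \<theta>"
proof -
  have tt: "t\<^sup>2 \<le> t" using t by (simp add: power2_eq_square mult_left_le)
  have mean: "t\<^sup>2 \<le> t powr (1 / N) * q powr (1 - 1 / N)" if "t\<^sup>2 \<le> q" for q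
  proof (cases "t = 0")
    case False
    then have "t > 0" using t by simp
    have "t\<^sup>2 = (t\<^sup>2) powr (1 / N) * (t\<^sup>2) powr (1 - 1 / N)"
      using \<open>t > 0\<close> by (simp flip: powr_add)
    also have "\<dots> \<le> t powr (1 / N) * q powr (1 - 1 / N)"
      using tt that N by (intro mult_mono powr_mono2) auto
    finally show ?thesis .
  qed simp
  consider "K * \<theta>\<^sup>2 = 0" | "K * \<theta>\<^sup>2 \<noteq> 0" "K * \<theta>\<^sup>2 \<ge> (N - 1) * pi\<^sup>2"
    | "K * \<theta>\<^sup>2 \<noteq> 0" "K * \<theta>\<^sup>2 < (N - 1) * pi\<^sup>2" "K * \<theta>\<^sup>2 > 0" | "K * \<theta>\<^sup>2 < 0" by linarith
  then show ?thesis
  proof cases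
    case 3
    then have K: "K > 0" "\<theta> > 0" using \<open>0 \<le> \<theta>\<close> by (auto simp: zero_less_mult_iff)
    define x where "x = \<theta> * sqrt (K / (N - 1))"
    have "0 < x" using K N by (simp add: x_def)
    moreover have "x < pi"
    proof (rule power2_less_imp_less)
      have "x\<^sup>2 = K * \<theta>\<^sup>2 / (N - 1)" using K N by (simp add: x_def power_mult_distrib)
      then show "x\<^sup>2 < pi\<^sup>2" using 3 N by (simp add: pos_divide_less_eq mult.commute)
    qed simp
    ultimately have "sin x > 0" "t * sin x \<le> sin (t * x)" using t by (auto intro: sin_gt_zero sin_scaled_ge)
    then have "t \<le> sin (t * x) / sin x" by (simp add: field_simps)
    then have "t\<^sup>2 \<le> sin (t * x) / sin x" using tt by simp
    from mean[OF this] show ?thesis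
      using 3 unfolding distortion_def x_def by (auto simp: mult.assoc intro!: ennreal_leI)
  next
    case 4
    then have K: "K < 0" "\<theta> > 0" using \<open>0 \<le> \<theta>\<close> by (auto simp: mult_less_0_iff)
    define x where "x = \<theta> * sqrt (- K / (N - 1))"
    have "K / (N - 1) < 0" using K N by (intro divide_neg_pos) auto
    then have "0 < x" using K by (simp add: x_def)
    moreover have "x \<le> 1" using small K by (simp add: x_def)
    ultimately have "sinh x > 0" "t\<^sup>2 * sinh x \<le> sinh (t * x)" using t by (auto intro: sinh_scaled_ge)
    then have "t\<^sup>2 \<le> sinh (t * x) / sinh x" by (simp add: field_simps)
    from mean[OF this] have "ennreal (t\<^sup>2) \<le> ennreal (t powr (1/N) *
         (sinh (t * \<theta> * sqrt (- K / (N - 1))) / sinh (\<theta> * sqrt (- K / (N - 1)))) powr (1 - 1/N))"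
      unfolding x_def by (auto simp: mult.assoc intro!: ennreal_leI)
    moreover have "\<not> K * \<theta>\<^sup>2 \<ge> (N - 1) * pi\<^sup>2"
      using 4 N by (smt (verit) mult_nonneg_nonneg zero_le_power2)
    ultimately show ?thesis using 4 N K unfolding distortion_def by simp
  qed (use tt in \<open>auto simp: distortion_def intro!: ennreal_leI\<close>)
qed

text \<open>The tangent inequality \<open>r\<^bsup>\<theta>\<^esup> \<le> \<theta> a\<^bsup>\<theta>-1\<^esup> r + (1 - \<theta>) a\<^bsup>\<theta>\<^esup>\<close> at \<open>a = 1 / m(C)\<close>
  replaces Jensen's inequality.\<close>

lemma powr_tangent:
  fixes r M \<theta> :: real
  assumes "0 \<le> r" "0 < M" "0 < \<theta>" "\<theta> < 1"
  shows "r powr \<theta> \<le> \<theta> * M powr (1 - \<theta>) * r + (1 - \<theta>) * M powr (- \<theta>)"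
proof (cases "r = 0")
  case False
  then have "(r * M) powr \<theta> * 1 powr (1 - \<theta>) \<le> \<theta> * (r * M) + (1 - \<theta>) * 1"
    using assms Youngs_inequality_0[of \<theta> "1 - \<theta>" "r * M" 1] by simp
  then have "r powr \<theta> * M powr \<theta> * M powr (- \<theta>) \<le> (\<theta> * (r * M) + (1 - \<theta>)) * M powr (- \<theta>)"
    using assms by (intro mult_right_mono) (auto simp: powr_mult)
  moreover have h: "M powr \<theta> * M powr (- \<theta>) = 1" "M * M powr (- \<theta>) = M powr (1 - \<theta>)"
    using assms by (auto simp: powr_minus powr_diff field_simps)
  moreover have "r powr \<theta> * M powr \<theta> * M powr (- \<theta>) = r powr \<theta>" by (simp add: mult.assoc h)
  moreover have "(\<theta> * (r * M) + (1 - \<theta>)) * M powr (- \<theta>) = \<theta> * M powr (1 - \<theta>) * r + (1 - \<theta>) * M powr (- \<theta>)"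
    unfolding h(2)[symmetric] by (simp add: algebra_simps)
  ultimately show ?thesis by simp
qed (use assms in auto)

context metric_measure_space
begin

text \<open>The density lives on \<open>C\<close> and has integral 1, so integrating the tangent
  bound over \<open>C\<close> gives \<open>\<theta> * M powr (1 - \<theta>) + (1 - \<theta>) * M
  powr (- \<theta>) * M\<close>, which is \<open>M powr (1 - \<theta>)\<close>.\<close>

lemma entropy_upper_bound:
  assumes \<nu>: "prob_space \<nu>" "sets \<nu> = sets m" "absolutely_continuous m \<nu>"
    and C: "C \<in> sets m" "emeasure m C < \<infinity>" "AE z in \<nu>. z \<in> C"
    and \<theta>: "0 < \<theta>" "\<theta> < 1"
  shows "(\<integral>\<^sup>+x. ennreal (real_density m \<nu> x powr \<theta>) \<partial>m) \<le> ennreal (measure m C powr (1 - \<theta>))"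
proof -
  interpret m: sigma_finite_measure m by (rule sigma_finite)
  interpret \<nu>: prob_space \<nu> by fact
  define M where "M = measure m C"
  have eM: "emeasure m C = ennreal M" using C(2) by (simp add: M_def emeasure_eq_ennreal_measure less_top)
  note [measurable] = C(1)
  have dens: "density m (RN_deriv m \<nu>) = \<nu>" using m.density_RN_deriv \<nu> by simp
  have fin: "AE x in m. RN_deriv m \<nu> x \<noteq> \<infinity>"
    using \<nu> by (intro m.RN_deriv_finite) (auto intro: \<nu>.sigma_finite_measure_axioms)
  \<comment> \<open>A statement almost everywhere for \<nu> carries over to \<open>m\<close> only
    where the density is positive.\<close>
  have zero: "AE x in m. RN_deriv m \<nu> x = 0 \<or> x \<in> C"
  proof -
    have "AE z in density m (RN_deriv m \<nu>). z \<in> C" by (subst dens) (rule C(3))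
    then have "AE x in m. RN_deriv m \<nu> x > 0 \<longrightarrow> x \<in> C" by (subst (asm) AE_density) auto
    then show ?thesis by eventually_elim (auto simp: zero_less_iff_neq_zero)
  qed
  have \<nu>C: "(\<integral>\<^sup>+x. RN_deriv m \<nu> x \<partial>m) = 1"
  proof -
    have "1 = emeasure (density m (RN_deriv m \<nu>)) (space m)"
      using \<nu>.emeasure_space_1 sets_eq_imp_space_eq[OF \<nu>(2)] unfolding dens by simp
    also have "\<dots> = (\<integral>\<^sup>+x. RN_deriv m \<nu> x * indicator (space m) x \<partial>m)" by (rule emeasure_density) (simp_all del: space_eq)
    also have "\<dots> = (\<integral>\<^sup>+x. RN_deriv m \<nu> x \<partial>m)" by (rule nn_integral_cong) auto
    finally show ?thesis by simp
  qed
  have "M > 0"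
  proof (rule ccontr)
    assume "\<not> M > 0"
    then have "emeasure m C = 0" using eM by (simp add: M_def not_less measure_le_0_iff)
    then have "AE x in m. x \<notin> C" by (intro AE_not_in) (auto simp: null_sets_def)
    then have "AE x in m. RN_deriv m \<nu> x = 0" using zero by eventually_elim auto
    then have "(\<integral>\<^sup>+x. RN_deriv m \<nu> x \<partial>m) = 0" by (subst nn_integral_0_iff_AE) auto
    then show False using \<nu>C by simp
  qed
  have "(\<integral>\<^sup>+x. ennreal (real_density m \<nu> x powr \<theta>) \<partial>m)
      \<le> (\<integral>\<^sup>+x. ennreal (\<theta> * M powr (1 - \<theta>)) * RN_deriv m \<nu> x + ennreal ((1 - \<theta>) * M powr (- \<theta>)) * indicator C x \<partial>m)"
  proof (rule nn_integral_mono_AE)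
    show "AE x in m. ennreal (real_density m \<nu> x powr \<theta>)
      \<le> ennreal (\<theta> * M powr (1 - \<theta>)) * RN_deriv m \<nu> x + ennreal ((1 - \<theta>) * M powr (- \<theta>)) * indicator C x"
      using fin zero
    proof eventually_elim
      case (elim x)
      show ?case
      proof (cases "x \<in> C")
        case True
        define r where "r = real_density m \<nu> x"
        have r: "RN_deriv m \<nu> x = ennreal r" "0 \<le> r" using elim by (auto simp: r_def real_density_def less_top)
        have "ennreal (r powr \<theta>) \<le> ennreal (\<theta> * M powr (1 - \<theta>) * r + (1 - \<theta>) * M powr (- \<theta>))"
          using powr_tangent[OF r(2) \<open>M > 0\<close> \<theta>] by (rule ennreal_leI)
        also have "\<dots> = ennreal (\<theta> * M powr (1 - \<theta>)) * ennreal r + ennreal ((1 - \<theta>) * M powr (- \<theta>))"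
          using r \<theta> by (simp add: ennreal_plus ennreal_mult)
        finally show ?thesis using True r by (simp add: r_def[symmetric])
      qed (use elim in \<open>simp add: real_density_def\<close>)
    qed
  qed
  also have "\<dots> = ennreal (\<theta> * M powr (1 - \<theta>)) * 1 + ennreal ((1 - \<theta>) * M powr (- \<theta>)) * ennreal M"
    by (subst nn_integral_add) (auto simp: nn_integral_cmult \<nu>C nn_integral_cmult_indicator eM)
  also have "\<dots> = ennreal (\<theta> * M powr (1 - \<theta>) + (1 - \<theta>) * (M powr (- \<theta>) * M))"
    using \<theta> \<open>M > 0\<close> by (simp add: ennreal_plus ennreal_mult mult.assoc)
  also have "M powr (- \<theta>) * M = M powr (1 - \<theta>)"
    using \<open>M > 0\<close> by (simp add: powr_minus powr_diff field_simps)
  finally show ?thesis by (simp add: M_def algebra_simps)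
qed

text \<open>The term of the target measure is nonnegative and is dropped. In the other one the
  density is the constant \<open>1 / measure m A\<close> almost everywhere and the distortion is at
  least \<open>(1 - t)\<^sup>2\<close>, so a constant is integrated against a probability
  measure.\<close>

lemma entropy_lower_bound:
  assumes A: "A \<in> sets m" "0 < emeasure m A" "emeasure m A < \<infinity>"
    and \<pi>: "\<pi> \<in> couplings X (uniform_measure m A) \<mu>1"
    and d: "AE p in \<pi>. K < 0 \<longrightarrow> mdist X (fst p) (snd p) * sqrt (- K / (N - 1)) \<le> 1"
    and N: "N > 1" and t: "t \<in> {0..1}"
  shows "ennreal ((1 - t)\<^sup>2 * measure m A powr (1 / N)) \<le>
    (\<integral>\<^sup>+(x, y). distortion K N (1 - t) (mdist X x y) * ennreal (real_density m (uniform_measure m A) x powr (- 1/N))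
               + distortion K N t (mdist X x y) * ennreal (real_density m \<mu>1 y powr (- 1/N)) \<partial>\<pi>)"
proof -
  interpret m: sigma_finite_measure m by (rule sigma_finite)
  let ?\<mu> = "uniform_measure m A"
  define M where "M = measure m A"
  have eM: "emeasure m A = ennreal M" using A(3) by (simp add: M_def emeasure_eq_ennreal_measure less_top)
  then have "M > 0" using A(2) by (auto simp: ennreal_0)
  note [measurable] = A(1)
  have pU: "prob_space ?\<mu>" using A by (intro prob_space_uniform_measure) auto
  interpret p: prob_space \<pi> using couplings_prob_space[OF \<pi> pU] .
  have "AE x in m. indicator A x / emeasure m A = RN_deriv m ?\<mu> x"
    by (rule m.RN_deriv_unique) (auto simp: uniform_measure_def)
  then have "AE x in m. x \<in> A \<longrightarrow> real_density m ?\<mu> x = 1 / M"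
  proof eventually_elim
    case (elim x)
    show ?case
    proof
      assume "x \<in> A"
      then have "RN_deriv m ?\<mu> x = ennreal (1 / M)"
        using elim[symmetric] \<open>M > 0\<close> eM by (simp add: divide_ennreal flip: ennreal_1)
      then show "real_density m ?\<mu> x = 1 / M" using \<open>M > 0\<close> by (simp add: real_density_def)
    qed
  qed
  then have "AE x in ?\<mu>. real_density m ?\<mu> x = 1 / M"
    using A by (subst AE_uniform_measure) auto
  then have AEp: "AE p in \<pi>. real_density m ?\<mu> (fst p) = 1 / M" using couplings_AE(1)[OF \<pi>] by blast
  have "ennreal ((1 - t)\<^sup>2 * M powr (1 / N)) = (\<integral>\<^sup>+p. ennreal ((1 - t)\<^sup>2 * M powr (1 / N)) \<partial>\<pi>)"
    by (simp add: p.emeasure_space_1)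
  also have "\<dots> \<le> (\<integral>\<^sup>+(x, y). distortion K N (1 - t) (mdist X x y) * ennreal (real_density m ?\<mu> x powr (- 1/N))
               + distortion K N t (mdist X x y) * ennreal (real_density m \<mu>1 y powr (- 1/N)) \<partial>\<pi>)"
  proof (rule nn_integral_mono_AE)
    show "AE p in \<pi>. ennreal ((1 - t)\<^sup>2 * M powr (1 / N)) \<le>
      (case p of (x, y) \<Rightarrow> distortion K N (1 - t) (mdist X x y) * ennreal (real_density m ?\<mu> x powr (- 1/N))
               + distortion K N t (mdist X x y) * ennreal (real_density m \<mu>1 y powr (- 1/N)))"
      using d AEp
    proof eventually_elim
      case (elim p)
      obtain x y where p: "p = (x, y)" by (cases p)
      have "(1 / M) powr (- 1 / N) = M powr (1 / N)"
        using \<open>M > 0\<close> by (simp add: powr_divide powr_minus field_simps)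
      then have Meq: "ennreal (M powr (1 / N)) = ennreal (real_density m ?\<mu> x powr (- 1/N))"
        using elim(2) by (simp add: p)
      have "ennreal ((1 - t)\<^sup>2) \<le> distortion K N (1 - t) (mdist X x y)"
        using elim t N by (intro distortion_ge) (auto simp: p)
      then have "ennreal ((1 - t)\<^sup>2) * ennreal (M powr (1 / N)) \<le> distortion K N (1 - t) (mdist X x y) * ennreal (M powr (1 / N))"
        by (rule mult_right_mono) simp
      also have "distortion K N (1 - t) (mdist X x y) * ennreal (M powr (1 / N))
          = distortion K N (1 - t) (mdist X x y) * ennreal (real_density m ?\<mu> x powr (- 1/N))"
        by (simp only: Meq)
      finally show ?case by (simp add: p ennreal_mult add_increasing2)
    qed
  qed
  finally show ?thesis unfolding M_def .
qed

end

section \<open>From Wasserstein geodesics to a contraction estimate\<close>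

lemma ennreal_sqrt_eqD:
  assumes "ennreal_sqrt x = ennreal c * ennreal_sqrt (ennreal V)" "0 \<le> c" "0 \<le> V"
  shows "x = ennreal (c\<^sup>2 * V)"
proof -
  have V: "ennreal_sqrt (ennreal V) = ennreal (sqrt V)" using assms by (simp add: ennreal_sqrt_def)
  then have "x \<noteq> \<infinity>" using assms
    by (auto simp: ennreal_sqrt_def ennreal_mult_eq_top_iff simp flip: ennreal_mult split: if_splits)
  then obtain y where y: "x = ennreal y" "0 \<le> y" by (cases x) auto
  then have "ennreal (sqrt y) = ennreal (c * sqrt V)"
    using assms V by (simp add: ennreal_sqrt_def ennreal_mult)
  then have "sqrt y = c * sqrt V" using assms y by (subst (asm) ennreal_inj) auto
  then have "y = (c * sqrt V)\<^sup>2" using y(2) by (metis real_sqrt_pow2)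
  then show ?thesis using assms y by (simp add: power_mult_distrib)
qed

text \<open>\<open>CD\<close> hands out an optimal coupling for the two end measures only. For pairs
  involving an intermediate measure just the infimum is known, hence the slack
  \<open>e\<close>.\<close>

lemma near_optimal_coupling:
  assumes "wasserstein X \<mu> \<nu> = ennreal c * ennreal_sqrt (ennreal V)" "0 \<le> c" "0 \<le> V" "e > 0"
  shows "\<exists>\<pi>\<in>couplings X \<mu> \<nu>. transport_cost X \<pi> \<le> ennreal (c\<^sup>2 * V + e)"
proof -
  have "(INF \<pi> \<in> couplings X \<mu> \<nu>. transport_cost X \<pi>) = ennreal (c\<^sup>2 * V)"
    using assms unfolding wasserstein_def by (intro ennreal_sqrt_eqD) auto
  also have "\<dots> < ennreal (c\<^sup>2 * V + e)" using assms by (intro ennreal_lessI) (auto intro: add_nonneg_pos)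
  finally show ?thesis unfolding INF_less_iff by (auto intro: less_imp_le)
qed

context metric_measure_space
begin

lemma uniform_measure_in_P2_ac:
  assumes A: "A \<in> sets m" "0 < emeasure m A" "emeasure m A < \<infinity>"
    and p: "p \<in> mspace X" "A \<subseteq> mcball_of X p R"
  shows "uniform_measure m A \<in> P2_ac X m"
proof -
  let ?\<mu> = "uniform_measure m A"
  interpret U: prob_space ?\<mu> using A by (intro prob_space_uniform_measure) auto
  have "(\<integral>\<^sup>+x. ennreal ((mdist X p x)\<^sup>2) \<partial>?\<mu>) \<le> (\<integral>\<^sup>+x. ennreal (R\<^sup>2) \<partial>?\<mu>)"
  proof (rule nn_integral_mono_AE)
    have AE: "AE x in ?\<mu>. x \<in> A" by (intro AE_uniform_measureI) (use A in auto)
    show "AE x in ?\<mu>. ennreal ((mdist X p x)\<^sup>2) \<le> ennreal (R\<^sup>2)"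
      using AE by eventually_elim (use p in \<open>auto intro!: ennreal_leI power_mono\<close>)
  qed
  also have "\<dots> < \<infinity>" using U.emeasure_space_1 by simp
  finally have "(\<integral>\<^sup>+x. ennreal ((mdist X p x)\<^sup>2) \<partial>?\<mu>) < \<infinity>" .
  moreover have "absolutely_continuous m ?\<mu>"
    unfolding uniform_measure_def using A(1) by (intro absolutely_continuousI_density) auto
  ultimately show ?thesis
    using p(1) U.prob_space_axioms unfolding P2_ac_def by (auto simp: sets_eq)
qed

end

text \<open>Below the scale \<open>R\<close>, comparison triangles stay in the range where the cosine is monotone, and the
  distortion coefficients are at least \<open>t\<^sup>2\<close>.\<close>

locale small_scale = metric_measure_space X m for X :: "'a metric" and m :: "'a measure" +
  fixes K N \<kappa> R :: real
  assumes CD: "CD K N X m" and N: "N \<ge> 1" and cat: "CAT \<kappa> X" and R: "R > 0"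
    and smallK: "K < 0 \<Longrightarrow> 2 * R * sqrt (- K / N) \<le> 1"
    and small\<kappa>: "\<kappa> > 0 \<Longrightarrow> sqrt \<kappa> * R \<le> pi / 4"
begin

text \<open>\<open>CD\<close> is applied to the uniform measures on \<open>A\<close> and on a tiny
  ball around \<open>p\<close>. The intermediate measure at time \<open>l\<close> is concentrated on
  \<open>C\<close>, so its entropy is at most a power of \<open>measure m C\<close>, while
  \<open>CD\<close> bounds it below by a power of \<open>measure m A\<close>. Any \<open>C\<close>
  that catches all approximate intermediate points will do, so their set itself never has to be
  measured.\<close>

lemma measure_contraction:
  assumes p: "p \<in> mspace X" and A: "A \<in> sets m" "emeasure m A < \<infinity>" "A \<subseteq> mcball_of X p R"
    and C: "C \<in> sets m" "emeasure m C < \<infinity>" and l: "0 < l" "l < 1" and "\<xi> > 0"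
    and mid: "\<And>x z. x \<in> A \<Longrightarrow> z \<in> mspace X \<Longrightarrow> mdist X x z \<le> l * mdist X x p + \<xi> \<Longrightarrow>
        mdist X z p \<le> (1 - l) * mdist X x p + \<xi> \<Longrightarrow> z \<in> C"
  shows "(1 - l) powr (2 * (N + 1)) * measure m A \<le> measure m C"
proof (cases "emeasure m A = 0")
  case True
  then show ?thesis by (simp add: measure_def)
next
  case False
  then have mA: "0 < emeasure m A" by (simp add: zero_less_iff_neq_zero)
  obtain r where r: "r > 0" "emeasure m (mball_of X p r) < \<infinity>" using locally_finite[OF p] by blast
  \<comment> \<open>The three bounds give the small ball finite measure, make it small enough for
    the concentration argument, and keep all transport distances below \<open>2 * R\<close>.\<close>
  define q where "q = min r (min (\<xi> / 4) R)"
  have q: "0 < q" "q \<le> \<xi> / 4" "q \<le> R" "q \<le> r" using r \<open>\<xi> > 0\<close> R by (auto simp: q_def)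
  define B where "B = mball_of X p q"
  have B: "B \<in> sets m" "0 < emeasure m B" "B \<subseteq> mcball_of X p q"
    unfolding B_def using q p by (auto intro: ball_pos)
  have "emeasure m B \<le> emeasure m (mball_of X p r)"
    unfolding B_def by (intro emeasure_mono mball_of_mono q) auto
  then have Bfin: "emeasure m B < \<infinity>" using r by auto
  let ?\<mu>0 = "uniform_measure m A" and ?\<mu>1 = "uniform_measure m B"
  have P0: "prob_space ?\<mu>0" and P1: "prob_space ?\<mu>1"
    using mA A B Bfin by (auto intro!: prob_space_uniform_measure)
  have AE0: "AE x in ?\<mu>0. x \<in> A" and AE1: "AE x in ?\<mu>1. x \<in> B"
    using A B by (auto intro!: AE_uniform_measureI)
  have U0: "?\<mu>0 \<in> P2_ac X m" and U1: "?\<mu>1 \<in> P2_ac X m"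
    using uniform_measure_in_P2_ac[OF A(1) mA A(2) p A(3)] uniform_measure_in_P2_ac[OF B(1,2) Bfin p B(3)] .
  obtain \<pi> \<Gamma> where opt: "optimal_coupling X ?\<mu>0 ?\<mu>1 \<pi>"
    and \<Gamma>01: "\<Gamma> 0 = ?\<mu>0" "\<Gamma> 1 = ?\<mu>1" and \<Gamma>P: "\<forall>t\<in>{0..1}. \<Gamma> t \<in> P2_ac X m"
    and \<Gamma>w: "\<forall>s\<in>{0..1}. \<forall>t\<in>{0..1}.
           wasserstein X (\<Gamma> s) (\<Gamma> t) = ennreal \<bar>s - t\<bar> * wasserstein X ?\<mu>0 ?\<mu>1"
    and ent: "\<forall>t\<in>{0..1::real}. \<forall>N'\<ge>N.
           renyi_entropy N' m (\<Gamma> t) \<le>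
           - enn2ereal (\<integral>\<^sup>+(x, y).
                 distortion K N' (1 - t) (mdist X x y) * ennreal (real_density m ?\<mu>0 x powr (- 1/N'))
               + distortion K N' t (mdist X x y) * ennreal (real_density m ?\<mu>1 y powr (- 1/N')) \<partial>\<pi>)"
    using CD[unfolded CD_def, THEN bspec, OF U0, THEN bspec, OF U1]
    by iprover
  have \<pi>: "\<pi> \<in> couplings X ?\<mu>0 ?\<mu>1"
    and \<pi>_opt: "\<And>\<pi>'. \<pi>' \<in> couplings X ?\<mu>0 ?\<mu>1 \<Longrightarrow> transport_cost X \<pi> \<le> transport_cost X \<pi>'"
    using opt by (auto simp: optimal_coupling_def)
  interpret \<pi>: prob_space \<pi> using couplings_prob_space[OF \<pi> P0] .
  have AE\<pi>: "AE w in \<pi>. mdist X (fst w) (snd w) \<le> 2 * R"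
    using couplings_AE(1)[OF \<pi> AE0] couplings_AE(2)[OF \<pi> AE1]
  proof eventually_elim
    case (elim w)
    have "mdist X (fst w) (snd w) \<le> mdist X (fst w) p + mdist X p (snd w)"
      using elim A(3) B(3) p by (intro mdist_triangle) auto
    moreover have "mdist X (fst w) p \<le> R" "mdist X p (snd w) \<le> R"
      using elim A(3) B(3) q by (force simp: mdist_commute)+
    ultimately show ?case by simp
  qed
  have "transport_cost X \<pi> \<le> (\<integral>\<^sup>+w. ennreal ((2 * R)\<^sup>2) \<partial>\<pi>)"
    unfolding transport_cost_def case_prod_beta
    by (rule nn_integral_mono_AE) (use AE\<pi> in eventually_elim, intro ennreal_leI power_mono, auto)
  then have "transport_cost X \<pi> \<le> ennreal ((2 * R)\<^sup>2)" by (simp add: \<pi>.emeasure_space_1)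
  then have "transport_cost X \<pi> < \<infinity>" by (rule le_less_trans) simp
  then obtain V where V: "transport_cost X \<pi> = ennreal V" "0 \<le> V" by (cases "transport_cost X \<pi>") auto
  have "(INF \<pi> \<in> couplings X ?\<mu>0 ?\<mu>1. transport_cost X \<pi>) = transport_cost X \<pi>"
    using \<pi> \<pi>_opt by (intro antisym INF_lower INF_greatest)
  then have W: "wasserstein X ?\<mu>0 ?\<mu>1 = ennreal_sqrt (ennreal V)" by (simp add: wasserstein_def V)
  define \<nu> where "\<nu> = \<Gamma> l"
  have \<nu>: "prob_space \<nu>" "sets \<nu> = sets (metric_borel X)" "absolutely_continuous m \<nu>"
    using \<Gamma>P[THEN bspec, of l] l by (auto simp: \<nu>_def P2_ac_def)
  have conc: "AE z in \<nu>. z \<in> C"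
  proof (rule intermediate_measure_concentrated[OF P0 P1 V(2) _ _ _ l \<open>\<xi> > 0\<close> p AE0 A(3) _ _ mid \<nu>(1,2)])
    show "ennreal V \<le> transport_cost X \<pi>'" if "\<pi>' \<in> couplings X ?\<mu>0 ?\<mu>1" for \<pi>'
      using \<pi>_opt[OF that] V by simp
    show "\<exists>\<pi>\<in>couplings X ?\<mu>0 \<nu>. transport_cost X \<pi> \<le> ennreal (l\<^sup>2 * V + e)" if "e > 0" for e
      using \<Gamma>w[THEN bspec, of 0, THEN bspec, of l] l V that by (intro near_optimal_coupling) (auto simp: \<Gamma>01 W \<nu>_def)
    show "\<exists>\<pi>\<in>couplings X \<nu> ?\<mu>1. transport_cost X \<pi> \<le> ennreal ((1 - l)\<^sup>2 * V + e)" if "e > 0" for e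
      using \<Gamma>w[THEN bspec, of l, THEN bspec, of 1] l V that by (intro near_optimal_coupling) (auto simp: \<Gamma>01 W \<nu>_def)
    show "AE y in ?\<mu>1. mdist X p y \<le> \<xi> / 4"
      using AE1 by eventually_elim (use q in \<open>auto simp: B_def\<close>)
    show "C \<in> sets (metric_borel X)" using C sets_eq by simp
  qed
  \<comment> \<open>A dimension larger than 1 makes the exponent \<open>1 - 1/N'\<close> of the entropy positive also for \<open>N = 1\<close>.\<close>
  define N' where "N' = N + 1"
  have N': "N' > 1" "N' \<ge> N" "N' - 1 = N" using N by (auto simp: N'_def)
  let ?I = "\<integral>\<^sup>+(x, y).
                 distortion K N' (1 - l) (mdist X x y) * ennreal (real_density m ?\<mu>0 x powr (- 1/N'))
               + distortion K N' l (mdist X x y) * ennreal (real_density m ?\<mu>1 y powr (- 1/N')) \<partial>\<pi>"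
  have "AE w in \<pi>. K < 0 \<longrightarrow> mdist X (fst w) (snd w) * sqrt (- K / (N' - 1)) \<le> 1"
    using AE\<pi>
  proof eventually_elim
    case (elim w)
    show ?case
    proof
      assume "K < 0"
      have "mdist X (fst w) (snd w) * sqrt (- K / N) \<le> 2 * R * sqrt (- K / N)"
        using elim \<open>K < 0\<close> N by (intro mult_right_mono) (auto simp: divide_nonpos_pos)
      then show "mdist X (fst w) (snd w) * sqrt (- K / (N' - 1)) \<le> 1" using smallK[OF \<open>K < 0\<close>] N'(3) by simp
    qed
  qed
  then have "ennreal ((1 - l)\<^sup>2 * measure m A powr (1 / N')) \<le> ?I"
    using l N' by (intro entropy_lower_bound[OF A(1) mA A(2) \<pi>]) auto
  \<comment> \<open>Both sides of the entropy inequality in \<open>CD\<close> carry a minus sign, so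
    the order is reversed here.\<close>
  also have "?I \<le> (\<integral>\<^sup>+x. ennreal (real_density m \<nu> x powr (1 - 1/N')) \<partial>m)"
    using ent[THEN bspec, of l, THEN spec, of N'] l N' unfolding renyi_entropy_def \<nu>_def by (simp add: less_eq_ennreal.rep_eq)
  also have "\<dots> \<le> ennreal (measure m C powr (1 - (1 - 1 / N')))"
    using N' \<nu> C conc sets_eq by (intro entropy_upper_bound) auto
  finally have "(1 - l)\<^sup>2 * measure m A powr (1 / N') \<le> measure m C powr (1 / N')"
    by (simp add: ennreal_le_iff)
  \<comment> \<open>Raising to the power \<open>N'\<close> removes the roots and turns the square
    into the exponent \<open>2 * (N + 1)\<close>.\<close>
  then have "((1 - l)\<^sup>2 * measure m A powr (1 / N')) powr N' \<le> (measure m C powr (1 / N')) powr N'"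
    using l N' by (intro powr_mono2) auto
  moreover have "((1 - l)\<^sup>2) powr N' = (1 - l) powr (2 * N')"
  proof -
    have "(1 - l)\<^sup>2 = (1 - l) powr 2" using l by (simp add: powr_numeral)
    then show ?thesis by (simp add: powr_powr)
  qed
  ultimately show ?thesis using N' l by (simp add: powr_mult powr_powr N'_def)
qed

end

section \<open>Contractions of balls\<close>

text \<open>The last condition says that images lose at most the factor \<open>c\<close> of measure,
  but in terms of preimages, so that no image of a Borel set has to be measurable. Measurability is
  asked on the whole space to keep compositions and push-forwards simple.\<close>

definition ball_contraction :: "'a metric \<Rightarrow> 'a measure \<Rightarrow> real \<Rightarrow> 'a set \<Rightarrow> 'a set \<Rightarrow> ('a \<Rightarrow> 'a) \<Rightarrow> bool" where
  "ball_contraction X m c B B' f \<longleftrightarrow>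
     f \<in> metric_borel X \<rightarrow>\<^sub>M metric_borel X \<and> f ` B \<subseteq> B' \<and>
     (\<forall>x\<in>B. \<forall>y\<in>B. mdist X (f x) (f y) \<le> mdist X x y) \<and>
     (\<forall>V\<in>sets m. c * measure m (f -` V \<inter> B) \<le> measure m (V \<inter> B'))"

lemma measurable_extend_const:
  assumes S: "S \<in> sets M" and "f \<in> restrict_space M S \<rightarrow>\<^sub>M N" "y \<in> space N"
  shows "(\<lambda>x. if x \<in> S then f x else y) \<in> M \<rightarrow>\<^sub>M N"
proof (subst measurable_If_restrict_space_iff)
  have "{x \<in> space M. x \<in> S} = S" using sets.sets_into_space[OF S] by blast
  then show "{x \<in> space M. x \<in> S} \<in> sets M" using S by simp
qed (use assms in simp)

lemma closedin_neighbourhoods_Inter: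
  assumes F: "closedin (mtopology_of X) F" and e: "\<And>n. e n > (0::real)" "e \<longlonglongrightarrow> 0"
  shows "(\<Inter>n. \<Union>v\<in>F. mball_of X v (e n)) = F"
proof (intro equalityI subsetI)
  fix x assume "x \<in> F"
  then show "x \<in> (\<Inter>n. \<Union>v\<in>F. mball_of X v (e n))"
    using closedin_subset[OF F] e(1) by fastforce
next
  fix x assume x: "x \<in> (\<Inter>n. \<Union>v\<in>F. mball_of X v (e n))"
  then have xX: "x \<in> mspace X" by auto
  show "x \<in> F"
  proof (rule ccontr)
    assume "x \<notin> F"
    moreover have "openin (mtopology_of X) (mspace X - F)" using F by (simp add: closedin_def)
    ultimately obtain d where d: "d > 0" "mball_of X x d \<subseteq> mspace X - F"
      using xX unfolding openin_mtopology_of by blast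
    obtain n where n: "e n < d" using order_tendstoD(2)[OF e(2) d(1)] by (auto simp: eventually_sequentially)
    obtain v where "v \<in> F" "x \<in> mball_of X v (e n)" using x by blast
    then have "v \<in> mball_of X x d" using n by (auto simp: mdist_commute)
    then show False using d \<open>v \<in> F\<close> by blast
  qed
qed

context small_scale
begin

text \<open>\<open>f\<close> moves each point by the fraction \<open>l\<close> along a geodesic
  towards \<open>e 1\<close>. It is 1-Lipschitz by \<open>CAT_contraction\<close> and sends centre
  to centre, so balls go to balls. For closed \<open>F\<close> the measure bound is obtained with
  shrinking neighbourhoods of \<open>F\<close> in the role of \<open>C\<close>; general sets follow
  by inner regularity.\<close>

lemma contraction_map:
  assumes e: "is_geodesic X e" and l: "0 < l" "l < 1" and r: "r > 0"
    and far: "mdist X (e 0) (e 1) + r \<le> R / 2"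
    and fin: "emeasure m (mcball_of X (e 0) r) < \<infinity>" "emeasure m (mcball_of X (e l) (2 * r)) < \<infinity>"
  shows "\<exists>f. ball_contraction X m ((1 - l) powr (2 * (N + 1))) (mcball_of X (e 0) r) (mcball_of X (e l) r) f"
proof -
  define p q p' B B' c where "p = e 0" and "q = e 1" and "p' = e l" and "B = mcball_of X p r"
    and "B' = mcball_of X p' r" and "c = (1 - l) powr (2 * (N + 1))"
  have pX: "p \<in> mspace X" "q \<in> mspace X" "p' \<in> mspace X"
    using l by (auto simp: p_def q_def p'_def intro!: geodesic_in_mspace[OF e])
  have Bm: "B \<in> sets m" "B' \<in> sets m" by (auto simp: B_def B'_def)
  have Bfin: "emeasure m B < \<infinity>" using fin by (simp add: B_def p_def)
  have pq: "mdist X p q + r \<le> R / 2" using far by (simp add: p_def q_def)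
  have dist: "mdist X x q \<le> R / 2" if "x \<in> B" for x
    using mdist_triangle[of x X p q] that pX pq by (auto simp: B_def mdist_commute)
  have rR: "2 * r \<le> R" using pq mdist_nonneg[of X p q] by linarith
  have diam: "mdist X x y \<le> R" if "x \<in> B" "y \<in> B" for x y
    using mdist_triangle[of x X p y] that pX rR by (auto simp: B_def mdist_commute)
  have "\<exists>g. is_geodesic X g \<and> g 0 = x \<and> g 1 = q" if "x \<in> B" for x
    using CAT_geodesic[OF cat small\<kappa>, of x q] dist[OF that] pX that R by (auto simp: B_def)
  then obtain G where G: "\<And>x. x \<in> B \<Longrightarrow> is_geodesic X (G x)" "\<And>x. x \<in> B \<Longrightarrow> G x 0 = x" "\<And>x. x \<in> B \<Longrightarrow> G x 1 = q"
    by metis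
  define f where "f x = (if x \<in> B then G x l else p')" for x
  have fX: "f x \<in> mspace X" for x
    using l pX by (auto simp: f_def intro!: geodesic_in_mspace[OF G(1)])
  have lip: "mdist X (f x) (f y) \<le> mdist X x y" if "x \<in> B" "y \<in> B" for x y
    using CAT_contraction[OF cat G(1)[OF that(1)] G(1)[OF that(2)], of R l] G(2,3) that small\<kappa> l dist[of x] dist[of y] diam[of x y] R
    by (simp add: f_def)
  have pB: "p \<in> B" using pX r by (simp add: B_def)
  \<comment> \<open>The chosen geodesic from \<open>p\<close> may differ from \<open>e\<close> a
    priori. Contraction applied to these two geodesics with equal endpoints gives distance 0 at time
    \<open>l\<close>.\<close>
  have "mdist X (G p l) (e l) \<le> mdist X (G p 0) (e 0)"
    using pB small\<kappa> l dist[OF pB] R pX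
    by (intro CAT_contraction[OF cat G(1)[OF pB] e, of R]) (auto simp: G(2,3) p_def[symmetric] q_def[symmetric])
  then have "mdist X (f p) p' = 0"
    using pB pX by (simp add: f_def G(2) p'_def[symmetric] p_def[symmetric] order_antisym)
  then have fp: "f p = p'" using fX pX by simp
  have fB: "f ` B \<subseteq> B'"
  proof
    fix y assume "y \<in> f ` B"
    then obtain x where x: "x \<in> B" "y = f x" by blast
    have "mdist X p' (f x) \<le> mdist X p x" using lip[OF pB x(1)] fp by simp
    then show "y \<in> B'" using x fX pX by (auto simp: B_def B'_def)
  qed
  have f_restr: "f \<in> restrict_space (metric_borel X) B \<rightarrow>\<^sub>M metric_borel X"
    using lip fX Bm(1) sets_eq by (intro measurable_Lipschitz_on[where L = 1]) auto
  have fm [measurable]: "f \<in> metric_borel X \<rightarrow>\<^sub>M metric_borel X"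
  proof -
    have "(\<lambda>x. if x \<in> B then f x else p') \<in> metric_borel X \<rightarrow>\<^sub>M metric_borel X"
      using Bm(1) f_restr pX by (intro measurable_extend_const) (simp_all add: sets_eq)
    moreover have "(\<lambda>x. if x \<in> B then f x else p') = f" by (auto simp: f_def)
    ultimately show ?thesis by simp
  qed
  have fm' : "f \<in> m \<rightarrow>\<^sub>M m" using fm by (simp cong: measurable_cong_sets add: sets_eq)
  have pre: "f -` V \<inter> B \<in> sets m" if "V \<in> sets m" for V
  proof -
    have "f -` V \<inter> space m \<in> sets m" using measurable_sets[OF fm' that] .
    then have "(f -` V \<inter> space m) \<inter> B \<in> sets m" using Bm by blast
    moreover have "(f -` V \<inter> space m) \<inter> B = f -` V \<inter> B" by (auto simp: B_def)
    ultimately show ?thesis by simp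
  qed
  have closed_case: "c * measure m (f -` F \<inter> B) \<le> measure m F"
    if F: "closedin (mtopology_of X) F" and FB: "F \<subseteq> B'" for F
  proof -
    \<comment> \<open>Thinness gives a weak inequality, so the open neighbourhoods below use the
      radius \<open>2 * \<eta> n\<close>. Its bound by \<open>r / 2\<close> keeps them inside a ball
      of finite measure, as continuity from above requires.\<close>
    define \<eta> where "\<eta> n = r / 4 * inverse (real (Suc n))" for n
    have \<eta>: "\<eta> n > 0" "2 * \<eta> n \<le> r / 2" for n
      using r by (auto simp: \<eta>_def field_simps)
    have \<eta>0: "(\<lambda>n. 2 * \<eta> n) \<longlonglongrightarrow> 0"
      unfolding \<eta>_def using LIMSEQ_inverse_real_of_nat
      by (auto intro!: tendsto_mult_right_zero)
    define C where "C n = (\<Union>v\<in>F. mball_of X v (2 * \<eta> n))" for n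
    have Cm: "C n \<in> sets m" for n unfolding C_def by (intro open_sets openin_Union) auto
    have Csub: "C n \<subseteq> mcball_of X p' (2 * r)" for n
    proof
      fix z assume "z \<in> C n"
      then obtain v where v: "v \<in> F" "v \<in> mspace X" "z \<in> mspace X" "mdist X v z < 2 * \<eta> n" by (auto simp: C_def)
      have "mdist X p' z \<le> mdist X p' v + mdist X v z" using v pX by (intro mdist_triangle) auto
      then show "z \<in> mcball_of X p' (2 * r)" using v FB \<eta>(2)[of n] r pX by (auto simp: B'_def)
    qed
    have Cfin: "emeasure m (C n) < \<infinity>" for n
    proof -
      have "emeasure m (C n) \<le> emeasure m (mcball_of X p' (2 * r))" using Csub by (intro emeasure_mono) auto
      then show ?thesis using fin(2) by (simp add: p'_def)
    qed
    have le: "c * measure m (f -` F \<inter> B) \<le> measure m (C n)" for n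
    proof -
      obtain \<xi> where xi: "\<xi> > 0" and thin: "\<And>g z l. is_geodesic X g \<Longrightarrow> z \<in> mspace X \<Longrightarrow> l \<in> {0..1} \<Longrightarrow>
        mdist X (g 0) (g 1) \<le> R \<Longrightarrow> mdist X (g 0) z \<le> R \<Longrightarrow> mdist X z (g 1) \<le> R \<Longrightarrow>
        mdist X (g 0) z \<le> l * mdist X (g 0) (g 1) + \<xi> \<Longrightarrow> mdist X z (g 1) \<le> (1 - l) * mdist X (g 0) (g 1) + \<xi>
        \<Longrightarrow> mdist X z (g l) \<le> \<eta> n"
        using CAT_thin[OF cat small\<kappa> \<eta>(1)[of n]] R by (metis less_imp_le)
      \<comment> \<open>The cap at \<open>R / 2\<close> keeps approximate intermediate points within
        distance \<open>R\<close> of both endpoints, as needed for comparison.\<close>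
      define \<xi>' where "\<xi>' = min \<xi> (R / 2)"
      have xi': "\<xi>' > 0" "\<xi>' \<le> \<xi>" "\<xi>' \<le> R / 2" using xi R by (auto simp: \<xi>'_def)
      show ?thesis
        unfolding c_def
      proof (rule measure_contraction[OF pX(2) _ _ _ Cm Cfin l xi'(1)])
        show "f -` F \<inter> B \<in> sets m" using F by (intro pre closed_sets)
        show "emeasure m (f -` F \<inter> B) < \<infinity>"
        proof (rule le_less_trans[OF _ Bfin])
          show "emeasure m (f -` F \<inter> B) \<le> emeasure m B" using Bm by (intro emeasure_mono) auto
        qed
        show "f -` F \<inter> B \<subseteq> mcball_of X q R"
        proof
          fix x assume "x \<in> f -` F \<inter> B"
          then have x: "x \<in> B" by simp
          then show "x \<in> mcball_of X q R" using dist[OF x] pX R by (simp add: B_def mdist_commute[of X q])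
        qed
      next
        fix x z assume x: "x \<in> f -` F \<inter> B" and z: "z \<in> mspace X" "mdist X x z \<le> l * mdist X x q + \<xi>'"
          "mdist X z q \<le> (1 - l) * mdist X x q + \<xi>'"
        have xB: "x \<in> B" using x by simp
        have "l * mdist X x q \<le> mdist X x q" "(1 - l) * mdist X x q \<le> mdist X x q"
          using l by (auto intro: mult_left_le_one_le)
        then have "mdist X z (G x l) \<le> \<eta> n"
          using thin[OF G(1)[OF xB] z(1), of l] G(2,3)[OF xB] z xi' dist[OF xB] l R by auto
        then have "mdist X (f x) z < 2 * \<eta> n" using \<eta>(1)[of n] xB by (simp add: f_def mdist_commute)
        then show "z \<in> C n" using x z fX by (auto simp: C_def)
      qed
    qed
    have "(\<lambda>n. measure m (C n)) \<longlonglongrightarrow> measure m (\<Inter>n. C n)"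
    proof (rule Lim_measure_decseq)
      show "range C \<subseteq> sets m" using Cm by auto
      show "decseq C"
      proof (rule antimonoI)
        fix a b :: nat assume "a \<le> b"
        then have "2 * \<eta> b \<le> 2 * \<eta> a" using r by (simp add: \<eta>_def field_simps)
        then show "C b \<subseteq> C a" unfolding C_def by (intro UN_mono mball_of_mono order_refl)
      qed
    qed (use Cfin in \<open>simp add: less_top\<close>)
    moreover have "(\<Inter>n. C n) = F"
      unfolding C_def using \<eta> \<eta>0 F by (intro closedin_neighbourhoods_Inter) auto
    ultimately show ?thesis using le by (intro LIMSEQ_le_const[of "\<lambda>n. measure m (C n)"]) auto
  qed
  have c: "0 \<le> c" "c \<le> 1" using l N by (auto simp: c_def intro!: powr_le1)
  have B'fin: "emeasure m B' < \<infinity>"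
  proof -
    have "emeasure m B' \<le> emeasure m (mcball_of X p' (2 * r))"
      unfolding B'_def using r by (intro emeasure_mono) auto
    then show ?thesis using fin(2) by (simp add: p'_def)
  qed
  have "c * measure m (f -` V \<inter> B) \<le> measure m (V \<inter> B')" if V: "V \<in> sets m" for V
  proof (rule field_le_epsilon)
    fix d :: real assume "d > 0"
    \<comment> \<open>Regularity is used for the push-forward, not for \<open>m\<close>: it is
      finite, and the part of the preimage lost by passing to a closed subset is what must be
      small.\<close>
    define \<nu> where "\<nu> = distr (restrict_space m B) (metric_borel X) f"
    have fr: "f \<in> restrict_space m B \<rightarrow>\<^sub>M metric_borel X"
      using f_restr by (simp add: sets_eq cong: measurable_cong_sets sets_restrict_space_cong)
    have \<nu>: "emeasure \<nu> U = emeasure m (f -` U \<inter> B)" if "U \<in> sets m" for U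
    proof -
      have "space (restrict_space m B) = B" by (auto simp: space_restrict_space B_def)
      then have "emeasure \<nu> U = emeasure (restrict_space m B) (f -` U \<inter> B)"
        unfolding \<nu>_def using that fr sets_eq by (subst emeasure_distr) auto
      then show ?thesis using Bm by (subst (asm) emeasure_restrict_space) (auto simp del: space_eq)
    qed
    have \<nu>fin: "finite_measure \<nu>"
    proof (rule finite_measureI)
      have "emeasure \<nu> (space \<nu>) \<le> emeasure m B"
        using \<nu>[of "mspace X"] Bm sets.top[of m] by (auto simp: \<nu>_def intro!: emeasure_mono)
      then show "emeasure \<nu> (space \<nu>) \<noteq> \<infinity>" using Bfin by auto
    qed
    then interpret \<nu>: finite_measure \<nu> .
    define V' where "V' = V \<inter> B'"
    have V': "V' \<in> sets m" using V Bm by (simp add: V'_def)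
    obtain F where F: "closedin (mtopology_of X) F" "F \<subseteq> V'" "measure \<nu> (V' - F) < d"
      using metric_borel_regular[OF \<nu>fin, of X V'] V' \<open>d > 0\<close> sets_eq by (auto simp: \<nu>_def)
    have Fm: "F \<in> sets m" using F closed_sets by blast
    have eq: "measure m (f -` U \<inter> B) = measure \<nu> U" if "U \<in> sets m" for U
      using \<nu>[OF that] by (simp add: measure_def)
    have "measure m (f -` V \<inter> B) = measure m (f -` V' \<inter> B)"
      using fB by (intro arg_cong[where f = "measure m"]) (auto simp: V'_def)
    also have "\<dots> = measure \<nu> V'" using V' by (rule eq)
    also have "\<dots> = measure \<nu> F + measure \<nu> (V' - F)"
    proof -
      have "V' = F \<union> (V' - F)" using F by blast
      then show ?thesis using Fm V' sets_eq \<nu>.finite_measure_Union[of F "V' - F"] by (auto simp: \<nu>_def)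
    qed
    also have "\<dots> \<le> measure \<nu> F + d" using F by simp
    finally have "c * measure m (f -` V \<inter> B) \<le> c * (measure \<nu> F + d)" using c by (intro mult_left_mono)
    also have "\<dots> \<le> c * measure m (f -` F \<inter> B) + d"
      using c \<open>d > 0\<close> by (simp add: eq[OF Fm] distrib_left mult_left_le_one_le)
    also have "c * measure m (f -` F \<inter> B) \<le> measure m F" using F by (intro closed_case) (auto simp: V'_def)
    also have "measure m F \<le> measure m V'"
    proof -
      have "emeasure m V' \<le> emeasure m B'" using Bm by (intro emeasure_mono) (auto simp: V'_def)
      then have "emeasure m V' < \<infinity>" using B'fin by auto
      then show ?thesis using F V' Fm by (intro measure_mono_fmeasurable) (auto simp: fmeasurable_def)
    qed
    finally show "c * measure m (f -` V \<inter> B) \<le> measure m (V \<inter> B') + d" by (simp add: V'_def)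
  qed
  then have "ball_contraction X m c B B' f"
    unfolding ball_contraction_def using fm fB lip by blast
  then show ?thesis unfolding c_def B_def B'_def p_def p'_def by blast
qed

text \<open>Around a boundary point \<open>x\<close> a ball may leave the ball of centre
  \<open>p\<close>. Hence the contraction aims at the point \<open>y\<close> at fraction
  \<open>s\<close> of the geodesic from \<open>x\<close> to \<open>p\<close>: the ball of radius
  \<open>s * r\<close> around \<open>y\<close> lies in both sets on the right.\<close>

lemma ball_volume:
  assumes r: "r > 0" "2 * r \<le> R" and x: "x \<in> mcball_of X p r" and s: "0 < s" "s \<le> 1"
    and fin: "emeasure m (mcball_of X p r) < \<infinity>"
  shows "(s / 3) powr (2 * (N + 1)) * measure m (mcball_of X p r)
    \<le> measure m (mcball_of X p r \<inter> mcball_of X x (2 * s * r))"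
proof -
  have xp: "x \<in> mspace X" "p \<in> mspace X" "mdist X x p \<le> r" using x by (auto simp: mdist_commute)
  obtain g where g: "is_geodesic X g" "g 0 = x" "g 1 = p"
    using CAT_geodesic[OF cat small\<kappa> xp(1,2)] xp(3) r by auto
  define y where "y = g s"
  have y: "y \<in> mspace X" using s by (auto simp: y_def intro!: geodesic_in_mspace[OF g(1)])
  have "mdist X (g 0) (g s) = \<bar>0 - s\<bar> * mdist X (g 0) (g 1)" "mdist X (g s) (g 1) = \<bar>s - 1\<bar> * mdist X (g 0) (g 1)"
    using s geodesic_dist[OF g(1), of 0 s] geodesic_dist[OF g(1), of s 1] by simp_all
  then have "mdist X x y = s * mdist X x p" "mdist X y p = (1 - s) * mdist X x p"
    using s by (simp_all add: y_def g)
  then have yd: "mdist X x y \<le> s * r" "mdist X y p \<le> (1 - s) * r"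
    using s xp by (auto intro!: mult_left_mono)
  have sr: "0 < s * r" "s * r \<le> r" using s r by (auto intro: mult_left_le_one_le)
  \<comment> \<open>Points of the large ball are within \<open>2 * r\<close> of \<open>y\<close>.
    Keeping the fraction \<open>s / 3\<close> of that distance leaves \<open>s * r / 3\<close> of
    the target radius as tolerance.\<close>
  have "(1 - (1 - s / 3)) powr (2 * (N + 1)) * measure m (mcball_of X p r) \<le> measure m (mcball_of X y (s * r))"
  proof (rule measure_contraction[OF y _ fin])
    show "emeasure m (mcball_of X y (s * r)) < \<infinity>"
    proof (rule le_less_trans[OF emeasure_mono fin])
      show "mcball_of X y (s * r) \<subseteq> mcball_of X p r"
      proof
        fix z assume z: "z \<in> mcball_of X y (s * r)"
        then have "mdist X p z \<le> mdist X p y + mdist X y z" using xp y by (intro mdist_triangle) auto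
        then show "z \<in> mcball_of X p r" using z xp yd by (auto simp: mdist_commute algebra_simps)
      qed
    qed simp
    show "mcball_of X p r \<subseteq> mcball_of X y R"
    proof
      fix z assume z: "z \<in> mcball_of X p r"
      then have "mdist X y z \<le> mdist X y p + mdist X p z" using xp y by (intro mdist_triangle) auto
      then show "z \<in> mcball_of X y R" using z xp y yd r sr by (auto simp: algebra_simps)
    qed
    show "0 < s * r / 3" using sr by simp
    show "0 < 1 - s / 3" "1 - s / 3 < 1" using s by auto
    fix a z assume a: "a \<in> mcball_of X p r" and z: "z \<in> mspace X" "mdist X z y \<le> (1 - (1 - s / 3)) * mdist X a y + s * r / 3"
    have "mdist X a y \<le> mdist X a p + mdist X p y" using a xp y by (intro mdist_triangle) auto
    then have "mdist X a y \<le> 2 * r" using a yd sr by (auto simp: mdist_commute algebra_simps)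
    then have "s / 3 * mdist X a y \<le> s / 3 * (2 * r)" using s by (intro mult_left_mono) auto
    then show "z \<in> mcball_of X y (s * r)" using z y by (simp add: mdist_commute)
  qed auto
  also have "\<dots> \<le> measure m (mcball_of X p r \<inter> mcball_of X x (2 * s * r))"
  proof (rule measure_mono_fmeasurable)
    show "mcball_of X y (s * r) \<subseteq> mcball_of X p r \<inter> mcball_of X x (2 * s * r)"
    proof
      fix z assume z: "z \<in> mcball_of X y (s * r)"
      then have "mdist X p z \<le> mdist X p y + mdist X y z" "mdist X x z \<le> mdist X x y + mdist X y z"
        using xp y by (auto intro!: mdist_triangle)
      then show "z \<in> mcball_of X p r \<inter> mcball_of X x (2 * s * r)"
        using z xp yd by (auto simp: mdist_commute algebra_simps)
    qed
    have "emeasure m (mcball_of X p r \<inter> mcball_of X x (2 * s * r)) < \<infinity>"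
      by (rule le_less_trans[OF emeasure_mono fin]) auto
    then show "mcball_of X p r \<inter> mcball_of X x (2 * s * r) \<in> fmeasurable m"
      by (auto simp: fmeasurable_def)
  qed auto
  finally show ?thesis by simp
qed

end

section \<open>Self-maps that almost preserve the measure\<close>

lemma nn_integral_le_of_measure_le:
  assumes "sets \<nu> = sets \<mu>" and le: "\<And>V. V \<in> sets \<mu> \<Longrightarrow> emeasure \<nu> V \<le> Q * emeasure \<mu> V"
    and g: "g \<in> borel_measurable \<mu>"
  shows "nn_integral \<nu> g \<le> Q * nn_integral \<mu> g"
proof -
  have "\<nu> \<le> scale_measure Q \<mu>"
    using assms(1) le sets_eq_imp_space_eq[OF assms(1)] by (auto simp: le_measure emeasure_scale_measure)
  then have "nn_integral \<nu> g \<le> nn_integral (scale_measure Q \<mu>) g"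
    using assms(1) by (intro nn_integral_mono_measure) auto
  also have "\<dots> = Q * nn_integral \<mu> g" using g by (rule nn_integral_scale_measure)
  finally show ?thesis .
qed

context metric_measure_space
begin

text \<open>The factor \<open>1 / (c * a)\<close> has two origins: \<open>c\<close> is the loss of
  measure under \<open>f\<close>, and \<open>a\<close> compares the two normalizing
  constants.\<close>

lemma uniform_measure_pullback_le:
  assumes B: "B \<in> sets m" "0 < emeasure m B" "emeasure m B < \<infinity>"
    and B': "B' \<in> sets m" "0 < emeasure m B'" "emeasure m B' < \<infinity>"
    and f: "ball_contraction X m c B B' f" and c: "0 < c" and a: "a > 0" "a * measure m B' \<le> measure m B"
    and V: "V \<in> sets m"
  shows "emeasure (distr (uniform_measure m B) (metric_borel X) f) V
    \<le> ennreal (1 / (c * a)) * emeasure (uniform_measure m B') V"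
proof -
  define M M' where "M = measure m B" and "M' = measure m B'"
  have eM: "emeasure m B = ennreal M" "emeasure m B' = ennreal M'"
    using B B' by (simp_all add: M_def M'_def emeasure_eq_ennreal_measure less_top)
  have pos: "M > 0" "M' > 0" using B B' unfolding eM by auto
  have f_meas: "f \<in> metric_borel X \<rightarrow>\<^sub>M metric_borel X"
    and le: "c * measure m (f -` V \<inter> B) \<le> measure m (V \<inter> B')"
    using f V by (auto simp: ball_contraction_def)
  have f_m: "f \<in> m \<rightarrow>\<^sub>M metric_borel X" using f_meas by (simp cong: measurable_cong_sets add: sets_eq)
  have pre: "f -` V \<inter> space m \<in> sets m" using measurable_sets[OF f_m, of V] V sets_eq by simp
  have BX: "B \<inter> (f -` V \<inter> space m) = f -` V \<inter> B" using sets.sets_into_space[OF B(1)] by blast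
  have fin: "emeasure m (f -` V \<inter> B) < \<infinity>" "emeasure m (V \<inter> B') < \<infinity>"
  proof -
    show "emeasure m (f -` V \<inter> B) < \<infinity>" by (rule le_less_trans[OF emeasure_mono B(3)]) (use B in auto)
    show "emeasure m (V \<inter> B') < \<infinity>" by (rule le_less_trans[OF emeasure_mono B'(3)]) (use B' in auto)
  qed
  have "f \<in> uniform_measure m B \<rightarrow>\<^sub>M metric_borel X" using f_m by (simp cong: measurable_cong_sets)
  then have "emeasure (distr (uniform_measure m B) (metric_borel X) f) V = emeasure (uniform_measure m B) (f -` V \<inter> space m)"
    using V sets_eq by (subst emeasure_distr) auto
  also have "\<dots> = emeasure m (f -` V \<inter> B) / emeasure m B" using B pre by (simp add: BX del: space_eq)
  also have "\<dots> = ennreal (measure m (f -` V \<inter> B) / M)"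
    using fin pos by (simp add: eM emeasure_eq_ennreal_measure less_top divide_ennreal)
  also have "\<dots> \<le> ennreal (1 / (c * a) * (measure m (V \<inter> B') / M'))"
  proof (rule ennreal_leI)
    have "measure m (f -` V \<inter> B) / M \<le> measure m (V \<inter> B') / c / M"
      using le c pos by (intro divide_right_mono) (auto simp: field_simps)
    also have "\<dots> \<le> measure m (V \<inter> B') / c / (a * M')"
      using a pos c unfolding M_def[symmetric] M'_def[symmetric] by (intro divide_left_mono) auto
    finally show "measure m (f -` V \<inter> B) / M \<le> 1 / (c * a) * (measure m (V \<inter> B') / M')" by simp
  qed
  also have "\<dots> = ennreal (1 / (c * a)) * ennreal (measure m (V \<inter> B') / M')"
    using c a pos by (intro ennreal_mult) auto
  also have "ennreal (measure m (V \<inter> B') / M') = emeasure (uniform_measure m B') V"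
    using B' V fin pos unfolding M'_def
    by (simp add: emeasure_eq_ennreal_measure less_top divide_ennreal Int_commute)
  finally show ?thesis .
qed

text \<open>A self-map that neither increases distances nor, up to a factor, decreases measure can lose
  only little of the average distance \<open>\<integral>\<integral> d(x,y)\<close>, hence, as small balls have a definite
  proportion of the volume, little of any single distance.\<close>

lemma ball_contraction_almost_isometric:
  assumes p: "p \<in> mspace X" and r: "r > 0" and B_def: "B = mcball_of X p r"
    and mB: "0 < emeasure m B" "emeasure m B < \<infinity>"
    and h: "ball_contraction X m c B B h" and c: "0 < c" and "\<epsilon> > 0" and v: "v > 0"
    and vol: "\<And>x. x \<in> B \<Longrightarrow> v * measure m B \<le> measure m (B \<inter> mcball_of X x (\<epsilon> * r / 8))"
    and gap: "2 * (1 / c\<^sup>2 - 1) < \<epsilon> / 2 * v\<^sup>2"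
    and xy: "x0 \<in> B" "y0 \<in> B"
  shows "mdist X x0 y0 - \<epsilon> * r \<le> mdist X (h x0) (h y0)"
proof (rule ccontr)
  assume "\<not> ?thesis"
  then have bad: "mdist X (h x0) (h y0) < mdist X x0 y0 - \<epsilon> * r" by simp
  define \<mu> where "\<mu> = uniform_measure m B"
  have Bm: "B \<in> sets m" by (simp add: B_def)
  interpret \<mu>: prob_space \<mu> unfolding \<mu>_def using mB by (intro prob_space_uniform_measure) auto
  have s\<mu>: "sets \<mu> = sets (metric_borel X)" by (simp add: \<mu>_def sets_eq)
  note [measurable_cong] = s\<mu>
  have sp\<mu>: "space \<mu> = mspace X" by (simp add: \<mu>_def)
  have AEB: "AE x in \<mu>. x \<in> B" unfolding \<mu>_def using Bm by (intro AE_uniform_measureI) auto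
  define M where "M = measure m B"
  have eM: "emeasure m B = ennreal M" using mB by (simp add: M_def emeasure_eq_ennreal_measure less_top)
  have "M > 0" using mB unfolding eM by auto
  have h_meas [measurable]: "h \<in> metric_borel X \<rightarrow>\<^sub>M metric_borel X" and hB: "\<And>x. x \<in> B \<Longrightarrow> h x \<in> B"
    and hlip: "\<And>x y. x \<in> B \<Longrightarrow> y \<in> B \<Longrightarrow> mdist X (h x) (h y) \<le> mdist X x y"
    using h by (auto simp: ball_contraction_def)
  have BX: "x \<in> mspace X" if "x \<in> B" for x using that by (simp add: B_def)
  have diam: "mdist X x y \<le> 2 * r" if "x \<in> B" "y \<in> B" for x y
    using mdist_triangle[of x X p y] that p by (auto simp: B_def mdist_commute)
  define \<nu> where "\<nu> = distr \<mu> (metric_borel X) h"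
  have \<nu>_le: "nn_integral \<nu> g \<le> ennreal (1 / c) * nn_integral \<mu> g" if "g \<in> borel_measurable (metric_borel X)" for g
  proof (rule nn_integral_le_of_measure_le)
    show "emeasure \<nu> V \<le> ennreal (1 / c) * emeasure \<mu> V" if "V \<in> sets \<mu>" for V
      using uniform_measure_pullback_le[OF Bm mB Bm mB h c, of 1 V] that s\<mu> sets_eq by (simp add: \<nu>_def \<mu>_def)
  qed (use that in \<open>auto simp: \<nu>_def s\<mu>\<close>)
  interpret \<nu>: prob_space \<nu> unfolding \<nu>_def by (rule \<mu>.prob_space_distr) measurable
  have s\<nu> [measurable_cong]: "sets \<nu> = sets (metric_borel X)" by (simp add: \<nu>_def)
  \<comment> \<open>The push-forward is bounded above by \<mu>, which is useful for nonnegative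
    functions that grow under \<open>h\<close>. The distance shrinks, so its complement to the
    diameter bound \<open>2 * r\<close> is integrated instead.\<close>
  define G where "G x y = ennreal (2 * r - mdist X x y)" for x y
  have G_meas [measurable]: "(\<lambda>x. G (f x) (g x)) \<in> borel_measurable Z"
    if [measurable]: "f \<in> Z \<rightarrow>\<^sub>M metric_borel X" "g \<in> Z \<rightarrow>\<^sub>M metric_borel X" for f g and Z :: "'z measure"
    unfolding G_def by measurable
  have G_meas2: "(\<lambda>p. G (fst p) (snd p)) \<in> borel_measurable (metric_borel X \<Otimes>\<^sub>M \<mu>)"
    "(\<lambda>p. G (fst p) (snd p)) \<in> borel_measurable (metric_borel X \<Otimes>\<^sub>M \<nu>)"
    unfolding G_def by measurable
  have G_meas1: "G x \<in> borel_measurable (metric_borel X)" if "x \<in> mspace X" for x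
    unfolding G_def using that by measurable
  have G\<mu>: "(\<lambda>x. \<integral>\<^sup>+y. G x y \<partial>\<mu>) \<in> borel_measurable (metric_borel X)"
    using \<mu>.borel_measurable_nn_integral_fst[OF G_meas2(1)] by simp
  have G\<nu>: "(\<lambda>x. \<integral>\<^sup>+y. G x y \<partial>\<nu>) \<in> borel_measurable (metric_borel X)"
    using \<nu>.borel_measurable_nn_integral_fst[OF G_meas2(2)] by simp
  define E where "E = (\<integral>\<^sup>+x. \<integral>\<^sup>+y. G x y \<partial>\<mu> \<partial>\<mu>)"
  have "(\<integral>\<^sup>+x. \<integral>\<^sup>+y. G (h x) (h y) \<partial>\<mu> \<partial>\<mu>) = (\<integral>\<^sup>+x. \<integral>\<^sup>+y. G (h x) y \<partial>\<nu> \<partial>\<mu>)"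
  proof (rule nn_integral_cong)
    fix x assume "x \<in> space \<mu>"
    then have "h x \<in> mspace X" using measurable_space[OF h_meas] sp\<mu> by simp
    then show "(\<integral>\<^sup>+y. G (h x) (h y) \<partial>\<mu>) = (\<integral>\<^sup>+y. G (h x) y \<partial>\<nu>)"
      unfolding \<nu>_def using G_meas1 by (subst nn_integral_distr) auto
  qed
  also have "\<dots> = (\<integral>\<^sup>+x. \<integral>\<^sup>+y. G x y \<partial>\<nu> \<partial>\<nu>)"
    using G\<nu> by (subst (2) \<nu>_def, subst nn_integral_distr) (auto simp: \<nu>_def)
  also have "\<dots> \<le> ennreal (1 / c) * (\<integral>\<^sup>+x. \<integral>\<^sup>+y. G x y \<partial>\<nu> \<partial>\<mu>)" by (rule \<nu>_le[OF G\<nu>])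
  also have "\<dots> \<le> ennreal (1 / c) * (\<integral>\<^sup>+x. ennreal (1 / c) * (\<integral>\<^sup>+y. G x y \<partial>\<mu>) \<partial>\<mu>)"
    using \<nu>_le G_meas1 by (intro mult_left_mono nn_integral_mono) (auto simp: sp\<mu>)
  also have "\<dots> = ennreal (1 / c) * (ennreal (1 / c) * E)"
    unfolding E_def using G\<mu> by (subst nn_integral_cmult) auto
  also have "\<dots> = ennreal (1 / c\<^sup>2) * E"
    using c by (simp add: power2_eq_square mult.assoc[symmetric] flip: ennreal_mult)
  finally have up: "(\<integral>\<^sup>+x. \<integral>\<^sup>+y. G (h x) (h y) \<partial>\<mu> \<partial>\<mu>) \<le> ennreal (1 / c\<^sup>2) * E" .
  \<comment> \<open>Replacing \<open>x0\<close>, \<open>y0\<close> by points of these sets changes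
    the distance, and the distance of the images, by at most \<open>\<epsilon> * r / 4\<close> each.
    Half of the assumed defect survives.\<close>
  define U V where "U = B \<inter> mcball_of X x0 (\<epsilon> * r / 8)" and "V = B \<inter> mcball_of X y0 (\<epsilon> * r / 8)"
  have UVm: "U \<in> sets m" "V \<in> sets m" using Bm by (auto simp: U_def V_def)
  then have [measurable]: "U \<in> sets (metric_borel X)" "V \<in> sets (metric_borel X)" using sets_eq by auto
  have ev: "ennreal v \<le> emeasure \<mu> W" if "x \<in> B" "W = B \<inter> mcball_of X x (\<epsilon> * r / 8)" for x W
  proof -
    have W: "W \<in> sets m" "W \<subseteq> B" using that Bm by auto
    have "emeasure m W < \<infinity>" by (rule le_less_trans[OF emeasure_mono mB(2)]) (use W Bm in auto)
    then have "emeasure \<mu> W = ennreal (measure m W / M)"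
      using W Bm mB(2) \<open>M > 0\<close> unfolding \<mu>_def M_def
      by (simp add: emeasure_eq_ennreal_measure less_top divide_ennreal Int_absorb1)
    moreover have "v \<le> measure m W / M" using vol[OF that(1)] that(2) \<open>M > 0\<close> by (simp add: M_def field_simps)
    ultimately show ?thesis by (simp add: ennreal_leI)
  qed
  have pt: "G x y + ennreal (\<epsilon> * r / 2) * (indicator U x * indicator V y) \<le> G (h x) (h y)" if "x \<in> B" "y \<in> B" for x y
  proof (cases "x \<in> U \<and> y \<in> V")
    case True
    have 1: "mdist X x0 x \<le> \<epsilon> * r / 8" "mdist X y0 y \<le> \<epsilon> * r / 8" using True by (auto simp: U_def V_def)
    have "mdist X (h x) (h y) \<le> mdist X (h x) (h x0) + mdist X (h x0) (h y)"
      "mdist X (h x0) (h y) \<le> mdist X (h x0) (h y0) + mdist X (h y0) (h y)"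
      using that xy by (auto intro!: mdist_triangle BX hB)
    moreover have "mdist X (h x) (h x0) \<le> \<epsilon> * r / 8" "mdist X (h y0) (h y) \<le> \<epsilon> * r / 8"
      using hlip[OF that(1) xy(1)] hlip[OF xy(2) that(2)] 1 by (simp_all add: mdist_commute[of X x])
    moreover have "mdist X x0 y0 \<le> mdist X x0 x + mdist X x y0" "mdist X x y0 \<le> mdist X x y + mdist X y y0"
      using that xy by (auto intro!: mdist_triangle BX)
    ultimately have "mdist X (h x) (h y) \<le> mdist X x y - \<epsilon> * r / 2"
      using bad 1 by (simp add: mdist_commute[of X y])
    then have "ennreal ((2 * r - mdist X x y) + \<epsilon> * r / 2) \<le> G (h x) (h y)"
      unfolding G_def by (intro ennreal_leI) simp
    then show ?thesis using True diam[OF that] \<open>\<epsilon> > 0\<close> r by (simp add: G_def ennreal_plus)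
  next
    case False
    then have "indicator U x * indicator V y = (0 :: ennreal)" by (auto simp: indicator_def)
    then have "ennreal (\<epsilon> * r / 2) * (indicator U x * indicator V y) = 0" by (simp only: mult_zero_right)
    then show ?thesis using hlip[OF that] by (simp only: G_def add_0_right) (simp add: ennreal_leI)
  qed
  have "E + ennreal (\<epsilon> * r / 2 * v\<^sup>2) \<le> E + ennreal (\<epsilon> * r / 2) * (emeasure \<mu> U * emeasure \<mu> V)"
  proof -
    have "ennreal (\<epsilon> * r / 2 * v\<^sup>2) = ennreal (\<epsilon> * r / 2) * (ennreal v * ennreal v)"
      using v r \<open>\<epsilon> > 0\<close> by (simp add: power2_eq_square flip: ennreal_mult)
    also have "\<dots> \<le> ennreal (\<epsilon> * r / 2) * (emeasure \<mu> U * emeasure \<mu> V)"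
      using ev[OF xy(1) U_def] ev[OF xy(2) V_def] by (intro mult_left_mono mult_mono) auto
    finally show ?thesis by (rule add_left_mono)
  qed
  also have "\<dots> = (\<integral>\<^sup>+x. \<integral>\<^sup>+y. G x y + ennreal (\<epsilon> * r / 2) * (indicator U x * indicator V y) \<partial>\<mu> \<partial>\<mu>)"
  proof -
    have "(\<integral>\<^sup>+y. G x y + ennreal (\<epsilon> * r / 2) * (indicator U x * indicator V y) \<partial>\<mu>)
        = (\<integral>\<^sup>+y. G x y \<partial>\<mu>) + ennreal (\<epsilon> * r / 2) * (indicator U x * emeasure \<mu> V)" if "x \<in> space \<mu>" for x
      using G_meas1[of x] that by (subst nn_integral_add) (auto simp: nn_integral_cmult sp\<mu>)
    then have "(\<integral>\<^sup>+x. \<integral>\<^sup>+y. G x y + ennreal (\<epsilon> * r / 2) * (indicator U x * indicator V y) \<partial>\<mu> \<partial>\<mu>)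
       = (\<integral>\<^sup>+x. (\<integral>\<^sup>+y. G x y \<partial>\<mu>) + ennreal (\<epsilon> * r / 2) * (indicator U x * emeasure \<mu> V) \<partial>\<mu>)"
      by (rule nn_integral_cong)
    also have "\<dots> = E + ennreal (\<epsilon> * r / 2) * (emeasure \<mu> U * emeasure \<mu> V)"
      using G\<mu> by (subst nn_integral_add) (auto simp: nn_integral_cmult nn_integral_multc E_def)
    finally show ?thesis by simp
  qed
  also have "\<dots> \<le> (\<integral>\<^sup>+x. \<integral>\<^sup>+y. G (h x) (h y) \<partial>\<mu> \<partial>\<mu>)"
  proof (rule nn_integral_mono_AE)
    show "AE x in \<mu>. (\<integral>\<^sup>+y. G x y + ennreal (\<epsilon> * r / 2) * (indicator U x * indicator V y) \<partial>\<mu>) \<le> (\<integral>\<^sup>+y. G (h x) (h y) \<partial>\<mu>)"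
      using AEB
    proof eventually_elim
      case (elim x)
      show ?case by (rule nn_integral_mono_AE) (use AEB in eventually_elim, rule pt[OF elim])
    qed
  qed
  finally have lo: "E + ennreal (\<epsilon> * r / 2 * v\<^sup>2) \<le> ennreal (1 / c\<^sup>2) * E" using up by simp
  \<comment> \<open>With total at most \<open>2 * r\<close>, the factor \<open>1 / c\<^sup>2\<close>
    permits a gain of at most \<open>2 * r * (1 / c\<^sup>2 - 1)\<close>, less than the gain forced
    by \<open>U\<close> and \<open>V\<close>.\<close>
  have "E \<le> (\<integral>\<^sup>+x. \<integral>\<^sup>+y. ennreal (2 * r) \<partial>\<mu> \<partial>\<mu>)"
    unfolding E_def G_def by (intro nn_integral_mono ennreal_leI) simp
  then have Ele: "E \<le> ennreal (2 * r)" by (simp add: \<mu>.emeasure_space_1)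
  then have "E < \<infinity>" by (rule le_less_trans) simp
  then obtain e where e: "E = ennreal e" "0 \<le> e" by (cases E) auto
  have "e + \<epsilon> * r / 2 * v\<^sup>2 \<le> 1 / c\<^sup>2 * e"
    using lo e c r \<open>\<epsilon> > 0\<close> by (simp flip: ennreal_mult ennreal_plus)
  then have 1: "\<epsilon> * r / 2 * v\<^sup>2 \<le> (1 / c\<^sup>2 - 1) * e" by (simp add: algebra_simps)
  also have "\<dots> \<le> (1 / c\<^sup>2 - 1) * (2 * r)"
  proof (rule mult_left_mono)
    show "e \<le> 2 * r" using Ele e r by simp
    have "0 < \<epsilon> * r / 2 * v\<^sup>2" using \<open>\<epsilon> > 0\<close> r v by simp
    then have "0 < (1 / c\<^sup>2 - 1) * e" using 1 by linarith
    then show "0 \<le> 1 / c\<^sup>2 - 1" using e by (simp add: zero_less_mult_iff)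
  qed
  finally have "r * (\<epsilon> / 2 * v\<^sup>2) \<le> r * (2 * (1 / c\<^sup>2 - 1))" by (simp add: algebra_simps)
  then show False using gap r by simp
qed

end

section \<open>The transport distance of two balls\<close>

text \<open>A discrete mapping cylinder: each \<open>x\<close> is joined to \<open>f x\<close> by a
  bridge of length \<epsilon>.\<close>

fun glued_dist :: "'a metric \<Rightarrow> 'b metric \<Rightarrow> ('a \<Rightarrow> 'b) \<Rightarrow> real \<Rightarrow> 'a + 'b \<Rightarrow> 'a + 'b \<Rightarrow> real" where
  "glued_dist Y Z f \<epsilon> (Inl x) (Inl y) = mdist Y x y"
| "glued_dist Y Z f \<epsilon> (Inr x) (Inr y) = mdist Z x y"
| "glued_dist Y Z f \<epsilon> (Inl x) (Inr y) = mdist Z (f x) y + \<epsilon>"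
| "glued_dist Y Z f \<epsilon> (Inr y) (Inl x) = mdist Z (f x) y + \<epsilon>"

definition glued_metric :: "'a metric \<Rightarrow> 'b metric \<Rightarrow> ('a \<Rightarrow> 'b) \<Rightarrow> real \<Rightarrow> ('a + 'b) metric" where
  "glued_metric Y Z f \<epsilon> = metric (mspace Y <+> mspace Z, glued_dist Y Z f \<epsilon>)"

text \<open>\<open>up\<close> serves a path that starts with a step inside \<open>Y\<close> and then
  crosses a bridge, \<open>lo\<close> a path that leaves \<open>Y\<close> and returns. Positivity of
  \<epsilon> separates \<open>x\<close> from \<open>f x\<close>.\<close>

lemma glued_metric:
  fixes Y :: "'a metric" and Z :: "'b metric"
  assumes f: "f ` mspace Y \<subseteq> mspace Z" and "\<epsilon> > 0"
    and up: "\<And>x y. x \<in> mspace Y \<Longrightarrow> y \<in> mspace Y \<Longrightarrow> mdist Z (f x) (f y) \<le> mdist Y x y"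
    and lo: "\<And>x y. x \<in> mspace Y \<Longrightarrow> y \<in> mspace Y \<Longrightarrow> mdist Y x y - \<epsilon> \<le> mdist Z (f x) (f y)"
  shows "mspace (glued_metric Y Z f \<epsilon>) = mspace Y <+> mspace Z"
    and "mdist (glued_metric Y Z f \<epsilon>) = glued_dist Y Z f \<epsilon>"
proof -
  interpret Metric_space "mspace Y <+> mspace Z" "glued_dist Y Z f \<epsilon>"
  proof
    fix u v :: "'a + 'b"
    show "0 \<le> glued_dist Y Z f \<epsilon> u v" using \<open>\<epsilon> > 0\<close> by (cases u; cases v) auto
    show "glued_dist Y Z f \<epsilon> u v = glued_dist Y Z f \<epsilon> v u" by (cases u; cases v) (auto simp: mdist_commute)
    assume u: "u \<in> mspace Y <+> mspace Z" and v: "v \<in> mspace Y <+> mspace Z"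
    have pos: "mdist Z a b + \<epsilon> \<noteq> 0" for a b using \<open>\<epsilon> > 0\<close> mdist_nonneg[of Z a b] by linarith
    show "(glued_dist Y Z f \<epsilon> u v = 0) = (u = v)" using u v pos by (cases u; cases v) auto
    fix w assume w: "w \<in> mspace Y <+> mspace Z"
    have fm: "f x \<in> mspace Z" if "x \<in> mspace Y" for x using f that by blast
    have t: "mdist Z a c \<le> mdist Z a b + mdist Z b c" "mdist Z a c \<le> mdist Z a b + mdist Z c b"
      "mdist Z a c \<le> mdist Z b a + mdist Z b c" "mdist Z a c \<le> mdist Z b a + mdist Z c b"
      if "a \<in> mspace Z" "b \<in> mspace Z" "c \<in> mspace Z" for a b c
      using mdist_triangle[OF that] by (simp_all add: mdist_commute)
    show "glued_dist Y Z f \<epsilon> u w \<le> glued_dist Y Z f \<epsilon> u v + glued_dist Y Z f \<epsilon> v w"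
    proof (cases u; cases v; cases w)
      fix x y z assume U: "u = Inl x" and V: "v = Inl y" and W: "w = Inr z"
      then show ?thesis using u v w t(1)[of "f x" "f y" z] up[of x y] fm by auto
    next
      fix x y z assume U: "u = Inl x" and V: "v = Inr y" and W: "w = Inl z"
      then show ?thesis using u v w t(2)[of "f x" y "f z"] lo[of x z] fm \<open>\<epsilon> > 0\<close> by auto
    next
      fix x y z assume U: "u = Inl x" and V: "v = Inr y" and W: "w = Inr z"
      then show ?thesis using u v w t(1)[of "f x" y z] fm by auto
    next
      fix x y z assume U: "u = Inr x" and V: "v = Inl y" and W: "w = Inl z"
      then show ?thesis using u v w t(3)[of "f z" "f y" x] up[of y z] fm by (auto simp: mdist_commute)
    next
      fix x y z assume U: "u = Inr x" and V: "v = Inl y" and W: "w = Inr z"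
      then show ?thesis using u v w t(3)[of x "f y" z] fm \<open>\<epsilon> > 0\<close> by auto
    next
      fix x y z assume U: "u = Inr x" and V: "v = Inr y" and W: "w = Inl z"
      then show ?thesis using u v w t(2)[of "f z" y x] fm by auto
    qed (use u v w in \<open>auto intro: mdist_triangle\<close>)
  qed
  show "mspace (glued_metric Y Z f \<epsilon>) = mspace Y <+> mspace Z"
    "mdist (glued_metric Y Z f \<epsilon>) = glued_dist Y Z f \<epsilon>"
    using mspace_Self mdist_Self by (auto simp: glued_metric_def Self_def)
qed

lemma sum_of_measures:
  assumes "sets P = sets Q"
  shows "\<exists>S. sets S = sets P \<and> (\<forall>A\<in>sets P. emeasure S A = emeasure P A + emeasure Q A)"
proof -
  define S where "S = measure_of (space P) (sets P) (\<lambda>A. emeasure P A + emeasure Q A)"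
  have "emeasure S A = emeasure P A + emeasure Q A" if "A \<in> sets P" for A
    unfolding S_def
  proof (rule emeasure_measure_of_sigma)
    show "sigma_algebra (space P) (sets P)" by (rule sets.sigma_algebra_axioms)
    show "positive (sets P) (\<lambda>A. emeasure P A + emeasure Q A)" by (simp add: positive_def)
    show "countably_additive (sets P) (\<lambda>A. emeasure P A + emeasure Q A)"
    proof (rule countably_additiveI)
      fix F :: "nat \<Rightarrow> 'a set" assume F: "range F \<subseteq> sets P" "disjoint_family F" "(\<Union>i. F i) \<in> sets P"
      have "(\<Sum>i. emeasure P (F i) + emeasure Q (F i)) = (\<Sum>i. emeasure P (F i)) + (\<Sum>i. emeasure Q (F i))"
        by (rule suminf_add[symmetric]) auto
      then show "(\<Sum>i. emeasure P (F i) + emeasure Q (F i)) = emeasure P (\<Union>i. F i) + emeasure Q (\<Union>i. F i)"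
        using F assms by (simp add: suminf_emeasure)
    qed
  qed (fact that)
  moreover have "sets S = sets P" by (simp add: S_def)
  ultimately show ?thesis by blast
qed

lemma ennreal_sqrt_mono: "x \<le> y \<Longrightarrow> ennreal_sqrt x \<le> ennreal_sqrt y"
  by (auto simp: ennreal_sqrt_def less_top intro!: ennreal_leI enn2real_mono)

lemma dense_subset_glued:
  assumes W: "mspace W = mspace Y <+> mspace Z" "mdist W = glued_dist Y Z f \<epsilon>"
    and "dense_subset Y (mspace Y) D" "dense_subset Z (mspace Z) D'"
  shows "dense_subset W (mspace W) (D <+> D')"
  using assms(3,4) unfolding dense_subset_def W
  by (auto simp: Plus_def) (metis glued_dist.simps(1) imageI UnCI, metis glued_dist.simps(2) imageI UnCI)

text \<open>The coupling transports the part \<open>c \<mu>\<close> along \<open>f\<close> and the rest by a product measure.\<close>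

lemma partial_push_coupling:
  assumes \<mu>: "prob_space \<mu>" and \<nu>: "prob_space \<nu>" and f: "f \<in> \<mu> \<rightarrow>\<^sub>M \<nu>" and c: "0 \<le> c" "c \<le> 1"
    and le: "\<And>V. V \<in> sets \<nu> \<Longrightarrow> ennreal c * emeasure (distr \<mu> \<nu> f) V \<le> emeasure \<nu> V"
  shows "\<exists>T. sets T = sets (\<mu> \<Otimes>\<^sub>M \<nu>) \<and> distr T \<mu> fst = \<mu> \<and> distr T \<nu> snd = \<nu> \<and>
    (\<forall>S\<in>sets (\<mu> \<Otimes>\<^sub>M \<nu>). (AE x in \<mu>. (x, f x) \<in> S) \<longrightarrow> emeasure T (space T - S) \<le> ennreal (1 - c))"
proof -
  interpret \<mu>: prob_space \<mu> by fact
  interpret \<nu>: prob_space \<nu> by fact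
  note [measurable] = f
  define g where "g = scale_measure (ennreal c) (distr \<mu> \<nu> f)"
  have sg: "sets g = sets \<nu>" by (simp add: g_def)
  have eg: "emeasure g V = ennreal c * emeasure (distr \<mu> \<nu> f) V" for V by (simp add: g_def)
  interpret fm: prob_space "distr \<mu> \<nu> f" by (rule \<mu>.prob_space_distr[OF f])
  have gle: "emeasure g V \<le> emeasure \<nu> V" if "V \<in> sets \<nu>" for V using le[OF that] eg by simp
  have gfin: "emeasure g V < \<infinity>" if "V \<in> sets \<nu>" for V
    by (rule le_less_trans[OF gle[OF that]]) (simp add: less_top[symmetric])
  \<comment> \<open>The remainder of \<nu> has total mass \<open>1 - c\<close>. Its product with
    \<mu> therefore has first marginal \<open>(1 - c)\<close> times \<mu> and second marginal
    \<beta>, which is what the part along \<open>f\<close> leaves open.\<close>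
  define \<beta> where "\<beta> = diff_measure \<nu> g"
  have s\<beta>: "sets \<beta> = sets \<nu>" by (simp add: \<beta>_def)
  have e\<beta>: "emeasure \<beta> V = emeasure \<nu> V - emeasure g V" if "V \<in> sets \<nu>" for V
    unfolding \<beta>_def
  proof (rule emeasure_diff_measure)
    show "finite_measure \<nu>" by (rule \<nu>.finite_measure_axioms)
    have "space g = space \<nu>" using sets_eq_imp_space_eq[OF sg] .
    then show "finite_measure g" using gfin[of "space \<nu>"] by (intro finite_measureI) auto
  qed (use that sg gle in auto)
  have sp\<beta>: "space \<beta> = space \<nu>" using sets_eq_imp_space_eq[OF s\<beta>] .
  have tot: "emeasure \<beta> (space \<nu>) = ennreal (1 - c)"
  proof -
    have "emeasure (distr \<mu> \<nu> f) (space \<nu>) = 1" using fm.emeasure_space_1 by simp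
    then have "emeasure \<beta> (space \<nu>) = 1 - ennreal c" by (simp add: e\<beta> eg \<nu>.emeasure_space_1)
    then show ?thesis using c by (metis ennreal_1 ennreal_minus)
  qed
  interpret \<beta>: finite_measure \<beta> using tot sp\<beta> by (intro finite_measureI) simp
  define P where "P = scale_measure (ennreal c) (distr \<mu> (\<mu> \<Otimes>\<^sub>M \<nu>) (\<lambda>x. (x, f x)))"
  note [measurable_cong] = s\<beta>
  have sQ: "sets (\<mu> \<Otimes>\<^sub>M \<beta>) = sets (\<mu> \<Otimes>\<^sub>M \<nu>)" by (rule sets_pair_measure_cong) (auto simp: s\<beta>)
  obtain T where T: "sets T = sets (\<mu> \<Otimes>\<^sub>M \<nu>)"
    "\<And>S. S \<in> sets (\<mu> \<Otimes>\<^sub>M \<nu>) \<Longrightarrow> emeasure T S = emeasure P S + emeasure (\<mu> \<Otimes>\<^sub>M \<beta>) S"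
    using sum_of_measures[of P "\<mu> \<Otimes>\<^sub>M \<beta>"] sQ by (auto simp: P_def)
  note [measurable_cong] = T(1)
  have spT: "space T = space \<mu> \<times> space \<nu>" using sets_eq_imp_space_eq[OF T(1)] by (simp add: space_pair_measure)
  have eP: "emeasure P S = ennreal c * emeasure \<mu> {x \<in> space \<mu>. (x, f x) \<in> S}" if "S \<in> sets (\<mu> \<Otimes>\<^sub>M \<nu>)" for S
    using that unfolding P_def by (simp, subst emeasure_distr) (auto intro!: arg_cong[where f = "\<lambda>A. ennreal c * emeasure \<mu> A"])
  have "distr T \<mu> fst = \<mu>"
  proof (rule measure_eqI)
    fix A assume "A \<in> sets (distr T \<mu> fst)"
    then have A [measurable]: "A \<in> sets \<mu>" by simp
    have A': "A \<times> space \<nu> \<in> sets (\<mu> \<Otimes>\<^sub>M \<nu>)" by simp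
    have "emeasure (distr T \<mu> fst) A = emeasure T (A \<times> space \<nu>)"
      using sets.sets_into_space[OF A] by (subst emeasure_distr) (auto simp: spT intro!: arg_cong[where f = "emeasure T"])
    also have "\<dots> = ennreal c * emeasure \<mu> {x \<in> space \<mu>. (x, f x) \<in> A \<times> space \<nu>} + emeasure (\<mu> \<Otimes>\<^sub>M \<beta>) (A \<times> space \<nu>)"
      using T(2)[OF A'] eP[OF A'] by simp
    also have "{x \<in> space \<mu>. (x, f x) \<in> A \<times> space \<nu>} = A"
      using sets.sets_into_space[OF A] measurable_space[OF f] by auto
    also have "emeasure (\<mu> \<Otimes>\<^sub>M \<beta>) (A \<times> space \<nu>) = emeasure \<mu> A * ennreal (1 - c)"
      by (subst \<beta>.emeasure_pair_measure_Times) (auto simp: s\<beta> tot)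
    also have "ennreal c * emeasure \<mu> A + emeasure \<mu> A * ennreal (1 - c) = emeasure \<mu> A * ennreal (c + (1 - c))"
      using c by (subst ennreal_plus) (auto simp: algebra_simps)
    finally show "emeasure (distr T \<mu> fst) A = emeasure \<mu> A" by simp
  qed simp
  moreover have "distr T \<nu> snd = \<nu>"
  proof (rule measure_eqI)
    fix A assume "A \<in> sets (distr T \<nu> snd)"
    then have A [measurable]: "A \<in> sets \<nu>" by simp
    have A': "space \<mu> \<times> A \<in> sets (\<mu> \<Otimes>\<^sub>M \<nu>)" by simp
    have "emeasure (distr T \<nu> snd) A = emeasure T (space \<mu> \<times> A)"
      using sets.sets_into_space[OF A] by (subst emeasure_distr) (auto simp: spT intro!: arg_cong[where f = "emeasure T"])
    also have "\<dots> = ennreal c * emeasure \<mu> {x \<in> space \<mu>. (x, f x) \<in> space \<mu> \<times> A} + emeasure (\<mu> \<Otimes>\<^sub>M \<beta>) (space \<mu> \<times> A)"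
      using T(2)[OF A'] eP[OF A'] by simp
    also have "{x \<in> space \<mu>. (x, f x) \<in> space \<mu> \<times> A} = f -` A \<inter> space \<mu>" by auto
    also have "ennreal c * emeasure \<mu> (f -` A \<inter> space \<mu>) = emeasure g A" by (simp add: eg emeasure_distr)
    also have "emeasure (\<mu> \<Otimes>\<^sub>M \<beta>) (space \<mu> \<times> A) = emeasure \<nu> A - emeasure g A"
      by (subst \<beta>.emeasure_pair_measure_Times) (auto simp: s\<beta> e\<beta> \<mu>.emeasure_space_1)
    also have "emeasure g A + (emeasure \<nu> A - emeasure g A) = emeasure \<nu> A"
      using gle[OF A] gfin[OF A] by (simp add: add_diff_inverse_ennreal less_top)
    finally show "emeasure (distr T \<nu> snd) A = emeasure \<nu> A" .
  qed simp
  moreover have "emeasure T (space T - S) \<le> ennreal (1 - c)"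
    if S [measurable]: "S \<in> sets (\<mu> \<Otimes>\<^sub>M \<nu>)" and AE: "AE x in \<mu>. (x, f x) \<in> S" for S
  proof -
    have S': "space T - S \<in> sets (\<mu> \<Otimes>\<^sub>M \<nu>)" using S T(1) by (metis sets.compl_sets)
    have m1: "{x \<in> space \<mu>. (x, f x) \<in> space T - S} \<in> sets \<mu>"
      using measurable_sets[OF _ S', of "\<lambda>x. (x, f x)" \<mu>] by (simp add: vimage_def Int_def conj_commute)
    have "AE x in \<mu>. \<not> (x, f x) \<in> space T - S" using AE by eventually_elim simp
    then have "emeasure \<mu> {x \<in> space \<mu>. (x, f x) \<in> space T - S} = 0"
      by (subst (asm) AE_iff_measurable[OF m1]) simp_all
    then have "emeasure T (space T - S) = emeasure (\<mu> \<Otimes>\<^sub>M \<beta>) (space T - S)" using T(2)[OF S'] eP[OF S'] by simp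
    also have "\<dots> \<le> emeasure (\<mu> \<Otimes>\<^sub>M \<beta>) (space \<mu> \<times> space \<beta>)"
      using sets.sets_into_space[OF S'] by (intro emeasure_mono) (auto simp: space_pair_measure sp\<beta>)
    also have "\<dots> = ennreal (1 - c)" 
      by (subst \<beta>.emeasure_pair_measure_Times) (auto simp: sp\<beta> tot \<mu>.emeasure_space_1)
    finally show ?thesis .
  qed
  ultimately show ?thesis using T(1) by blast
qed

section \<open>Normalized balls and the bound on their transport distance\<close>

context metric_measure_space
begin

text \<open>The support is computed with balls of the rescaled ball itself. A boundary point might
  have a neighbourhood meeting the closed ball in a null set; \<open>pos\<close> excludes
  this.\<close>

lemma measure_support_normalized_ball:
  assumes "r > 0" and mB: "emeasure m (mcball_of X p r) < \<infinity>"
    and pos: "\<And>x \<rho>. x \<in> mcball_of X p r \<Longrightarrow> \<rho> > 0 \<Longrightarrow> 0 < emeasure m (mcball_of X p r \<inter> mball_of X x \<rho>)"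
  shows "measure_support (fst (normalized_ball X m p r)) (snd (normalized_ball X m p r)) = mcball_of X p r"
proof -
  let ?B = "mcball_of X p r"
  let ?Y = "rescaled_ball X p r"
  note Y = rescaled_ball[OF \<open>r > 0\<close>, of X p]
  have "0 < emeasure (scale_measure (1 / emeasure m ?B) (restrict_space m ?B)) (mball_of ?Y x \<rho>)"
    if x: "x \<in> ?B" and "\<rho> > 0" for x \<rho>
  proof -
    have "mball_of ?Y x \<rho> = ?B \<inter> mball_of X x (\<rho> * r)"
      using x \<open>r > 0\<close> by (auto simp: Y field_simps)
    moreover have "emeasure (restrict_space m ?B) (?B \<inter> mball_of X x (\<rho> * r)) = emeasure m (?B \<inter> mball_of X x (\<rho> * r))"
      by (subst emeasure_restrict_space) (auto simp del: space_eq)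
    moreover have "0 < emeasure m (?B \<inter> mball_of X x (\<rho> * r))" using pos x \<open>\<rho> > 0\<close> \<open>r > 0\<close> by simp
    moreover have "0 < 1 / emeasure m ?B" using mB by (simp add: ennreal_zero_less_divide)
    ultimately show ?thesis by (simp add: ennreal_zero_less_mult_iff)
  qed
  then show ?thesis by (auto simp: measure_support_def normalized_ball_def Y)
qed

text \<open>An embedding \<open>j\<close> is meaningful on the ball only. Replacing it by a total
  measurable map \<open>i\<close> allows the work to be done with uniform measures on
  \<open>X\<close> rather than with restricted spaces.\<close>

lemma push_support_normalized_ball:
  assumes "r > 0" and supp: "measure_support (fst (normalized_ball X m p r)) (snd (normalized_ball X m p r)) = mcball_of X p r"
    and i: "i \<in> metric_borel X \<rightarrow>\<^sub>M metric_borel W" and eq: "\<And>x. x \<in> mcball_of X p r \<Longrightarrow> i x = j x"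
  shows "push_support (fst (normalized_ball X m p r)) (snd (normalized_ball X m p r)) W j
     = distr (uniform_measure m (mcball_of X p r)) (metric_borel W) i"
proof -
  let ?B = "mcball_of X p r"
  let ?\<mu> = "scale_measure (1 / emeasure m ?B) (restrict_space m ?B)"
  have BX: "?B \<subseteq> mspace X" by auto
  have sets: "sets (restrict_space ?\<mu> ?B) = sets (restrict_space m ?B)"
  proof -
    have "sets (restrict_space ?\<mu> ?B) = sets (restrict_space (restrict_space m ?B) ?B)"
      by (rule sets_restrict_space_cong) simp
    then show ?thesis by (simp add: sets_restrict_restrict_space)
  qed
  have i_m: "i \<in> m \<rightarrow>\<^sub>M metric_borel W" using i by (simp add: sets_eq cong: measurable_cong_sets)
  have "i \<in> restrict_space m ?B \<rightarrow>\<^sub>M metric_borel W" by (rule measurable_restrict_space1[OF i_m])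
  then have "j \<in> restrict_space m ?B \<rightarrow>\<^sub>M metric_borel W"
    using eq by (subst measurable_cong[of _ _ i]) (auto simp: space_restrict_space)
  then have j: "j \<in> restrict_space ?\<mu> ?B \<rightarrow>\<^sub>M metric_borel W"
    using measurable_cong_sets[OF sets refl] by blast
  have sp: "space (restrict_space ?\<mu> ?B) = ?B"
    using BX sets_eq_imp_space_eq[OF sets] by (auto simp: space_restrict_space)
  have "distr (restrict_space ?\<mu> ?B) (metric_borel W) j = distr (uniform_measure m ?B) (metric_borel W) i"
  proof (rule measure_eqI)
    fix S assume "S \<in> sets (distr (restrict_space ?\<mu> ?B) (metric_borel W) j)"
    then have S: "S \<in> sets (metric_borel W)" by simp
    have iS: "i -` S \<inter> space m \<in> sets m" using measurable_sets[OF i_m S] .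
    have eqS: "j -` S \<inter> ?B = ?B \<inter> (i -` S \<inter> space m)" using eq BX by auto
    have "emeasure (distr (restrict_space ?\<mu> ?B) (metric_borel W) j) S = emeasure (restrict_space ?\<mu> ?B) (j -` S \<inter> ?B)"
      using emeasure_distr[OF j S] sp by simp
    also have "\<dots> = emeasure ?\<mu> (j -` S \<inter> ?B)"
    proof (subst emeasure_restrict_space)
      have "space ?\<mu> = ?B" using BX by (auto simp: space_scale_measure space_restrict_space)
      then show "?B \<inter> space ?\<mu> \<in> sets ?\<mu>" by (metis Int_absorb sets.top)
    qed auto
    also have "\<dots> = 1 / emeasure m ?B * emeasure m (j -` S \<inter> ?B)"
      by (simp, subst emeasure_restrict_space) (auto simp del: space_eq)
    also have "\<dots> = emeasure m (?B \<inter> (i -` S \<inter> space m)) / emeasure m ?B"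
      unfolding eqS by (simp add: divide_ennreal_def mult.commute)
    also have "\<dots> = emeasure (uniform_measure m ?B) (i -` S \<inter> space m)" using iS by simp
    also have "\<dots> = emeasure (distr (uniform_measure m ?B) (metric_borel W) i) S"
      using i_m S by (subst emeasure_distr) auto
    finally show "emeasure (distr (restrict_space ?\<mu> ?B) (metric_borel W) j) S
      = emeasure (distr (uniform_measure m ?B) (metric_borel W) i) S" .
  qed simp
  moreover have "push_support (fst (normalized_ball X m p r)) (snd (normalized_ball X m p r)) W j
      = distr (restrict_space ?\<mu> ?B) (metric_borel W) j"
    unfolding push_support_def supp by (simp add: normalized_ball_def)
  ultimately show ?thesis by simp
qed

text \<open>In the glued space mass \<open>c\<^sup>2\<close> travels along bridges of length
  \<epsilon>, and the rest at most the diameter bound 2 of a rescaled ball plus \<epsilon>. One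
  factor \<open>c\<close> comes from \<open>f\<close>, the other from the ratio of the masses of the
  balls.\<close>

lemma sturm_distance_balls:
  assumes p: "p \<in> mspace X" "p' \<in> mspace X" and r: "r > 0"
    and B_def: "B = mcball_of X p r" and B'_def: "B' = mcball_of X p' r"
    and mB: "0 < emeasure m B" "emeasure m B < \<infinity>" and mB': "0 < emeasure m B'" "emeasure m B' < \<infinity>"
    and f: "ball_contraction X m c B B' f" and c: "0 < c" "c \<le> 1" "c * measure m B' \<le> measure m B"
    and "\<epsilon> > 0" and near: "\<And>x y. x \<in> B \<Longrightarrow> y \<in> B \<Longrightarrow> mdist X x y - \<epsilon> * r \<le> mdist X (f x) (f y)"
    and pos: "\<And>x \<rho>. x \<in> B \<Longrightarrow> \<rho> > 0 \<Longrightarrow> 0 < emeasure m (B \<inter> mball_of X x \<rho>)"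
      "\<And>x \<rho>. x \<in> B' \<Longrightarrow> \<rho> > 0 \<Longrightarrow> 0 < emeasure m (B' \<inter> mball_of X x \<rho>)"
  shows "sturm_distance (normalized_ball X m p r) (normalized_ball X m p' r)
    \<le> ennreal (sqrt (\<epsilon>\<^sup>2 + (1 - c\<^sup>2) * (2 + \<epsilon>)\<^sup>2))"
proof -
  have f_meas: "f \<in> metric_borel X \<rightarrow>\<^sub>M metric_borel X" and fB: "f ` B \<subseteq> B'"
    and flip: "\<And>x y. x \<in> B \<Longrightarrow> y \<in> B \<Longrightarrow> mdist X (f x) (f y) \<le> mdist X x y"
    using f by (auto simp: ball_contraction_def)
  let ?Y = "rescaled_ball X p r" and ?Z = "rescaled_ball X p' r"
  note Y = rescaled_ball[OF r, of X p, folded B_def] and Z = rescaled_ball[OF r, of X p', folded B'_def]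
  define W where "W = glued_metric ?Y ?Z f \<epsilon>"
  have W: "mspace W = B <+> B'" "mdist W = glued_dist ?Y ?Z f \<epsilon>"
  proof -
    have "mdist X x y / r - \<epsilon> \<le> mdist X (f x) (f y) / r" if "x \<in> B" "y \<in> B" for x y
      using divide_right_mono[OF near[OF that], of r] r by (simp add: diff_divide_distrib)
    moreover have "mdist X (f x) (f y) / r \<le> mdist X x y / r" if "x \<in> B" "y \<in> B" for x y
      using flip[OF that] r by (simp add: divide_right_mono)
    ultimately show "mspace W = B <+> B'" "mdist W = glued_dist ?Y ?Z f \<epsilon>"
      using glued_metric[of f ?Y ?Z \<epsilon>] fB \<open>\<epsilon> > 0\<close> unfolding W_def Y Z by auto
  qed
  have BX: "B \<subseteq> mspace X" "B' \<subseteq> mspace X" by (auto simp: B_def B'_def)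
  have Bm: "B \<in> sets m" "B' \<in> sets m" by (auto simp: B_def B'_def)
  have pB: "p \<in> B" "p' \<in> B'" using p r by (auto simp: B_def B'_def)
  let ?BX = "metric_borel X" and ?BW = "metric_borel W"
  \<comment> \<open>Constant off the ball, which is a null set for the uniform measure; this keeps
    the embeddings total and measurable.\<close>
  define i1 :: "'a \<Rightarrow> 'a + 'a" where "i1 x = (if x \<in> B then Inl x else Inl p)" for x
  define i2 :: "'a \<Rightarrow> 'a + 'a" where "i2 x = (if x \<in> B' then Inr x else Inr p')" for x
  have i1 [measurable]: "i1 \<in> ?BX \<rightarrow>\<^sub>M ?BW"
    unfolding i1_def
  proof (rule measurable_extend_const)
    show "Inl \<in> restrict_space ?BX B \<rightarrow>\<^sub>M ?BW"
      using Bm(1) r W by (intro measurable_Lipschitz_on[where L = "1 / r"]) (auto simp: sets_eq Y)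
  qed (use Bm(1) pB W in \<open>auto simp: sets_eq\<close>)
  have i2 [measurable]: "i2 \<in> ?BX \<rightarrow>\<^sub>M ?BW"
    unfolding i2_def
  proof (rule measurable_extend_const)
    show "Inr \<in> restrict_space ?BX B' \<rightarrow>\<^sub>M ?BW"
      using Bm(2) r W by (intro measurable_Lipschitz_on[where L = "1 / r"]) (auto simp: sets_eq Z)
  qed (use Bm(2) pB W in \<open>auto simp: sets_eq\<close>)
  have W_meas: "(\<lambda>q. mdist W (fst q) (snd q)) \<in> borel_measurable (?BW \<Otimes>\<^sub>M ?BW)"
  proof -
    obtain D where D: "countable D" "dense_subset X B D" using countable_dense BX by blast
    obtain D' where D': "countable D'" "dense_subset X B' D'" using countable_dense BX by blast
    have scale: "dense_subset V S E" if d: "dense_subset X S E" and V: "mdist V = (\<lambda>x y. mdist X x y / r)" for V S E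
      unfolding dense_subset_def
    proof (intro conjI ballI allI impI)
      show "E \<subseteq> S" using d by (simp add: dense_subset_def)
      fix x and e :: real assume "x \<in> S" "e > 0"
      then obtain q where "q \<in> E" "mdist X x q < e * r" using d r unfolding dense_subset_def by (meson mult_pos_pos)
      then show "\<exists>q\<in>E. mdist V x q < e" using r by (auto simp: V field_simps intro!: bexI[of _ q])
    qed
    have "dense_subset W (mspace W) (D <+> D')"
    proof (rule dense_subset_glued)
      show "mspace W = mspace ?Y <+> mspace ?Z" using W Y Z by simp
      show "dense_subset ?Y (mspace ?Y) D" "dense_subset ?Z (mspace ?Z) D'"
        using scale[OF D(2), of ?Y] scale[OF D'(2), of ?Z] Y Z by auto
    qed (rule W(2))
    moreover have "countable (D <+> D')" using D(1) D'(1) by (rule countable_Plus)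
    ultimately show ?thesis using measurable_mdist by blast
  qed
  define \<mu> \<nu> where "\<mu> = uniform_measure m B" and "\<nu> = uniform_measure m B'"
  have P: "prob_space \<mu>" "prob_space \<nu>"
    unfolding \<mu>_def \<nu>_def using mB mB' by (auto intro!: prob_space_uniform_measure)
  have s: "sets \<mu> = sets ?BX" "sets \<nu> = sets ?BX" by (simp_all add: \<mu>_def \<nu>_def sets_eq)
  note [measurable_cong] = s
  have sp: "space \<mu> = mspace X" "space \<nu> = mspace X" by (simp_all add: \<mu>_def \<nu>_def)
  have f\<mu>: "f \<in> \<mu> \<rightarrow>\<^sub>M \<nu>" using f_meas by measurable
  have le: "ennreal (c\<^sup>2) * emeasure (distr \<mu> \<nu> f) V \<le> emeasure \<nu> V" if V: "V \<in> sets \<nu>" for V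
  proof -
    have "distr \<mu> \<nu> f = distr \<mu> ?BX f" by (rule distr_cong) (auto simp: s)
    then have "emeasure (distr \<mu> \<nu> f) V \<le> ennreal (1 / (c * c)) * emeasure \<nu> V"
      using uniform_measure_pullback_le[OF Bm(1) mB Bm(2) mB' f c(1,1,3), of V] V s sets_eq by (simp add: \<mu>_def \<nu>_def)
    then have "ennreal (c\<^sup>2) * emeasure (distr \<mu> \<nu> f) V \<le> ennreal (c\<^sup>2) * (ennreal (1 / (c * c)) * emeasure \<nu> V)"
      by (rule mult_left_mono) simp
    also have "\<dots> = emeasure \<nu> V"
      using c by (simp add: mult.assoc[symmetric] power2_eq_square flip: ennreal_mult)
    finally show ?thesis .
  qed
  have c2: "0 \<le> c\<^sup>2" "c\<^sup>2 \<le> 1" using c by (auto simp: power_le_one)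
  obtain T where T: "sets T = sets (\<mu> \<Otimes>\<^sub>M \<nu>)" "distr T \<mu> fst = \<mu>" "distr T \<nu> snd = \<nu>"
    and Tsmall: "\<And>S. S \<in> sets (\<mu> \<Otimes>\<^sub>M \<nu>) \<Longrightarrow> AE x in \<mu>. (x, f x) \<in> S \<Longrightarrow> emeasure T (space T - S) \<le> ennreal (1 - c\<^sup>2)"
    using partial_push_coupling[OF P f\<mu> c2 le] by blast
  note [measurable_cong] = T(1)
  have spT: "space T = mspace X \<times> mspace X" using sets_eq_imp_space_eq[OF T(1)] by (simp add: space_pair_measure sp)
  have "prob_space (distr T \<mu> fst)" using T P by simp
  then have PT: "prob_space T" by (rule prob_space_distrD[rotated]) measurable
  define \<pi> where "\<pi> = distr T (?BW \<Otimes>\<^sub>M ?BW) (\<lambda>q. (i1 (fst q), i2 (snd q)))"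
  have "distr \<pi> ?BW fst = distr \<mu> ?BW i1"
  proof -
    have "distr \<pi> ?BW fst = distr T ?BW (i1 \<circ> fst)" unfolding \<pi>_def by (subst distr_distr) (auto simp: comp_def)
    also have "\<dots> = distr (distr T \<mu> fst) ?BW i1" by (intro distr_distr[symmetric]) measurable
    finally show ?thesis using T by simp
  qed
  moreover have "distr \<pi> ?BW snd = distr \<nu> ?BW i2"
  proof -
    have "distr \<pi> ?BW snd = distr T ?BW (i2 \<circ> snd)" unfolding \<pi>_def by (subst distr_distr) (auto simp: comp_def)
    also have "\<dots> = distr (distr T \<nu> snd) ?BW i2" by (intro distr_distr[symmetric]) measurable
    finally show ?thesis using T by simp
  qed
  ultimately have \<pi>: "\<pi> \<in> couplings W (distr \<mu> ?BW i1) (distr \<nu> ?BW i2)"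
    by (simp add: couplings_def \<pi>_def)
  define d where "d q = mdist W (i1 (fst q)) (i2 (snd q))" for q
  have d_meas [measurable]: "d \<in> borel_measurable T"
    unfolding d_def using measurable_compose[OF _ W_meas, of "\<lambda>q. (i1 (fst q), i2 (snd q))" T] by simp
  have d_le: "0 \<le> d q" "d q \<le> 2 + \<epsilon>" for q
  proof -
    obtain x y where xy: "x \<in> B" "y \<in> B'" "i1 (fst q) = Inl x" "i2 (snd q) = Inr y"
      using pB unfolding i1_def i2_def by metis
    have fx: "f x \<in> B'" using fB xy by blast
    have "mdist X (f x) y \<le> mdist X (f x) p' + mdist X p' y" using fx xy p BX by (intro mdist_triangle) auto
    also have "\<dots> \<le> 2 * r" using fx xy by (simp add: B'_def mdist_commute)
    finally show "d q \<le> 2 + \<epsilon>" using r by (simp add: d_def W xy Z field_simps)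
    show "0 \<le> d q" by (simp add: d_def)
  qed
  define S where "S = {q \<in> space T. d q \<le> \<epsilon>}"
  have S: "S \<in> sets T" unfolding S_def by measurable
  have "AE x in \<mu>. (x, f x) \<in> S"
  proof -
    have "AE x in \<mu>. x \<in> B" unfolding \<mu>_def using Bm by (intro AE_uniform_measureI) auto
    then show ?thesis
    proof eventually_elim
      case (elim x)
      have "f x \<in> B'" using fB elim by blast
      then show ?case using elim BX by (auto simp: S_def spT d_def i1_def i2_def W Z)
    qed
  qed
  then have small: "emeasure T (space T - S) \<le> ennreal (1 - c\<^sup>2)" using Tsmall S T(1) by blast
  have "transport_cost W \<pi> = (\<integral>\<^sup>+q. ennreal ((d q)\<^sup>2) \<partial>T)"
    unfolding transport_cost_def case_prod_beta \<pi>_def d_def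
    using W_meas by (subst nn_integral_distr) auto
  also have "\<dots> \<le> (\<integral>\<^sup>+q. ennreal (\<epsilon>\<^sup>2) + ennreal ((2 + \<epsilon>)\<^sup>2) * indicator (space T - S) q \<partial>T)"
  proof (rule nn_integral_mono)
    fix q assume q: "q \<in> space T"
    show "ennreal ((d q)\<^sup>2) \<le> ennreal (\<epsilon>\<^sup>2) + ennreal ((2 + \<epsilon>)\<^sup>2) * indicator (space T - S) q"
    proof (cases "q \<in> S")
      case True
      then show ?thesis using d_le(1)[of q] by (auto simp: S_def intro!: ennreal_leI power_mono)
    next
      case False
      have "ennreal ((d q)\<^sup>2) \<le> ennreal ((2 + \<epsilon>)\<^sup>2)" using d_le[of q] by (intro ennreal_leI power_mono)
      then show ?thesis using False q by (simp add: add_increasing)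
    qed
  qed
  also have "\<dots> = ennreal (\<epsilon>\<^sup>2) + ennreal ((2 + \<epsilon>)\<^sup>2) * emeasure T (space T - S)"
    using S prob_space.emeasure_space_1[OF PT] by (subst nn_integral_add) (auto simp: nn_integral_cmult_indicator)
  also have "\<dots> \<le> ennreal (\<epsilon>\<^sup>2) + ennreal ((2 + \<epsilon>)\<^sup>2) * ennreal (1 - c\<^sup>2)"
    using small by (intro add_left_mono mult_left_mono) auto
  also have "\<dots> = ennreal (\<epsilon>\<^sup>2 + (1 - c\<^sup>2) * (2 + \<epsilon>)\<^sup>2)"
    using c2 by (simp add: mult.commute flip: ennreal_mult ennreal_plus)
  finally have cost: "transport_cost W \<pi> \<le> ennreal (\<epsilon>\<^sup>2 + (1 - c\<^sup>2) * (2 + \<epsilon>)\<^sup>2)" .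
  have "wasserstein W (distr \<mu> ?BW i1) (distr \<nu> ?BW i2) \<le> ennreal_sqrt (ennreal (\<epsilon>\<^sup>2 + (1 - c\<^sup>2) * (2 + \<epsilon>)\<^sup>2))"
    unfolding wasserstein_def by (intro ennreal_sqrt_mono INF_lower2[OF \<pi>] cost)
  also have "\<dots> = ennreal (sqrt (\<epsilon>\<^sup>2 + (1 - c\<^sup>2) * (2 + \<epsilon>)\<^sup>2))"
  proof -
    have "0 \<le> \<epsilon>\<^sup>2 + (1 - c\<^sup>2) * (2 + \<epsilon>)\<^sup>2" using c2 by auto
    then show ?thesis by (simp add: ennreal_sqrt_def del: ennreal_plus)
  qed
  finally have Wass: "wasserstein W (distr \<mu> ?BW i1) (distr \<nu> ?BW i2) \<le> ennreal (sqrt (\<epsilon>\<^sup>2 + (1 - c\<^sup>2) * (2 + \<epsilon>)\<^sup>2))" .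
  define \<mu>0 \<nu>0 where "\<mu>0 = snd (normalized_ball X m p r)" and "\<nu>0 = snd (normalized_ball X m p' r)"
  have nb: "normalized_ball X m p r = (?Y, \<mu>0)" "normalized_ball X m p' r = (?Z, \<nu>0)"
    by (simp_all add: \<mu>0_def \<nu>0_def normalized_ball_def)
  have sup1: "measure_support ?Y \<mu>0 = B"
    using measure_support_normalized_ball[OF r, of p] mB pos(1) by (simp add: nb B_def)
  have sup2: "measure_support ?Z \<nu>0 = B'"
    using measure_support_normalized_ball[OF r, of p'] mB' pos(2) by (simp add: nb B'_def)
  have push1: "push_support ?Y \<mu>0 W Inl = distr \<mu> ?BW i1"
    using push_support_normalized_ball[OF r, of p i1 W Inl] sup1 i1 by (simp add: nb \<mu>_def B_def[symmetric] i1_def)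
  have push2: "push_support ?Z \<nu>0 W Inr = distr \<nu> ?BW i2"
    using push_support_normalized_ball[OF r, of p' i2 W Inr] sup2 i2 by (simp add: nb \<nu>_def B'_def[symmetric] i2_def)
  have emb: "(W, Inl, Inr) \<in> {(W, \<iota>, \<iota>'). isometric_embedding_on (measure_support ?Y \<mu>0) ?Y W \<iota> \<and>
        isometric_embedding_on (measure_support ?Z \<nu>0) ?Z W \<iota>'}"
    by (auto simp: isometric_embedding_on_def sup1 sup2 W)
  have "sturm_distance (?Y, \<mu>0) (?Z, \<nu>0) \<le> wasserstein W (push_support ?Y \<mu>0 W Inl) (push_support ?Z \<nu>0 W Inr)"
    unfolding sturm_distance.simps by (rule INF_lower2[OF emb]) simp
  then show ?thesis using Wass by (simp add: nb push1 push2)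
qed

end

section \<open>Constants uniform along the geodesic\<close>

context metric_measure_space
begin

text \<open>Local finiteness gives a radius at each point; compactness of the parameter interval, in
  the form of a bisection argument, gives a common one. The threshold for \<open>r\<close> depends
  on it.\<close>

lemma uniform_finite_balls:
  assumes g: "is_geodesic X \<gamma>"
  shows "\<exists>\<rho>>0. \<forall>t\<in>{0..1}. emeasure m (mcball_of X (\<gamma> t) \<rho>) < \<infinity>"
proof -
  define L where "L = mdist X (\<gamma> 0) (\<gamma> 1)"
  have L: "L \<ge> 0" by (simp add: L_def)
  define P where "P a b \<longleftrightarrow> (\<exists>\<rho>>0. \<forall>t\<in>{a..b} \<inter> {0..1}. emeasure m (mcball_of X (\<gamma> t) \<rho>) < \<infinity>)" for a b
  have "P 0 1"
  proof (rule Bolzano)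
    fix a b c :: real assume "P a b" "P b c" "a \<le> b" "b \<le> c"
    then obtain \<rho> \<rho>' where \<rho>: "\<rho> > 0" "\<rho>' > 0" "\<forall>t\<in>{a..b} \<inter> {0..1}. emeasure m (mcball_of X (\<gamma> t) \<rho>) < \<infinity>"
      "\<forall>t\<in>{b..c} \<inter> {0..1}. emeasure m (mcball_of X (\<gamma> t) \<rho>') < \<infinity>" unfolding P_def by blast
    have "emeasure m (mcball_of X (\<gamma> t) (min \<rho> \<rho>')) < \<infinity>" if "t \<in> {a..c} \<inter> {0..1}" for t
    proof -
      have "emeasure m (mcball_of X (\<gamma> t) (min \<rho> \<rho>')) \<le> emeasure m (mcball_of X (\<gamma> t) \<rho>)"
        "emeasure m (mcball_of X (\<gamma> t) (min \<rho> \<rho>')) \<le> emeasure m (mcball_of X (\<gamma> t) \<rho>')"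
        by (auto intro!: emeasure_mono)
      moreover have "t \<in> {a..b} \<inter> {0..1} \<or> t \<in> {b..c} \<inter> {0..1}" using that by auto
      ultimately show ?thesis using \<rho> by (metis le_less_trans)
    qed
    then show "P a c" using \<rho> unfolding P_def by (intro exI[of _ "min \<rho> \<rho>'"]) auto
  next
    fix x :: real assume x: "0 \<le> x" "x \<le> 1"
    then have gx: "\<gamma> x \<in> mspace X" by (auto intro: geodesic_in_mspace[OF g])
    then obtain r where r: "r > 0" "emeasure m (mball_of X (\<gamma> x) r) < \<infinity>"
      using locally_finite by blast
    \<comment> \<open>Ensures \<open>d * L \<le> r / 3\<close>; the summand 1 covers constant
      geodesics.\<close>
    define d where "d = r / (3 * (L + 1))"
    have d: "d > 0" "d * L \<le> r / 3" using r L by (auto simp: d_def field_simps)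
    have "P a b" if ab: "a \<le> x" "x \<le> b" "b - a < d" for a b
    proof -
      have "emeasure m (mcball_of X (\<gamma> t) (r / 3)) < \<infinity>" if t: "t \<in> {a..b} \<inter> {0..1}" for t
      proof (rule le_less_trans[OF emeasure_mono r(2)])
        have gt: "\<gamma> t \<in> mspace X" using t by (auto intro: geodesic_in_mspace[OF g])
        have "mdist X (\<gamma> x) (\<gamma> t) = \<bar>x - t\<bar> * L" unfolding L_def using x t by (intro geodesic_dist[OF g]) auto
        also have "\<dots> \<le> d * L" using ab t L by (intro mult_right_mono) auto
        finally have xt: "mdist X (\<gamma> x) (\<gamma> t) \<le> r / 3" using d by simp
        show "mcball_of X (\<gamma> t) (r / 3) \<subseteq> mball_of X (\<gamma> x) r"
        proof
          fix z assume z: "z \<in> mcball_of X (\<gamma> t) (r / 3)"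
          then have "mdist X (\<gamma> x) z \<le> mdist X (\<gamma> x) (\<gamma> t) + mdist X (\<gamma> t) z"
            using gx gt by (intro mdist_triangle) auto
          then show "z \<in> mball_of X (\<gamma> x) r" using z xt gx r(1) by auto
        qed
      qed simp
      then show ?thesis using r unfolding P_def by (intro exI[of _ "r / 3"]) auto
    qed
    then show "\<exists>d>0. \<forall>a b. a \<le> x \<and> x \<le> b \<and> b - a < d \<longrightarrow> P a b" using d(1) by blast
  qed simp
  then show ?thesis by (simp add: P_def)
qed

lemma ball_contraction_comp:
  assumes f: "ball_contraction X m c B B' f" and g: "ball_contraction X m c B' B g" and c: "0 \<le> c"
    and B: "B' \<subseteq> mspace X"
  shows "ball_contraction X m (c\<^sup>2) B B (g \<circ> f)"
  unfolding ball_contraction_def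
proof (intro conjI ballI)
  have fm [measurable]: "f \<in> metric_borel X \<rightarrow>\<^sub>M metric_borel X" and gm [measurable]: "g \<in> metric_borel X \<rightarrow>\<^sub>M metric_borel X"
    using f g by (auto simp: ball_contraction_def)
  show "g \<circ> f \<in> metric_borel X \<rightarrow>\<^sub>M metric_borel X" by measurable
  have fB: "\<And>x. x \<in> B \<Longrightarrow> f x \<in> B'" and gB: "\<And>x. x \<in> B' \<Longrightarrow> g x \<in> B"
    using f g by (auto simp: ball_contraction_def)
  show "(g \<circ> f) ` B \<subseteq> B" using fB gB by auto
  show "mdist X ((g \<circ> f) x) ((g \<circ> f) y) \<le> mdist X x y" if "x \<in> B" "y \<in> B" for x y
  proof -
    have "mdist X (g (f x)) (g (f y)) \<le> mdist X (f x) (f y)" using g fB that by (simp add: ball_contraction_def)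
    also have "\<dots> \<le> mdist X x y" using f that by (simp add: ball_contraction_def)
    finally show ?thesis by simp
  qed
  fix V assume V: "V \<in> sets m"
  have V': "g -` V \<inter> space m \<in> sets m"
    using measurable_sets[OF gm, of V] V by (simp add: sets_eq)
  have comp: "(g \<circ> f) -` V \<inter> B = f -` (g -` V \<inter> space m) \<inter> B" using fB B by auto
  have "c * measure m (f -` (g -` V \<inter> space m) \<inter> B) \<le> measure m ((g -` V \<inter> space m) \<inter> B')"
    using f V' unfolding ball_contraction_def by blast
  then have "c * (c * measure m ((g \<circ> f) -` V \<inter> B)) \<le> c * measure m ((g -` V \<inter> space m) \<inter> B')"
    unfolding comp using c by (rule mult_left_mono)
  also have "(g -` V \<inter> space m) \<inter> B' = g -` V \<inter> B'" using B by auto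
  also have "c * measure m (g -` V \<inter> B') \<le> measure m (V \<inter> B)" using g V by (simp add: ball_contraction_def)
  finally show "c\<^sup>2 * measure m ((g \<circ> f) -` V \<inter> B) \<le> measure m (V \<inter> B)"
    unfolding power2_eq_square mult.assoc .
qed

end

context small_scale
begin

text \<open>The contraction aims at the point of \<gamma> lying \<sigma> beyond \<open>t'\<close> as
  seen from \<open>t\<close>, so the fraction is \<open>a / (a + \<sigma>)\<close>, at most \<delta>
  whatever \<open>r\<close> is. The margin \<open>s0\<close> leaves room for this point on either
  side, which makes the roles of \<open>t\<close> and \<open>t'\<close> exchangeable.\<close>

lemma geodesic_ball_contraction:
  assumes g: "is_geodesic X \<gamma>" and \<sigma>: "0 < \<sigma>" "\<sigma> \<le> s0" "2 * \<sigma> * mdist X (\<gamma> 0) (\<gamma> 1) \<le> R / 4"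
    and r: "0 < r" "r \<le> R / 4" and fin: "\<And>t. t \<in> {0..1} \<Longrightarrow> emeasure m (mcball_of X (\<gamma> t) (2 * r)) < \<infinity>"
    and t: "t \<in> {s0..1 - s0}" "t' \<in> {s0..1 - s0}"
    and \<delta>: "\<delta> \<le> 1" "\<bar>t - t'\<bar> \<le> \<delta> * \<sigma>" and c: "0 \<le> c" "c \<le> 1" "c \<le> (1 - \<delta>) powr (2 * (N + 1))"
  shows "\<exists>f. ball_contraction X m c (mcball_of X (\<gamma> t) r) (mcball_of X (\<gamma> t') r) f"
proof (cases "t = t'")
  case True
  have "c * measure m (V \<inter> B) \<le> measure m (V \<inter> B)" for V B
    using c by (simp add: mult_left_le_one_le)
  then have "ball_contraction X m c (mcball_of X (\<gamma> t) r) (mcball_of X (\<gamma> t) r) (\<lambda>x. x)"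
    by (simp add: ball_contraction_def)
  then show ?thesis using True by blast
next
  case False
  define L where "L = mdist X (\<gamma> 0) (\<gamma> 1)"
  define a where "a = \<bar>t - t'\<bar>"
  define u where "u = (if t < t' then t' + \<sigma> else t' - \<sigma>)"
  define l where "l = (t' - t) / (u - t)"
  define e where "e w = \<gamma> (t + w * (u - t))" for w
  have a: "0 < a" "a \<le> \<delta> * \<sigma>" using False \<delta> by (auto simp: a_def)
  have \<delta>\<sigma>: "\<delta> * \<sigma> \<le> \<sigma>" using \<delta>(1) \<sigma>(1) by (simp add: mult_left_le_one_le mult_le_cancel_right1)
  have u: "u \<in> {0..1}" "\<bar>t - u\<bar> = a + \<sigma>" "u \<noteq> t" using t \<sigma> False by (auto simp: u_def a_def)
  have l_eq: "l = a / (a + \<sigma>)"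
    using False \<sigma>(1) by (cases "t < t'") (auto simp: l_def u_def a_def divide_simps algebra_simps)
  have l: "0 < l" "l < 1" "l \<le> \<delta>"
  proof -
    show "0 < l" "l < 1" unfolding l_eq using a \<sigma>(1) by auto
    have "a / (a + \<sigma>) \<le> a / \<sigma>" using a \<sigma>(1) by (intro divide_left_mono) auto
    also have "\<dots> \<le> \<delta>" using a \<sigma>(1) by (simp add: divide_le_eq)
    finally show "l \<le> \<delta>" unfolding l_eq .
  qed
  have t01: "t \<in> {0..1}" "t' \<in> {0..1}" using t \<sigma> by auto
  have e: "is_geodesic X e" unfolding e_def by (rule subgeodesic[OF g t01(1) u(1)])
  have e0: "e 0 = \<gamma> t" and e1: "e 1 = \<gamma> u" by (simp_all add: e_def)
  have "t + l * (u - t) = t'" using u(3) by (simp add: l_def)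
  then have el: "e l = \<gamma> t'" by (simp add: e_def)
  have "mdist X (e 0) (e 1) = (a + \<sigma>) * L"
    unfolding e0 e1 L_def u(2)[symmetric] by (rule geodesic_dist[OF g t01(1) u(1)])
  also have "\<dots> \<le> 2 * \<sigma> * L" using a \<delta>\<sigma> by (intro mult_right_mono) (auto simp: L_def)
  finally have far: "mdist X (e 0) (e 1) + r \<le> R / 2" using \<sigma>(3) r by (simp add: L_def)
  have fin1: "emeasure m (mcball_of X (e 0) r) < \<infinity>"
  proof (rule le_less_trans[OF emeasure_mono fin[OF t01(1)]])
    show "mcball_of X (e 0) r \<subseteq> mcball_of X (\<gamma> t) (2 * r)" using r by (auto simp: e0)
  qed simp
  obtain f where f: "ball_contraction X m ((1 - l) powr (2 * (N + 1))) (mcball_of X (e 0) r) (mcball_of X (e l) r) f"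
    using contraction_map[OF e l(1,2) r(1) far fin1] fin[OF t01(2)] el by auto
  have "c \<le> (1 - l) powr (2 * (N + 1))"
  proof -
    have "(1 - \<delta>) powr (2 * (N + 1)) \<le> (1 - l) powr (2 * (N + 1))" using \<delta>(1) l N by (intro powr_mono2) auto
    then show ?thesis using c by simp
  qed
  then have "c * measure m V \<le> (1 - l) powr (2 * (N + 1)) * measure m V" for V by (intro mult_right_mono) auto
  then have "ball_contraction X m c (mcball_of X (e 0) r) (mcball_of X (e l) r) f"
    using f unfolding ball_contraction_def by (meson order_trans)
  then show ?thesis unfolding e0 el by blast
qed

lemma ball_intersection_pos:
  assumes r: "r > 0" "2 * r \<le> R" and x: "x \<in> mcball_of X p r" and "\<rho> > 0"
    and fin: "emeasure m (mcball_of X p r) < \<infinity>"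
  shows "0 < emeasure m (mcball_of X p r \<inter> mball_of X x \<rho>)"
proof -
  \<comment> \<open>Makes the closed ball of radius \<open>2 * s * r \<le> \<rho> / 2\<close> fit
    into the open ball of radius \<rho>.\<close>
  define s where "s = min 1 (\<rho> / (4 * r))"
  have s: "0 < s" "s \<le> 1" using r \<open>\<rho> > 0\<close> by (auto simp: s_def)
  have "s * r \<le> \<rho> / (4 * r) * r" using r by (intro mult_right_mono) (auto simp: s_def)
  then have sr: "2 * s * r < \<rho>" using r \<open>\<rho> > 0\<close> by simp
  have "0 < emeasure m (mball_of X p r)" using x r by (intro ball_pos) auto
  also have "\<dots> \<le> emeasure m (mcball_of X p r)" by (intro emeasure_mono) auto
  finally have "0 < measure m (mcball_of X p r)"
    using fin by (simp add: emeasure_eq_ennreal_measure less_top)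
  then have "0 < (s / 3) powr (2 * (N + 1)) * measure m (mcball_of X p r)" using s by simp
  also have "\<dots> \<le> measure m (mcball_of X p r \<inter> mcball_of X x (2 * s * r))"
    by (rule ball_volume[OF r x s fin])
  finally have "0 < emeasure m (mcball_of X p r \<inter> mcball_of X x (2 * s * r))"
    by (metis emeasure_eq_0 zero_less_measure_iff not_gr_zero measure_eq_emeasure_eq_ennreal less_irrefl enn2real_0 measure_def)
  also have "\<dots> \<le> emeasure m (mcball_of X p r \<inter> mball_of X x \<rho>)"
    using sr by (intro emeasure_mono) auto
  finally show ?thesis .
qed

end

text \<open>The fourth power of \<open>c\<close> arises because the gap condition is applied to the
  composite of the two maps, whose constant is \<open>c\<^sup>2\<close>, and itself squares that
  constant.\<close>

lemma ex_contraction_constant: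
  fixes \<epsilon> v a :: real
  assumes "\<epsilon> > 0" "v > 0" "\<epsilon>\<^sup>2 < a"
  shows "\<exists>c. 0 < c \<and> c < 1 \<and> 2 * (1 / (c\<^sup>2)\<^sup>2 - 1) < \<epsilon> / 2 * v\<^sup>2 \<and> \<epsilon>\<^sup>2 + (1 - c\<^sup>2) * (2 + \<epsilon>)\<^sup>2 < a"
proof -
  have "((\<lambda>c::real. 2 * (1 / (c\<^sup>2)\<^sup>2 - 1)) \<longlongrightarrow> 2 * (1 / (1\<^sup>2)\<^sup>2 - 1)) (at_left 1)"
    by (intro tendsto_intros) auto
  then have "eventually (\<lambda>c::real. 2 * (1 / (c\<^sup>2)\<^sup>2 - 1) < \<epsilon> / 2 * v\<^sup>2) (at_left 1)"
    by (rule order_tendstoD) (use assms in simp)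
  moreover have "((\<lambda>c. \<epsilon>\<^sup>2 + (1 - c\<^sup>2) * (2 + \<epsilon>)\<^sup>2) \<longlongrightarrow> \<epsilon>\<^sup>2 + (1 - 1\<^sup>2) * (2 + \<epsilon>)\<^sup>2) (at_left 1)"
    by (intro tendsto_intros)
  then have "eventually (\<lambda>c. \<epsilon>\<^sup>2 + (1 - c\<^sup>2) * (2 + \<epsilon>)\<^sup>2 < a) (at_left 1)"
    by (rule order_tendstoD) (use assms in simp)
  moreover have "eventually (\<lambda>c::real. c \<in> {0<..<1}) (at_left 1)" by (rule eventually_at_left_real) simp
  ultimately have "eventually (\<lambda>c. 0 < c \<and> c < 1 \<and> 2 * (1 / (c\<^sup>2)\<^sup>2 - 1) < \<epsilon> / 2 * v\<^sup>2 \<and>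
      \<epsilon>\<^sup>2 + (1 - c\<^sup>2) * (2 + \<epsilon>)\<^sup>2 < a) (at_left 1)"
    by eventually_elim auto
  then show ?thesis by (rule eventually_happens'[rotated]) simp
qed

theorem theorem7p4:
  fixes X :: "'a metric" and m :: "'a measure"
    and K \<kappa> N s0 :: real and \<gamma> :: "real \<Rightarrow> 'a"
  assumes "metric_measure_space X m"
    and "N \<ge> 1"
    and "RCD K N X m"
    and "CAT \<kappa> X"
    and "is_geodesic X \<gamma>"
    and "0 < s0" and "s0 < 1/2"
  shows "\<forall>\<epsilon>::real. \<epsilon> > 0 \<longrightarrow>
    (\<exists>\<delta>>0. \<exists>r0>0. \<forall>r t t'. 0 < r \<and> r < r0 \<and>
       t \<in> {s0..1 - s0} \<and> t' \<in> {s0..1 - s0} \<and> \<bar>t - t'\<bar> < \<delta> \<longrightarrow>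
       sturm_distance (normalized_ball X m (\<gamma> t) r) (normalized_ball X m (\<gamma> t') r) < ennreal \<epsilon>)"
proof (intro allI impI)
  fix \<epsilon>0 :: real assume "\<epsilon>0 > 0"
  interpret metric_measure_space X m by fact
  note N = assms(2) and cat = assms(4) and g = assms(5)
  have CD: "CD K N X m" using assms(3) by (simp add: RCD_def)
  define L where "L = mdist X (\<gamma> 0) (\<gamma> 1)"
  have L: "0 \<le> L" by (simp add: L_def)
  \<comment> \<open>Absolute values and added ones satisfy both scale conditions at once for all
    signs of \<open>K\<close> and \<kappa>, without dividing by 0.\<close>
  define R where "R = min (1 / (2 * sqrt (\<bar>K\<bar> / N) + 1)) (pi / 4 / (sqrt \<bar>\<kappa>\<bar> + 1))"
  have den: "0 < 2 * sqrt (\<bar>K\<bar> / N) + 1" "0 < sqrt \<bar>\<kappa>\<bar> + 1" using N by (auto intro!: add_nonneg_pos)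
  have R: "R > 0" using den pi_gt_zero by (simp add: R_def)
  have smallK: "2 * R * sqrt (- K / N) \<le> 1" if "K < 0"
  proof -
    have "R \<le> 1 / (2 * sqrt (\<bar>K\<bar> / N) + 1)" by (simp add: R_def)
    then have "R * (2 * sqrt (\<bar>K\<bar> / N) + 1) \<le> 1" using den(1) by (simp only: pos_le_divide_eq)
    moreover have "\<bar>K\<bar> = - K" using that by simp
    ultimately show ?thesis using R by (simp add: algebra_simps)
  qed
  have small\<kappa>: "sqrt \<kappa> * R \<le> pi / 4" if "\<kappa> > 0"
  proof -
    have "R \<le> pi / 4 / (sqrt \<bar>\<kappa>\<bar> + 1)" by (simp add: R_def)
    then have "R * (sqrt \<bar>\<kappa>\<bar> + 1) \<le> pi / 4" using den(2) by (simp only: pos_le_divide_eq)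
    then show ?thesis using R that by (simp add: algebra_simps)
  qed
  interpret small_scale X m K N \<kappa> R
    by unfold_locales (use CD N cat R smallK small\<kappa> in auto)
  \<comment> \<open>Strictly below \<open>\<epsilon>0\<close> to leave room for the stray mass, and
    at most 1 so that \<open>\<epsilon> / 16\<close> is an admissible fraction in
    \<open>ball_volume\<close>.\<close>
  define \<epsilon> where "\<epsilon> = min (\<epsilon>0 / 2) 1"
  have \<epsilon>: "0 < \<epsilon>" "\<epsilon> \<le> 1" "\<epsilon> < \<epsilon>0" using \<open>\<epsilon>0 > 0\<close> by (auto simp: \<epsilon>_def)
  \<comment> \<open>The volume share given by \<open>ball_volume\<close> with
    \<open>s = \<epsilon> / 16\<close>, that is, for balls of radius
    \<open>\<epsilon> * r / 8\<close>.\<close>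
  define v where "v = (\<epsilon> / 16 / 3) powr (2 * (N + 1))"
  have v: "v > 0" using \<epsilon> by (simp add: v_def)
  have "\<epsilon>\<^sup>2 < \<epsilon>0\<^sup>2" using \<epsilon> by (intro power_strict_mono) auto
  then obtain c where c: "0 < c" "c < 1" and gap: "2 * (1 / (c\<^sup>2)\<^sup>2 - 1) < \<epsilon> / 2 * v\<^sup>2"
    and final: "\<epsilon>\<^sup>2 + (1 - c\<^sup>2) * (2 + \<epsilon>)\<^sup>2 < \<epsilon>0\<^sup>2"
    using ex_contraction_constant \<epsilon>(1) v by metis
  define \<delta> where "\<delta> = 1 - c powr (1 / (2 * (N + 1)))"
  have \<delta>: "0 < \<delta>" "\<delta> \<le> 1" "(1 - \<delta>) powr (2 * (N + 1)) = c"
  proof -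
    have "c powr (1 / (2 * (N + 1))) < 1 powr (1 / (2 * (N + 1)))" using c N by (intro powr_less_mono2) auto
    then show "0 < \<delta>" by (simp add: \<delta>_def)
    show "\<delta> \<le> 1" by (simp add: \<delta>_def)
    show "(1 - \<delta>) powr (2 * (N + 1)) = c" using c N by (simp add: \<delta>_def powr_powr)
  qed
  \<comment> \<open>The first bound keeps the target point on \<gamma>, the second keeps it within
    \<open>R / 4\<close> of the centre of the ball; \<open>L + 1\<close> allows
    \<open>L = 0\<close>.\<close>
  define \<sigma> where "\<sigma> = min s0 (R / (8 * (L + 1)))"
  have \<sigma>: "0 < \<sigma>" "\<sigma> \<le> s0" using assms(6) R L by (auto simp: \<sigma>_def)
  have \<sigma>L: "2 * \<sigma> * L \<le> R / 4"
  proof -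
    have "2 * \<sigma> * L \<le> 2 * \<sigma> * (L + 1)" using \<sigma> by (intro mult_left_mono) auto
    also have "\<dots> \<le> 2 * (R / (8 * (L + 1))) * (L + 1)" using L by (intro mult_right_mono) (auto simp: \<sigma>_def)
    also have "\<dots> = R / 4" using L by (simp add: field_simps)
    finally show ?thesis .
  qed
  obtain \<rho> where \<rho>: "\<rho> > 0" "\<forall>t\<in>{0..1}. emeasure m (mcball_of X (\<gamma> t) \<rho>) < \<infinity>"
    using uniform_finite_balls[OF g] by blast
  define r0 where "r0 = min (R / 4) (\<rho> / 2)"
  have r0: "r0 > 0" using R \<rho> by (simp add: r0_def)
  have main: "sturm_distance (normalized_ball X m (\<gamma> t) r) (normalized_ball X m (\<gamma> t') r) < ennreal \<epsilon>0"
    if r: "0 < r" "r < r0" and t: "t \<in> {s0..1 - s0}" "t' \<in> {s0..1 - s0}" "\<bar>t - t'\<bar> < \<delta> * \<sigma>" for r t t'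
  proof -
    have rR: "r \<le> R / 4" "2 * r \<le> R" "2 * r \<le> \<rho>" using r R by (auto simp: r0_def)
    have fin2: "emeasure m (mcball_of X (\<gamma> t) (2 * r)) < \<infinity>" if "t \<in> {0..1}" for t
    proof (rule le_less_trans)
      show "emeasure m (mcball_of X (\<gamma> t) (2 * r)) \<le> emeasure m (mcball_of X (\<gamma> t) \<rho>)"
        using rR by (intro emeasure_mono) auto
    qed (use \<rho> that in blast)
    have t01: "t \<in> {0..1}" "t' \<in> {0..1}" using t assms(6) by auto
    define B B' where "B = mcball_of X (\<gamma> t) r" and "B' = mcball_of X (\<gamma> t') r"
    have gX: "\<gamma> t \<in> mspace X" "\<gamma> t' \<in> mspace X" using t01 by (auto intro: geodesic_in_mspace[OF g])
    have fin: "emeasure m B < \<infinity>" "emeasure m B' < \<infinity>"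
    proof -
      have "emeasure m B \<le> emeasure m (mcball_of X (\<gamma> t) (2 * r))"
        "emeasure m B' \<le> emeasure m (mcball_of X (\<gamma> t') (2 * r))"
        unfolding B_def B'_def using r by (auto intro!: emeasure_mono)
      then show "emeasure m B < \<infinity>" "emeasure m B' < \<infinity>"
        using fin2[OF t01(1)] fin2[OF t01(2)] by (auto intro: le_less_trans)
    qed
    have pos: "0 < emeasure m (B \<inter> mball_of X x \<rho>)" if "x \<in> B" "\<rho> > 0" for x \<rho>
      using ball_intersection_pos[OF r(1) rR(2)] that fin by (simp add: B_def)
    have pos': "0 < emeasure m (B' \<inter> mball_of X x \<rho>)" if "x \<in> B'" "\<rho> > 0" for x \<rho>
      using ball_intersection_pos[OF r(1) rR(2)] that fin by (simp add: B'_def)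
    have mB: "0 < emeasure m B" "0 < emeasure m B'"
    proof -
      have "0 < emeasure m (mball_of X (\<gamma> t) r)" "0 < emeasure m (mball_of X (\<gamma> t') r)"
        using gX r by (auto intro: ball_pos)
      moreover have "emeasure m (mball_of X (\<gamma> t) r) \<le> emeasure m B" "emeasure m (mball_of X (\<gamma> t') r) \<le> emeasure m B'"
        unfolding B_def B'_def by (auto intro!: emeasure_mono)
      ultimately show "0 < emeasure m B" "0 < emeasure m B'" by (auto intro: less_le_trans)
    qed
    note ex = geodesic_ball_contraction[OF g \<sigma> \<sigma>L[unfolded L_def] r(1) rR(1) fin2]
    obtain f where f: "ball_contraction X m c B B' f"
      using ex[OF _ t(1,2) \<delta>(2), of c] t(3) c \<delta>(3) unfolding B_def B'_def by auto
    obtain h where h: "ball_contraction X m c B' B h"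
      using ex[OF _ t(2,1) \<delta>(2), of c] t(3) c \<delta>(3) unfolding B_def B'_def by (auto simp: abs_minus_commute)
    \<comment> \<open>The map back, tested on the whole ball \<open>B\<close>, compares the two
      total masses.\<close>
    have "c * measure m (h -` B \<inter> B') \<le> measure m (B \<inter> B)"
      using h ball_sets(2)[of "\<gamma> t" r] unfolding ball_contraction_def B_def by blast
    moreover have "h -` B \<inter> B' = B'" using h by (auto simp: ball_contraction_def)
    ultimately have cm: "c * measure m B' \<le> measure m B" by simp
    have hf: "ball_contraction X m (c\<^sup>2) B B (h \<circ> f)"
      using c by (intro ball_contraction_comp[OF f h]) (auto simp: B'_def)
    have vol: "v * measure m B \<le> measure m (B \<inter> mcball_of X x (\<epsilon> * r / 8))" if "x \<in> B" for x
      using ball_volume[OF r(1) rR(2), of x "\<gamma> t" "\<epsilon> / 16"] that \<epsilon> fin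
      by (simp add: B_def v_def)
    \<comment> \<open>The composite is almost isometric, and since \<open>h\<close> does not
      increase distances, the loss under \<open>f\<close> alone is no larger.\<close>
    have near: "mdist X x y - \<epsilon> * r \<le> mdist X (f x) (f y)" if "x \<in> B" "y \<in> B" for x y
    proof -
      have "mdist X x y - \<epsilon> * r \<le> mdist X ((h \<circ> f) x) ((h \<circ> f) y)"
        using c by (intro ball_contraction_almost_isometric[OF gX(1) r(1) B_def mB(1) fin(1) hf _ \<epsilon>(1) v vol gap that]) auto
      also have "\<dots> \<le> mdist X (f x) (f y)"
      proof -
        have "f x \<in> B'" "f y \<in> B'" using f that by (auto simp: ball_contraction_def)
        then show ?thesis using h by (simp add: ball_contraction_def)
      qed
      finally show ?thesis .
    qed
    have "sturm_distance (normalized_ball X m (\<gamma> t) r) (normalized_ball X m (\<gamma> t') r)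
        \<le> ennreal (sqrt (\<epsilon>\<^sup>2 + (1 - c\<^sup>2) * (2 + \<epsilon>)\<^sup>2))"
      using sturm_distance_balls[OF gX r(1) B_def B'_def mB(1) fin(1) mB(2) fin(2) f c(1) _ cm \<epsilon>(1) near pos pos'] c(2)
      by simp
    also have "\<dots> < ennreal \<epsilon>0"
    proof (rule ennreal_lessI)
      show "sqrt (\<epsilon>\<^sup>2 + (1 - c\<^sup>2) * (2 + \<epsilon>)\<^sup>2) < \<epsilon>0"
        using final \<open>\<epsilon>0 > 0\<close> by (intro real_less_lsqrt) auto
    qed (use \<open>\<epsilon>0 > 0\<close> in auto)
    finally show ?thesis .
  qed
  then show "\<exists>\<delta>>0. \<exists>r0>0. \<forall>r t t'. 0 < r \<and> r < r0 \<and>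
       t \<in> {s0..1 - s0} \<and> t' \<in> {s0..1 - s0} \<and> \<bar>t - t'\<bar> < \<delta> \<longrightarrow>
       sturm_distance (normalized_ball X m (\<gamma> t) r) (normalized_ball X m (\<gamma> t') r) < ennreal \<epsilon>0"
    using \<delta>(1) \<sigma>(1) r0 by (intro exI[of _ "\<delta> * \<sigma>"] conjI exI[of _ r0]) auto
qed

end
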